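(* Let $k\ge2$ be an integer and let $n,\ell$ be positive integers with $n>\ell$ and $(k,n,\ell)\neq(2,6,4)$. Then $$p_k(n-1)\,p_k(\ell+1)\ \ge\ p_k(n)\,p_k(\ell).$$ In particular, $p_2(n)$ is log-concave for $n\ge6$, that is, $p_2(n)^2\ge p_2(n-1)p_2(n+1)$ for all integers $n\ge 6$; and for every integer $k\ge3$, $p_k(n)$ is log-concave for all $n$, that is, $p_k(n)^2\ge p_k(n-1)p_k(n+1)$ for all integers $n\ge1$.
   Context: For a positive integer $k$, $p_k(n)$ is the number of $k$-colored partitions of $n$, defined by $\prod_{m\ge1}(1-q^m)^{-k}=\sum_{n\ge0}p_k(n)q^n$. *)

theory Defs
  imports "HOL-Analysis.Analysis"
begin

text \<open>
  The infinite product is taken in the ring of formal power series with its usual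
  (coefficientwise) topology. Since \<^term>\<open>prodinf\<close> starts at index 0, the factor for \<open>m \<ge> 1\<close>
  is found at index \<open>m - 1\<close>. Convergence is shown below in \<open>colored_partition_fps_has_prod\<close>.
\<close>

definition colored_partition_fps :: "nat \<Rightarrow> real fps" where
  "colored_partition_fps k = (\<Prod>m. inverse ((1 - fps_X ^ Suc m) ^ k))"

definition colored_partitions :: "nat \<Rightarrow> nat \<Rightarrow> real" where
  "colored_partitions k n = fps_nth (colored_partition_fps k) n"

lemma colored_partition_factor:
  "\<exists>h. inverse ((1 - fps_X ^ Suc m) ^ k) = 1 + fps_X ^ Suc m * (h :: real fps)"
proof -
  define x :: "real fps" where "x = fps_X ^ Suc m"
  define B where "B = (1 - x) ^ k"
  have x0: "fps_nth x 0 = 0" by (simp add: x_def)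
  have "\<exists>g. (1 - x) ^ k = 1 - x * g"
  proof (induction k)
    case 0
    show ?case by (intro exI[of _ 0]) simp
  next
    case (Suc k)
    then obtain g where g: "(1 - x) ^ k = 1 - x * g" ..
    have "(1 - x) ^ Suc k = 1 - x * (1 + g - x * g)"
      unfolding power_Suc g by (simp add: algebra_simps)
    thus ?case ..
  qed
  then obtain g where g: "B = 1 - x * g" unfolding B_def ..
  have "fps_nth B 0 = 1" unfolding B_def by (simp add: fps_power_zeroth x0)
  hence "inverse B * B = 1" by (intro inverse_mult_eq_1) auto
  hence "inverse B * (1 - x * g) = 1" by (simp only: g)
  hence "inverse B = 1 + x * (g * inverse B)" by (simp add: algebra_simps)
  thus ?thesis unfolding B_def x_def by blast
qed

lemma colored_partition_prod_stable:
  assumes "i \<le> N"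
  shows "fps_nth (\<Prod>m\<le>N. inverse ((1 - fps_X ^ Suc m) ^ k) :: real fps) i =
         fps_nth (\<Prod>m\<le>i. inverse ((1 - fps_X ^ Suc m) ^ k)) i"
  using assms
proof (induction N rule: dec_induct)
  case (step N)
  obtain h :: "real fps"
    where h: "inverse ((1 - fps_X ^ Suc (Suc N)) ^ k) = 1 + fps_X ^ Suc (Suc N) * h"
    using colored_partition_factor by blast
  define P where "P = (\<Prod>m\<le>N. inverse ((1 - fps_X ^ Suc m) ^ k) :: real fps)"
  have "(\<Prod>m\<le>Suc N. inverse ((1 - fps_X ^ Suc m) ^ k) :: real fps) =
        P + fps_X ^ Suc (Suc N) * (P * h)"
    unfolding prod.atMost_Suc h P_def by (simp add: algebra_simps)
  moreover have "fps_nth (fps_X ^ Suc (Suc N) * (P * h)) i = 0"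
    using step.hyps unfolding fps_X_power_mult_nth by simp
  ultimately show ?case using step.IH by (simp add: P_def)
qed simp

lemma colored_partition_fps_has_prod:
  "(\<lambda>m. inverse ((1 - fps_X ^ Suc m) ^ k)) has_prod colored_partition_fps k"
proof -
  define f :: "nat \<Rightarrow> real fps" where "f = (\<lambda>m. inverse ((1 - fps_X ^ Suc m) ^ k))"
  define L where "L = Abs_fps (\<lambda>i. fps_nth (prod f {..i}) i)"
  have "(\<lambda>N. prod f {..N}) \<longlonglongrightarrow> L"
  proof (rule tendsto_fpsI)
    fix i
    show "eventually (\<lambda>N. fps_nth (prod f {..N}) i = fps_nth L i) sequentially"
      using eventually_ge_at_top[of i]
      by eventually_elim
         (unfold L_def f_def fps_nth_Abs_fps, rule colored_partition_prod_stable)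
  qed
  moreover have "fps_nth L 0 = 1"
    by (simp add: L_def f_def fps_power_zeroth)
  hence "L \<noteq> 0" by auto
  ultimately have "f has_prod L"
    by (simp add: has_prod_def raw_has_prod_def)
  thus ?thesis
    using has_prod_unique[of f L] unfolding colored_partition_fps_def f_def by simp
qed

lemma colored_partitions_eq_finite_prod:
  "colored_partitions k n = fps_nth (\<Prod>m\<le>n. inverse ((1 - fps_X ^ Suc m) ^ k)) n"
proof -
  define f :: "nat \<Rightarrow> real fps" where "f = (\<lambda>m. inverse ((1 - fps_X ^ Suc m) ^ k))"
  have nz: "f i \<noteq> 0" for i
  proof -
    have "fps_nth (f i) 0 = 1" by (simp add: f_def fps_power_zeroth)
    thus ?thesis by auto
  qed
  have "(\<lambda>N. prod f {..N}) \<longlonglongrightarrow> colored_partition_fps k"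
    using colored_partition_fps_has_prod[of k] nz
    unfolding f_def[symmetric] has_prod_def raw_has_prod_def by auto
  hence "eventually (\<lambda>N. fps_nth (prod f {..N}) n = colored_partitions k n) sequentially"
    unfolding tendsto_fps_iff colored_partitions_def by blast
  with eventually_ge_at_top[of n]
  have "eventually (\<lambda>N. fps_nth (prod f {..n}) n = colored_partitions k n) sequentially"
  proof eventually_elim
    case (elim N)
    thus ?case using colored_partition_prod_stable[of n N k] unfolding f_def by simp
  qed
  thus ?thesis by (simp add: f_def)
qed

end

theory Submission
  imports Defs "HOL-Complex_Analysis.Complex_Analysis"
begin

text \<open>
  Let \<open>F(z) = \<Sum>\<^sub>n p\<^sub>k(n) z\<^sup>n\<close> and \<open>r = e\<^sup>-\<^sup>t\<close>. By the inequality between arithmetic and geometric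
  means, \<open>p\<^sub>k(n)\<^sup>2 \<ge> p\<^sub>k(n-1) p\<^sub>k(n+1)\<close> holds as soon as
  \<open>2 r\<^sup>n p\<^sub>k(n) \<ge> r\<^sup>n\<^sup>-\<^sup>1 p\<^sub>k(n-1) + r\<^sup>n\<^sup>+\<^sup>1 p\<^sub>k(n+1)\<close> for a single \<open>t > 0\<close>, and by Cauchy's formula this
  is the statement that \<open>Re (F(r e\<^sup>i\<^sup>\<theta>) e\<^sup>-\<^sup>i\<^sup>n\<^sup>\<theta>) (1 - cos \<theta>)\<close> has a nonnegative integral over a
  period. We choose \<open>t\<close> such that the phase of \<open>F(r e\<^sup>i\<^sup>\<theta>) e\<^sup>-\<^sup>i\<^sup>n\<^sup>\<theta>\<close> vanishes to third order at \<open>0\<close>.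
  With \<open>log F(z) = k \<Sum>\<^sub>N (\<sigma>(N) / N) z\<^sup>N\<close> and \<open>\<lambda> = k / t\<close>, the modulus then is bounded below by a
  Gaussian, and both the phase and the contribution of \<open>\<theta>\<close> of larger order than \<open>t\<close> are negligible
  once \<open>\<lambda> \<ge> 32\<close>, with no need for the modular transformation of \<open>F\<close>. For \<open>2 \<le> k \<le> 5\<close> this
  leaves the finitely many \<open>n\<close> with \<open>k n < 1685\<close>, which are checked by evaluating the recurrence
  that comes from the pentagonal number theorem. Finally the convolution of positive log-concave
  sequences is log-concave, and every \<open>k \<ge> 3\<close> is a sum of numbers \<open>3\<close>, \<open>4\<close> and \<open>5\<close>.
\<close>

section \<open>The recurrence and the pentagonal number theorem\<close>

text \<open>In the scale \<theta> = t u the bounds depend on \<lambda> alone: the modulus decays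
  like exp(-c \<lambda> u^2), and the phase is at most of order \<lambda> u^3. The weight
  \<open>1 - cos \<theta>\<close> vanishes at the peak, so the main term is a second moment, of
  order t^3 \<lambda>^(-3/2). A phase error p^2/2 makes it an eighth moment, smaller only by a
  factor of order 1/\<lambda>; at \<lambda> = 32 little room is left, and the constants are tuned to
  that value. The modular transformation is replaced by writing \<sigma>(N)/N as the sum of 1/j over
  the divisors j of N: this splits log F into elementary functions of exp(-j t), whose upper bounds
  are homogeneous in j t and add up to multiples of \<pi>^2/6. The condition \<lambda> \<ge> 32
  means t \<le> k/32, which the choice of t permits once k n \<ge> 1024 \<pi>^2/6, about 1684.4.
  Only k \<le> 5 is treated directly, so that t \<le> 5/32 keeps j t small for the four j that are
  used. The sequence p_2 cannot serve as a factor of the convolutions: it violates log-concavity at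
  1 and at 5.\<close>

definition divisor_sum :: "nat \<Rightarrow> nat" where
  "divisor_sum n = \<Sum>{d. d dvd n}"

lemma divisor_sum_0 [simp]: "divisor_sum 0 = 0"
proof -
  have "infinite {d :: nat. d dvd 0}" by simp
  thus ?thesis unfolding divisor_sum_def by (rule sum.infinite)
qed

definition euler_fps :: "nat \<Rightarrow> real fps" where
  "euler_fps N = (\<Prod>m<N. 1 - fps_X ^ Suc m)"

lemma euler_fps_nth_0 [simp]: "fps_nth (euler_fps N) 0 = 1"
  by (induction N) (simp_all add: euler_fps_def fps_mult_nth_0)

text \<open>Coefficients below \<open>N\<close> see only the first \<open>N\<close> factors, so
  identities between coefficients can be proved with one finite product, without limits.\<close>

lemma colored_partitions_eq_euler:
  assumes "n < N"
  shows "colored_partitions k n = fps_nth (inverse (euler_fps N ^ k)) n"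
proof -
  obtain M where M: "N = Suc M" "n \<le> M" using assms by (cases N) auto
  have "(\<Prod>m\<le>L. inverse ((1 - fps_X ^ Suc m) ^ k)) = inverse (euler_fps (Suc L) ^ k)" for L
    by (induction L)
       (simp_all add: euler_fps_def fps_inverse_mult power_mult_distrib mult.commute)
  thus ?thesis
    using colored_partition_prod_stable[OF M(2), of k]
    by (simp add: colored_partitions_eq_finite_prod M(1))
qed

text \<open>One factor of the Euler product turns \<open>Suc k\<close> colors into \<open>k\<close>.
  Read backwards, p_(k+1) is the quotient of p_k by the Euler product, which is how the initial
  values are computed.\<close>

lemma euler_fps_mult_colored_partitions:
  assumes "n < N"
  shows "colored_partitions k n =
         (\<Sum>i=0..n. fps_nth (euler_fps N) i * colored_partitions (Suc k) (n - i))"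
proof -
  define E where "E = euler_fps N"
  have [simp]: "fps_nth (E ^ k) 0 = 1" for k by (simp add: E_def fps_power_zeroth)
  have "inverse E * E = 1" by (rule inverse_mult_eq_1) (simp add: E_def)
  hence "inverse (E ^ k) = E * inverse (E ^ Suc k)"
    by (simp add: fps_inverse_mult mult.assoc [symmetric] mult.commute)
  hence "colored_partitions k n = fps_nth (E * inverse (E ^ Suc k)) n"
    using colored_partitions_eq_euler[OF assms] by (simp add: E_def)
  also have "\<dots> = (\<Sum>i=0..n. fps_nth E i * colored_partitions (Suc k) (n - i))"
    unfolding fps_mult_nth
    using assms by (intro sum.cong) (auto simp: E_def colored_partitions_eq_euler[of _ N])
  finally show ?thesis by (simp add: E_def)
qed

lemma colored_partitions_add:
  "colored_partitions (a + b) n =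
     (\<Sum>i=0..n. colored_partitions a i * colored_partitions b (n - i))"
proof -
  define E where "E = euler_fps (Suc n)"
  have "colored_partitions (a + b) n = fps_nth (inverse (E ^ a) * inverse (E ^ b)) n"
    by (simp add: colored_partitions_eq_euler[of n "Suc n"] E_def power_add fps_inverse_mult)
  also have "\<dots> = (\<Sum>i=0..n. colored_partitions a i * colored_partitions b (n - i))"
    unfolding fps_mult_nth
    by (intro sum.cong) (auto simp: E_def colored_partitions_eq_euler[of _ "Suc n"])
  finally show ?thesis .
qed

section \<open>Logarithmic derivative and the divisor-sum recurrence\<close>

definition multiples_fps :: "nat \<Rightarrow> real fps" where
  "multiples_fps d = Abs_fps (\<lambda>n. if n > 0 \<and> d dvd n then 1 else 0)"

lemma multiples_fps_mult:
  assumes "d > 0"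
  shows "multiples_fps d * (1 - fps_X ^ d) = fps_X ^ d"
proof (rule fps_ext)
  fix n
  show "fps_nth (multiples_fps d * (1 - fps_X ^ d)) n = fps_nth (fps_X ^ d :: real fps) n"
    using assms
    by (cases "n < d") (auto simp: right_diff_distrib fps_X_power_mult_right_nth multiples_fps_def
        fps_X_power_nth dvd_minus_self nat_dvd_not_less dest: dvd_imp_le)
qed

text \<open>Logarithmic derivative, multiplied out: the factor 1 - x^d contributes -d x^d/(1 - x^d)
  to x E'/E, and \<open>multiples_fps d\<close> is the series x^d/(1 - x^d).\<close>

lemma euler_fps_deriv:
  "fps_X * fps_deriv (euler_fps N) =
     - euler_fps N * (\<Sum>m<N. fps_const (real (Suc m)) * multiples_fps (Suc m))"
proof (induction N)
  case 0
  show ?case by (simp add: euler_fps_def)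
next
  case (Suc N)
  define A where "A = (\<Sum>m<N. fps_const (real (Suc m)) * multiples_fps (Suc m))"
  define x where "x = (fps_X ^ Suc N :: real fps)"
  define M where "M = multiples_fps (Suc N)"
  define c where "c = fps_const (real (Suc N))"
  have E: "euler_fps (Suc N) = euler_fps N * (1 - x)" by (simp add: euler_fps_def x_def)
  have Mx: "M * (1 - x) = x" unfolding M_def x_def by (rule multiples_fps_mult) simp
  have "fps_deriv (fps_X ^ Suc N :: real fps) = c * fps_X ^ N"
    by (simp only: fps_deriv_power c_def) simp
  hence dx: "fps_X * fps_deriv x = c * x" by (simp add: x_def algebra_simps)
  have "fps_X * fps_deriv (euler_fps (Suc N)) =
        (fps_X * fps_deriv (euler_fps N)) * (1 - x) - euler_fps N * (fps_X * fps_deriv x)"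
    unfolding E by (simp add: algebra_simps)
  also have "\<dots> = - euler_fps N * A * (1 - x) - euler_fps N * (c * (M * (1 - x)))"
    unfolding Suc.IH[folded A_def] dx Mx by simp
  also have "\<dots> = - euler_fps (Suc N) * (A + c * M)" unfolding E by (simp add: algebra_simps)
  finally show ?case by (simp add: A_def c_def M_def)
qed

lemma sum_multiples_fps_nth:
  assumes "n \<le> N"
  shows "fps_nth (\<Sum>m<N. fps_const (real (Suc m)) * multiples_fps (Suc m)) n = real (divisor_sum n)"
proof (cases "n = 0")
  case False
  have "fps_nth (\<Sum>m<N. fps_const (real (Suc m)) * multiples_fps (Suc m)) n =
        (\<Sum>m<N. if Suc m dvd n then real (Suc m) else 0)"
    using False by (simp add: fps_sum_nth multiples_fps_def if_distrib cong: if_cong)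
  also have "\<dots> = (\<Sum>d\<in>{1..N}. if d dvd n then real d else 0)"
    by (rule sum.reindex_bij_witness[of _ "\<lambda>d. d - 1" Suc]) auto
  also have "\<dots> = (\<Sum>d\<in>{d. d dvd n}. real d)"
    using False assms
    by (intro sum.mono_neutral_cong_right[OF finite_atLeastAtMost])
       (auto dest: dvd_imp_le dvd_pos_nat intro: order_trans[OF dvd_imp_le] intro!: Suc_leI)
  finally show ?thesis by (simp add: divisor_sum_def)
qed (simp add: fps_sum_nth multiples_fps_def)

text \<open>Comparison of coefficients in x F' = k A F, where F = E^(-k) and A is the series of the
  divisor sums. The sum may start at \<open>i = 0\<close> because \<open>divisor_sum 0\<close> is 0.
  The recurrence gives positivity and later identifies the Taylor coefficients of the complex
  generating function.\<close>

lemma colored_partitions_rec: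
  "real n * colored_partitions k n =
     real k * (\<Sum>i=0..n. real (divisor_sum i) * colored_partitions k (n - i))"
proof (cases k)
  case 0
  show ?thesis
    using colored_partitions_eq_euler[of n "Suc n" 0] 0 by (cases n) auto
next
  case (Suc k')
  define E where "E = euler_fps (Suc n)"
  define A where "A = (\<Sum>m<Suc n. fps_const (real (Suc m)) * multiples_fps (Suc m))"
  define F where "F = inverse (E ^ k)"
  have [simp]: "fps_nth (E ^ k) 0 = 1" for k by (simp add: E_def fps_power_zeroth)
  have FE: "F * E ^ k = 1" unfolding F_def by (rule inverse_mult_eq_1) simp
  have dE: "fps_X * fps_deriv E = - E * A" unfolding E_def A_def by (rule euler_fps_deriv)
  have "fps_X * fps_deriv F = - (fps_X * fps_deriv (E ^ k)) * F\<^sup>2"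
    unfolding F_def by (subst fps_inverse_deriv) (simp_all add: algebra_simps)
  also have "fps_X * fps_deriv (E ^ k) = of_nat k * E ^ k' * (fps_X * fps_deriv E)"
    by (simp only: Suc fps_deriv_power fps_of_nat diff_Suc_1 mult_ac)
  also have "\<dots> = - of_nat k * E ^ k * A" 
    unfolding dE Suc power_Suc by (simp only: mult_minus_left mult_minus_right mult_ac)
  also have "- \<dots> * F\<^sup>2 = of_nat k * (A * F) * (F * E ^ k)"
    by (simp add: algebra_simps power2_eq_square)
  finally have *: "fps_X * fps_deriv F = of_nat k * (A * F)" unfolding FE by simp
  have XF: "fps_nth (fps_X * fps_deriv F) n = real n * colored_partitions k n"
    by (cases n) (auto simp: F_def E_def colored_partitions_eq_euler[of _ "Suc n"])
  have A_nth: "fps_nth A i = real (divisor_sum i)" if "i \<le> n" for i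
    unfolding A_def using that by (intro sum_multiples_fps_nth) simp
  have "fps_nth (of_nat k * (A * F)) n =
                   real k * (\<Sum>i=0..n. real (divisor_sum i) * colored_partitions k (n - i))"
    unfolding fps_of_nat [symmetric] fps_mult_left_const_nth fps_mult_nth[of A F]
    by (intro arg_cong2[where f = "(*)"] refl sum.cong)
       (auto simp: A_nth F_def E_def colored_partitions_eq_euler[of _ "Suc n"])
  with XF show ?thesis unfolding * by (simp only:)
qed

lemma colored_partitions_0 [simp]: "colored_partitions k 0 = 1"
  using colored_partitions_eq_euler[of 0 1 k] by (simp add: fps_power_zeroth)

lemma divisor_sum_pos: "n > 0 \<Longrightarrow> divisor_sum n > 0"
  unfolding divisor_sum_def by (rule sum_pos2[of _ 1]) auto

lemma colored_partitions_pos: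
  assumes "k > 0"
  shows "colored_partitions k n > 0"
proof (induction n rule: less_induct)
  case (less n)
  show ?case
  proof (cases "n = 0")
    case False
    have nonneg: "0 \<le> real (divisor_sum i) * colored_partitions k (n - i)" if "i \<in> {0..n}" for i
      using less.IH[of "n - i"] that by (cases "i = 0") (auto intro!: mult_nonneg_nonneg)
    have "0 < (\<Sum>i=0..n. real (divisor_sum i) * colored_partitions k (n - i))"
      using divisor_sum_pos[of n] False nonneg by (intro sum_pos2[of _ n]) auto
    hence "0 < real n * colored_partitions k n"
      unfolding colored_partitions_rec[of n k] using assms by simp
    thus ?thesis using False by (simp add: zero_less_mult_iff)
  qed simp
qed

text \<open>Shanks's finite form of the pentagonal number theorem. In passing from \<open>n\<close>
  to \<open>Suc n\<close>, the terms with \<open>s \<le> n\<close> change by a telescoping sum with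
  value \<open>- U n\<close>; this and the new term \<open>s = Suc n\<close> are exactly the two new
  pentagonal powers.\<close>

lemma euler_identity_shanks:
  fixes q :: "'a :: comm_ring_1"
  shows "(\<Sum>s\<le>n. (-1) ^ s * (\<Prod>i\<in>{s<..n}. 1 - q ^ i) * q ^ (s * n + s * (s + 1) div 2)) =
         1 + (\<Sum>i\<in>{1..n}. (-1) ^ i * (q ^ (i * (3 * i - 1) div 2) + q ^ (i * (3 * i + 1) div 2)))"
proof (induction n)
  case (Suc n)
  define R where "R = (\<lambda>s. (\<Prod>i\<in>{s<..n}. 1 - q ^ i))"
  define e where "e = (\<lambda>s :: nat. s * n + s * (s + 1) div 2)"
  have e_Suc: "e (Suc s) = e s + s + n + 1" for s
  proof -
    have "Suc s * (Suc s + 1) div 2 = (s * (s + 1) + (s + 1) * 2) div 2"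
      by (simp add: algebra_simps)
    also have "\<dots> = s * (s + 1) div 2 + (s + 1)" by simp
    finally show ?thesis by (simp add: e_def)
  qed
  have R_Suc: "R s = (1 - q ^ Suc s) * R (Suc s)" if "s < n" for s
  proof -
    have "{s<..n} = insert (Suc s) {Suc s<..n}" using that by auto
    thus ?thesis by (simp add: R_def)
  qed
  have RS: "(\<Prod>i\<in>{s<..Suc n}. 1 - q ^ i) = R s * (1 - q ^ Suc n)" if "s \<le> n" for s
  proof -
    have "{s<..Suc n} = insert (Suc n) {s<..n}" using that by auto
    thus ?thesis by (simp add: R_def mult.commute)
  qed
  define T where "T = (\<lambda>s. (-1) ^ s * R s * q ^ e s)"
  define U where "U = (\<lambda>s. (-1) ^ s * R s * q ^ e (Suc s))"
  have tele: "(\<Sum>s\<le>m. (-1) ^ s * R s * (1 - q ^ Suc n) * q ^ (e s + s) - T s) = - U m" if "m \<le> n" for m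
    using that
  proof (induction m)
    case 0
    show ?case by (simp add: T_def U_def e_Suc) (simp add: e_def algebra_simps)
  next
    case (Suc m)
    have "(-1) ^ Suc m * R (Suc m) * (1 - q ^ Suc n) * q ^ (e (Suc m) + Suc m) - T (Suc m) - U m
          = - U (Suc m)"
      unfolding T_def U_def e_Suc[of "Suc m"] R_Suc[OF Suc_le_lessD[OF Suc.prems]]
      by (simp add: power_add algebra_simps)
    with Suc show ?case by simp
  qed
  have "(\<Sum>s\<le>Suc n. (-1) ^ s * (\<Prod>i\<in>{s<..Suc n}. 1 - q ^ i) * q ^ (s * Suc n + s * (s + 1) div 2))
        = (\<Sum>s\<le>n. (-1) ^ s * R s * (1 - q ^ Suc n) * q ^ (e s + s)) +
          (-1) ^ Suc n * q ^ (Suc n * Suc n + Suc n * (Suc n + 1) div 2)"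
    by (simp add: RS e_def algebra_simps)
  also have "(\<Sum>s\<le>n. (-1) ^ s * R s * (1 - q ^ Suc n) * q ^ (e s + s)) = (\<Sum>s\<le>n. T s) - U n"
    using tele[OF order_refl] unfolding sum_subtractf
    by (simp only: diff_eq_eq uminus_add_conv_diff diff_add_cancel)
  also have "(\<Sum>s\<le>n. T s) = 1 + (\<Sum>i\<in>{1..n}. (-1) ^ i *
               (q ^ (i * (3 * i - 1) div 2) + q ^ (i * (3 * i + 1) div 2)))"
    using Suc.IH by (simp add: T_def R_def e_def)
  also have "U n = (-1) ^ n * q ^ (Suc n * (3 * Suc n - 1) div 2)"
  proof -
    have "Suc n * (3 * Suc n - 1) div 2 = (n * (n + 1) + (n * n + 2 * n + 1) * 2) div 2"
      by (simp add: algebra_simps)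
    also have "\<dots> = n * (n + 1) div 2 + (n * n + 2 * n + 1)" by simp
    finally have "e (Suc n) = Suc n * (3 * Suc n - 1) div 2"
      by (simp add: e_Suc) (simp add: e_def)
    thus ?thesis by (simp add: U_def R_def)
  qed
  also have "Suc n * Suc n + Suc n * (Suc n + 1) div 2 = Suc n * (3 * Suc n + 1) div 2"
  proof -
    have "Suc n * (3 * Suc n + 1) div 2 = (Suc n * (Suc n + 1) + Suc n * Suc n * 2) div 2"
      by (simp add: algebra_simps)
    also have "\<dots> = Suc n * (Suc n + 1) div 2 + Suc n * Suc n" by simp
    finally show ?thesis by simp
  qed
  finally show ?case by (simp add: algebra_simps)
qed simp

text \<open>In Shanks's identity at \<open>N\<close> the term \<open>s = 0\<close> is the Euler
  product, and each term with \<open>s > 0\<close> carries a power of at least N + 1. Up to index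
  \<open>N\<close> the product therefore agrees with the pentagonal sum.\<close>

lemma euler_fps_nth:
  assumes "i \<le> N"
  shows "fps_nth (euler_fps N) i = fps_nth (1 + (\<Sum>j\<in>{1..N}. (-1) ^ j *
           (fps_X ^ (j * (3 * j - 1) div 2) + fps_X ^ (j * (3 * j + 1) div 2)))) i"
proof -
  define f where "f = (\<lambda>s. (-1) ^ s * (\<Prod>i\<in>{s<..N}. 1 - fps_X ^ i) *
                       fps_X ^ (s * N + s * (s + 1) div 2) :: real fps)"
  have f_nth: "fps_nth (f s) i = 0" if "s > 0" for s
  proof -
    have "1 * N \<le> s * N" using that by (intro mult_right_mono) auto
    moreover have "s * (s + 1) div 2 \<ge> 1"
    proof -
      have "1 * 2 \<le> s * (s + 1)" using that by (intro mult_mono) auto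
      thus ?thesis by linarith
    qed
    ultimately have "i < s * N + s * (s + 1) div 2" using assms by linarith
    thus ?thesis unfolding f_def by (subst fps_X_power_mult_right_nth) simp
  qed
  have "fps_nth (\<Sum>s\<le>N. f s) i = (\<Sum>s\<le>N. fps_nth (f s) i)" by (rule fps_sum_nth)
  also have "\<dots> = (\<Sum>s\<in>{0}. fps_nth (f s) i)"
    by (rule sum.mono_neutral_right) (auto simp: f_nth)
  finally have sum_f: "fps_nth (\<Sum>s\<le>N. f s) i = fps_nth (f 0) i" by simp
  have "(\<Prod>i\<in>{0<..N}. 1 - fps_X ^ i) = euler_fps N"
    unfolding euler_fps_def by (rule prod.reindex_bij_witness[of _ Suc "\<lambda>i. i - 1"]) auto
  hence "f 0 = euler_fps N" by (simp add: f_def)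
  with sum_f show ?thesis
    unfolding f_def euler_identity_shanks by simp
qed

section \<open>Evaluation of the initial values\<close>

datatype braun = Leaf | Node int braun braun

fun lookup :: "braun \<Rightarrow> nat \<Rightarrow> int" where
  "lookup Leaf n = 0"
| "lookup (Node x l r) n =
     (if n = 0 then 0 else if n = 1 then x else lookup (if even n then l else r) (n div 2))"

text \<open>Prepending moves index i to i + 1: the even places become the odd ones, and the root
  followed by the old odd places fills the even ones. A single recursive call suffices, so the cost
  is logarithmic in a balanced tree.\<close>

fun push :: "int \<Rightarrow> braun \<Rightarrow> braun" where
  "push x Leaf = Node x Leaf Leaf"
| "push x (Node y l r) = Node x (push y r) l"

fun add_at :: "int \<Rightarrow> num \<Rightarrow> braun \<Rightarrow> braun" where
  "add_at c num.One Leaf = Node c Leaf Leaf"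
| "add_at c num.One (Node x l r) = Node (x + c) l r"
| "add_at c (num.Bit0 p) Leaf = Node 0 (add_at c p Leaf) Leaf"
| "add_at c (num.Bit0 p) (Node x l r) = Node x (add_at c p l) r"
| "add_at c (num.Bit1 p) Leaf = Node 0 Leaf (add_at c p Leaf)"
| "add_at c (num.Bit1 p) (Node x l r) = Node x l (add_at c p r)"

text \<open>A \<open>Leaf\<close> in either argument cuts off the whole subtree. With the sparse
  tree of pentagonal numbers as second argument, the cost is governed by its nonzero coefficients
  and not by the length of the history.\<close>

fun dot :: "braun \<Rightarrow> braun \<Rightarrow> int" where
  "dot Leaf u = 0"
| "dot (Node x l r) Leaf = 0"
| "dot (Node x l r) (Node c a b) = c * x + (dot l a + dot r b)"

text \<open>Power series division: \<open>u\<close> holds the negated coefficients of the divisor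
  from index 1 on, and \<open>h\<close> the quotient so far, newest first. Passing the new
  coefficient through \<open>divide_step\<close> has it evaluated once although it is used
  twice.\<close>

fun divide_series :: "braun \<Rightarrow> braun \<Rightarrow> int list \<Rightarrow> int list"
  and divide_step :: "braun \<Rightarrow> braun \<Rightarrow> int list \<Rightarrow> int \<Rightarrow> int list" where
  "divide_series u h [] = []"
| "divide_series u h (x # xs) = divide_step u h xs (x + dot h u)"
| "divide_step u h xs q = q # divide_series u (push q h) xs"

text \<open>The invariant is g = i(3i-1)/2, so \<open>g + i\<close> is the companion i(3i+1)/2, and
  the next g is larger by 3i+1. The value \<open>c\<close> is the negated sign of the pair, since
  the tree serves on the right-hand side of a recurrence; the first argument counts the
  pairs.\<close>

fun pentagonal_tree :: "nat \<Rightarrow> num \<Rightarrow> num \<Rightarrow> int \<Rightarrow> braun" where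
  "pentagonal_tree 0 i g c = Leaf"
| "pentagonal_tree (Suc f) i g c =
     add_at c g (add_at c (g + i) (pentagonal_tree f (i + num.One) (g + i + i + i + num.One) (- c)))"

fun strip_bits :: "nat \<Rightarrow> num \<Rightarrow> num" where
  "strip_bits 0 n = n"
| "strip_bits (Suc k) num.One = num.One"
| "strip_bits (Suc k) (num.Bit0 n) = strip_bits k n"
| "strip_bits (Suc k) (num.Bit1 n) = strip_bits k n"

fun half :: "num \<Rightarrow> num" where
  "half num.One = num.One"
| "half (num.Bit0 n) = n"
| "half (num.Bit1 n) = n"

text \<open>The first argument only counts halvings. Started with \<open>y\<close> stripped of 18
  bits, it leaves the 19 leading bits of \<open>y\<close>; adding one to \<open>x\<close> and
  \<open>z\<close> but not to \<open>y\<close> puts all truncation errors on the safe side.\<close>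

fun truncated_le_square :: "num \<Rightarrow> num \<Rightarrow> num \<Rightarrow> num \<Rightarrow> bool" where
  "truncated_le_square num.One x y z = ((x + num.One) * (z + num.One) \<le> y * y)"
| "truncated_le_square (num.Bit0 g) x y z = (y \<noteq> num.One \<and> truncated_le_square g (half x) (half y) (half z))"
| "truncated_le_square (num.Bit1 g) x y z = (y \<noteq> num.One \<and> truncated_le_square g (half x) (half y) (half z))"

text \<open>The products of a log-concavity condition are computed from the leading bits only:
  the condition holds with enough room for this outside of the first few terms.\<close>

definition le_square :: "num \<Rightarrow> num \<Rightarrow> num \<Rightarrow> bool" where
  "le_square x y z = (let g = strip_bits 18 y in
     if g = num.One then x * z \<le> y * y else truncated_le_square g x y z)"

definition num_of_int :: "int \<Rightarrow> num" where
  "num_of_int i = num_of_nat (nat i)"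

lemma num_of_int_code [code]:
  "num_of_int 0 = num.One" "num_of_int (Int.Pos n) = n" "num_of_int (Int.Neg n) = num.One"
  by (auto simp: num_of_int_def num_of_nat.simps nat_of_num_inverse)

fun log_concave_list :: "int list \<Rightarrow> bool" where
  "log_concave_list (x # y # z # zs) =
     (le_square (num_of_int x) (num_of_int y) (num_of_int z) \<and> log_concave_list (y # z # zs))"
| "log_concave_list _ = True"

text \<open>The library equations of \<open>take\<close> and \<open>drop\<close> branch with a case expression,
  which makes symbolic evaluation by the simplifier slow.\<close>

fun prefix_of :: "nat \<Rightarrow> int list \<Rightarrow> int list" where
  "prefix_of 0 xs = []"
| "prefix_of (Suc n) [] = []"
| "prefix_of (Suc n) (x # xs) = x # prefix_of n xs"

fun suffix_of :: "nat \<Rightarrow> int list \<Rightarrow> int list" where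
  "suffix_of 0 xs = xs"
| "suffix_of (Suc n) [] = []"
| "suffix_of (Suc n) (x # xs) = suffix_of n xs"

text \<open>Each pair \<open>(n, d)\<close> asks for one more division, with \<open>n\<close> terms
  kept; the first \<open>d\<close> terms of the quotient are exempt from the test.\<close>

fun check_quotients :: "braun \<Rightarrow> (nat \<times> nat) list \<Rightarrow> int list \<Rightarrow> bool"
  and check_quotient :: "braun \<Rightarrow> (nat \<times> nat) list \<Rightarrow> nat \<Rightarrow> int list \<Rightarrow> bool" where
  "check_quotients u [] xs = True"
| "check_quotients u ((n, d) # ps) xs = check_quotient u ps d (divide_series u Leaf (prefix_of n xs))"
| "check_quotient u ps d ys = (log_concave_list (suffix_of d ys) \<and> check_quotients u ps ys)"

section \<open>Correctness of the evaluation\<close>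

lemma prefix_of_eq_take: "prefix_of n xs = take n xs"
  by (induction n xs rule: prefix_of.induct) auto

lemma suffix_of_eq_drop: "suffix_of n xs = drop n xs"
  by (induction n xs rule: suffix_of.induct) auto

lemma lookup_0 [simp]: "lookup t 0 = 0" by (cases t) auto

lemma lookup_push:
  "lookup (push x t) (Suc n) = (if n = 0 then x else lookup t n)"
proof (induction x t arbitrary: n rule: push.induct)
  case (2 x y l r)
  show ?case
  proof (cases "odd n")
    case True
    then obtain m where "n = 2 * m + 1" by (elim oddE)
    thus ?thesis using 2[of m] by (cases m) auto
  next
    case False
    then obtain m where "n = 2 * m" by auto
    thus ?thesis by (cases m) auto
  qed
qed auto

lemma lookup_add_at:
  "lookup (add_at c p t) n = lookup t n + (if n = nat_of_num p then c else 0)"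
proof (induction c p t arbitrary: n rule: add_at.induct)
  case (3 c p)
  show ?case using nat_of_num_pos[of p] by (auto simp: 3 elim!: evenE)
next
  case (4 c p x l r)
  show ?case using nat_of_num_pos[of p] by (auto simp: 4 elim!: evenE)
next
  case (5 c p)
  show ?case using nat_of_num_pos[of p] by (auto simp: 5 elim!: evenE oddE)
next
  case (6 c p x l r)
  show ?case using nat_of_num_pos[of p] by (auto simp: 6 elim!: evenE oddE)
qed auto

lemma dot_eq:
  assumes "\<And>n. n > N \<Longrightarrow> lookup h n = 0"
  shows "dot h u = (\<Sum>i=1..N. lookup u i * lookup h i)"
  using assms
proof (induction h u arbitrary: N rule: dot.induct)
  case (3 x l r c a b)
  define M where "M = N div 2"
  define f where "f = (\<lambda>i. lookup (Node c a b) i * lookup (Node x l r) i)"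
  have l: "lookup l n = 0" if "n > M" for n
    using "3.prems"[of "2 * n"] that by (auto simp: M_def)
  have r: "lookup r n = 0" if "n > M" for n
    using "3.prems"[of "2 * n + 1"] that by (auto simp: M_def)
  \<comment> \<open>The upper limit is padded to an odd number, so that the indices above 1 fall
    into pairs \<open>2 * i\<close>, \<open>2 * i + 1\<close>, one member for each subtree.\<close>
  have "(\<Sum>i=1..N. f i) = (\<Sum>i=1..2*M+1. f i)"
    by (rule sum.mono_neutral_left) (auto simp: f_def M_def 3 simp del: lookup.simps)
  also have "\<dots> = f 1 + (\<Sum>i=1..M. f (2 * i) + f (2 * i + 1))"
  proof (induction M)
    case (Suc M)
    have "{1..2 * Suc M + 1} = insert (2 * M + 3) (insert (2 * M + 2) {1..2 * M + 1})" by auto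
    thus ?case using Suc by (simp add: eval_nat_numeral)
  qed simp
  also have "(\<Sum>i=1..M. f (2 * i) + f (2 * i + 1)) =
             (\<Sum>i=1..M. lookup a i * lookup l i) + (\<Sum>i=1..M. lookup b i * lookup r i)"
    unfolding sum.distrib [symmetric] by (intro sum.cong) (auto simp: f_def)
  also have "f 1 = c * x" by (simp add: f_def)
  finally show ?case using 3(1)[of M] 3(2)[of M] l r by (simp add: f_def)
qed auto

text \<open>Invariant: after \<open>n\<close> coefficients, index \<open>i\<close> of
  \<open>h\<close> holds \<open>q (n - i)\<close>. The dot product with \<open>u\<close> is then the
  convolution in the recurrence, and \<open>push\<close> restores the invariant.\<close>

lemma divide_series_correct:
  fixes s q :: "nat \<Rightarrow> real"
  assumes "map of_int xs = map s [n..<N]"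
    and "\<And>i. of_int (lookup h i) = (if 1 \<le> i \<and> i \<le> n then q (n - i) else 0)"
    and "\<And>m. m < N \<Longrightarrow> q m = s m + (\<Sum>i=1..m. of_int (lookup u i) * q (m - i))"
  shows "map of_int (divide_series u h xs) = map q [n..<N]"
  using assms(1,2)
proof (induction xs arbitrary: n h)
  case Nil
  thus ?case by simp
next
  case (Cons x xs)
  have "n < N" using Cons.prems(1) by (cases "n < N") auto
  hence upt: "[n..<N] = n # [Suc n..<N]" by (simp add: upt_conv_Cons)
  have xs: "map of_int xs = map s [Suc n..<N]" and x: "of_int x = s n"
    using Cons.prems(1) upt by auto
  have "lookup h i = 0" if "i > n" for i
    using Cons.prems(2)[of i] that by simp
  hence "of_int (dot h u) = (\<Sum>i=1..n. of_int (lookup u i) * of_int (lookup h i) :: real)"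
    by (subst dot_eq[of n]) auto
  also have "\<dots> = (\<Sum>i=1..n. of_int (lookup u i) * q (n - i))"
    by (intro sum.cong) (auto simp: Cons.prems(2))
  finally have q: "of_int (x + dot h u) = q n"
    using assms(3)[OF \<open>n < N\<close>] x by simp
  have "of_int (lookup (push (x + dot h u) h) i) =
          (if 1 \<le> i \<and> i \<le> Suc n then q (Suc n - i) else 0)" for i
    using q Cons.prems(2)[of "i - 1"] by (cases i) (auto simp: lookup_push)
  from Cons.IH[OF xs this] show ?case using q by (simp add: upt)
qed

lemma of_int_lookup_pentagonal_tree:
  assumes "0 < j" "nat_of_num i = j" "nat_of_num g = j * (3 * j - 1) div 2"
  shows "of_int (lookup (pentagonal_tree f i g ((-1) ^ Suc j)) n) =
         (- (\<Sum>j\<in>{j..<j+f}. (-1) ^ j * (fps_nth (fps_X ^ (j * (3 * j - 1) div 2)) n +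
                 fps_nth (fps_X ^ (j * (3 * j + 1) div 2)) n)) :: real)"
  using assms
proof (induction f arbitrary: i g j)
  case (Suc f)
  have "Suc j * (3 * Suc j - 1) div 2 = (j * (3 * j - 1) + (3 * j + 1) * 2) div 2"
    using Suc.prems(1) by (cases j) (simp_all add: algebra_simps)
  hence g': "Suc j * (3 * Suc j - 1) div 2 = j * (3 * j - 1) div 2 + (3 * j + 1)" by simp
  have "j * (3 * j + 1) div 2 = (j * (3 * j - 1) + j * 2) div 2"
    using Suc.prems(1) by (cases j) (simp_all add: algebra_simps)
  hence gi: "j * (3 * j + 1) div 2 = j * (3 * j - 1) div 2 + j" by simp
  have "of_int (lookup (pentagonal_tree f (i + num.One) (g + i + i + i + num.One) ((-1) ^ Suc (Suc j))) n) =
         (- (\<Sum>j\<in>{Suc j..<Suc j+f}. (-1) ^ j * (fps_nth (fps_X ^ (j * (3 * j - 1) div 2)) n +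
                 fps_nth (fps_X ^ (j * (3 * j + 1) div 2)) n)) :: real)"
    by (rule Suc.IH) (use Suc.prems g' in \<open>auto simp: nat_of_num_add\<close>)
  moreover have "{j..<j + Suc f} = insert j {Suc j..<Suc j + f}" by auto
  ultimately show ?case
    using Suc.prems gi by (auto simp: lookup_add_at nat_of_num_add)
qed auto


lemma colored_partitions_Suc_pentagonal:
  assumes "n < Suc f * (3 * Suc f - 1) div 2"
  shows "colored_partitions (Suc k) n = colored_partitions k n +
           (\<Sum>i=1..n. of_int (lookup (pentagonal_tree f num.One num.One 1) i) *
                     colored_partitions (Suc k) (n - i))"
proof -
  \<comment> \<open>\<open>N\<close> exceeds \<open>n\<close>, so the finite product determines the
    coefficient, and it exceeds \<open>f\<close>, so all pairs of the tree occur in the pentagonal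
    sum.\<close>
  define N where "N = n + f + 1"
  have tree: "of_int (lookup (pentagonal_tree f num.One num.One 1) i) = - fps_nth (euler_fps N) i"
    if "i \<in> {1..n}" for i
  proof -
    define t where "t = (\<lambda>j :: nat. (-1) ^ j * (fps_nth (fps_X ^ (j * (3 * j - 1) div 2)) i +
                 fps_nth (fps_X ^ (j * (3 * j + 1) div 2)) i) :: real)"
    have t0: "t j = 0" if "j > f" for j
    proof -
      have "Suc f * (3 * Suc f - 1) div 2 \<le> j * (3 * j - 1) div 2"
        using that by (intro div_le_mono mult_mono) auto
      moreover have "j * (3 * j - 1) div 2 \<le> j * (3 * j + 1) div 2"
        by (intro div_le_mono mult_mono) auto
      ultimately show ?thesis using \<open>i \<in> {1..n}\<close> assms by (auto simp: t_def)
    qed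
    have "of_int (lookup (pentagonal_tree f num.One num.One ((-1) ^ Suc 1)) i) =
            - (\<Sum>j\<in>{1..<1+f}. t j)"
      unfolding t_def by (rule of_int_lookup_pentagonal_tree) auto
    also have "(\<Sum>j\<in>{1..<1+f}. t j) = (\<Sum>j\<in>{1..N}. t j)"
      by (rule sum.mono_neutral_left) (auto intro!: t0 simp: N_def)
    also have "\<dots> = fps_nth (euler_fps N) i"
    proof -
      have sign: "fps_nth ((-1) ^ j * F) i = (-1) ^ j * fps_nth F i" for j and F :: "real fps"
        by (cases "even j") auto
      have "i \<le> N" using that by (simp add: N_def)
      thus ?thesis using that
        by (simp only: euler_fps_nth fps_add_nth fps_sum_nth sign t_def) simp
    qed
    finally show ?thesis by simp
  qed
  have "colored_partitions k n =
         (\<Sum>i=0..n. fps_nth (euler_fps N) i * colored_partitions (Suc k) (n - i))"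
    by (rule euler_fps_mult_colored_partitions) (simp add: N_def)
  also have "\<dots> = colored_partitions (Suc k) n +
         (\<Sum>i=1..n. fps_nth (euler_fps N) i * colored_partitions (Suc k) (n - i))"
    by (subst sum.atLeast_Suc_atMost) simp_all
  also have "(\<Sum>i=1..n. fps_nth (euler_fps N) i * colored_partitions (Suc k) (n - i)) =
      - (\<Sum>i=1..n. of_int (lookup (pentagonal_tree f num.One num.One 1) i) *
                     colored_partitions (Suc k) (n - i))"
    unfolding sum_negf [symmetric] by (intro sum.cong refl) (simp add: tree)
  finally show ?thesis by simp
qed

text \<open>Induction over the halvings, with the scale \<open>c\<close> doubling each time:
  \<open>X\<close> and \<open>Z\<close> stay below \<open>c\<close> times the rounded-up values,
  \<open>Y\<close> above \<open>c\<close> times the rounded-down one. The test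
  \<open>y \<noteq> num.One\<close> matters because \<open>half num.One\<close> is not rounded
  down.\<close>

lemma truncated_le_square_correct:
  assumes "truncated_le_square g x y z" "X \<le> c * (nat_of_num x + 1)" "c * nat_of_num y \<le> Y"
    "Z \<le> c * (nat_of_num z + 1)"
  shows "X * Z \<le> Y * Y"
proof -
  have half1: "nat_of_num n + 1 \<le> 2 * (nat_of_num (half n) + 1)" for n by (cases n) auto
  have half2: "2 * nat_of_num (half n) \<le> nat_of_num n" if "n \<noteq> num.One" for n
    using that by (cases n) auto
  have *: "X \<le> (2 * c) * (nat_of_num (half x) + 1)" "(2 * c) * nat_of_num (half y) \<le> Y"
          "Z \<le> (2 * c) * (nat_of_num (half z) + 1)"
    if "X \<le> c * (nat_of_num x + 1)" "c * nat_of_num y \<le> Y" "Z \<le> c * (nat_of_num z + 1)" "y \<noteq> num.One"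
    for x y z :: num and X Y Z c :: nat
  proof -
    show "X \<le> (2 * c) * (nat_of_num (half x) + 1)"
      using that(1) mult_left_mono[OF half1[of x], of c] by (simp only: mult_ac) linarith
    show "Z \<le> (2 * c) * (nat_of_num (half z) + 1)"
      using that(3) mult_left_mono[OF half1[of z], of c] by (simp only: mult_ac) linarith
    show "(2 * c) * nat_of_num (half y) \<le> Y"
      using that(2) mult_left_mono[OF half2[OF that(4)], of c] by (simp only: mult_ac) linarith
  qed
  show ?thesis using assms
  proof (induction g x y z arbitrary: c rule: truncated_le_square.induct)
    case (1 x y z)
    have le: "(nat_of_num x + 1) * (nat_of_num z + 1) \<le> nat_of_num y * nat_of_num y"
      using 1(1) by (simp add: less_eq_num_def nat_of_num_add nat_of_num_mult)
    have "X * Z \<le> (c * (nat_of_num x + 1)) * (c * (nat_of_num z + 1))"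
      using 1 by (intro mult_mono) auto
    also have "\<dots> = c * c * ((nat_of_num x + 1) * (nat_of_num z + 1))" by (simp only: mult_ac)
    also have "\<dots> \<le> c * c * (nat_of_num y * nat_of_num y)" by (intro mult_left_mono le) simp
    also have "\<dots> = (c * nat_of_num y) * (c * nat_of_num y)" by (simp only: mult_ac)
    also have "\<dots> \<le> Y * Y" using 1 by (intro mult_mono) auto
    finally show ?case .
  next
    case (2 g x y z)
    thus ?case using *[of X c x y Y Z z] by auto
  next
    case (3 g x y z)
    thus ?case using *[of X c x y Y Z z] by auto
  qed
qed

lemma le_square_correct:
  assumes "le_square (num_of_int x) (num_of_int y) (num_of_int z)" "0 < x" "0 < y" "0 < z"
  shows "x * z \<le> y * y"
proof -
  have num: "nat_of_num (num_of_int i) = nat i" if "0 < i" for i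
    using that by (simp add: num_of_int_def num_of_nat_inverse)
  have "nat x * nat z \<le> nat y * nat y"
  proof (cases "strip_bits 18 (num_of_int y) = num.One")
    case True
    hence "nat_of_num (num_of_int x * num_of_int z) \<le> nat_of_num (num_of_int y * num_of_int y)"
      using assms(1) by (simp add: le_square_def less_eq_num_def)
    thus ?thesis using assms by (simp add: nat_of_num_mult num)
  next
    case False
    hence "truncated_le_square (strip_bits 18 (num_of_int y)) (num_of_int x) (num_of_int y) (num_of_int z)"
      using assms(1) by (simp add: le_square_def Let_def)
    thus ?thesis
      by (rule truncated_le_square_correct[where c = 1]) (use assms in \<open>simp_all add: num\<close>)
  qed
  hence "int (nat x * nat z) \<le> int (nat y * nat y)" by (rule zle_int[THEN iffD2])
  thus ?thesis using assms by simp
qed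

lemma log_concave_list_correct:
  fixes q :: "nat \<Rightarrow> real"
  assumes "log_concave_list xs" "map of_int xs = map q [m..<N]" "m \<le> j" "Suc (Suc j) < N"
    and pos: "\<And>n. q n > 0"
  shows "q j * q (Suc (Suc j)) \<le> (q (Suc j))\<^sup>2"
  using assms(1-4)
proof (induction xs arbitrary: m rule: log_concave_list.induct)
  case (1 x y z zs)
  have "m < N" "Suc m < N" "Suc (Suc m) < N" using 1 by auto
  hence upt: "[m..<N] = m # Suc m # Suc (Suc m) # [Suc (Suc (Suc m))..<N]"
    by (simp add: upt_conv_Cons)
  show ?case
  proof (cases "j = m")
    case True
    have eq: "real_of_int x = q m" "real_of_int y = q (Suc m)" "real_of_int z = q (Suc (Suc m))"
      using 1(3) upt by simp_all
    have "0 < real_of_int x" "0 < real_of_int y" "0 < real_of_int z"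
      unfolding eq by (rule pos)+
    hence "x * z \<le> y * y" using 1(2) by (intro le_square_correct) auto
    hence "real_of_int x * real_of_int z \<le> real_of_int y * real_of_int y"
      unfolding of_int_mult [symmetric] of_int_le_iff .
    thus ?thesis using 1(3) upt True by (simp add: power2_eq_square)
  next
    case False
    show ?thesis
      by (rule 1(1)[of "Suc m"]) (use 1 False upt in \<open>auto simp: upt_conv_Cons\<close>)
  qed
next
  case ("2_1")
  thus ?case by (cases "m < N") (auto simp: upt_conv_Cons)
next
  case ("2_2" x)
  thus ?case by (cases "m < N") (auto simp: upt_conv_Cons)
next
  case ("2_3" x y)
  thus ?case by (cases "Suc m < N") (auto simp: upt_conv_Cons)
qed

lemma divide_series_colored_partitions:
  assumes "map of_int xs = map (colored_partitions k) [0..<N]" "n \<le> N"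
    and "n \<le> Suc f * (3 * Suc f - 1) div 2"
  shows "map of_int (divide_series (pentagonal_tree f num.One num.One 1) Leaf (take n xs)) =
         map (colored_partitions (Suc k)) [0..<n]"
proof (rule divide_series_correct)
  show "map of_int (take n xs) = map (colored_partitions k) [0..<n]"
    unfolding take_map [symmetric] assms(1) using assms(2) by (simp add: take_map take_upt)
  fix m assume "m < n"
  hence "m < Suc f * (3 * Suc f - 1) div 2" using assms(3) by linarith
  thus "colored_partitions (Suc k) m = colored_partitions k m +
          (\<Sum>i=1..m. of_int (lookup (pentagonal_tree f num.One num.One 1) i) *
             colored_partitions (Suc k) (m - i))"
    by (rule colored_partitions_Suc_pentagonal)
qed auto

text \<open>Starting from the series 1, the quotients are p_1, ..., p_5. All of p_1 is exempt, and
  of p_2 the first five terms, because 36^2 < 20 * 65 at center 5. The lengths for k = 2, ..., 5 are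
  1685/k rounded up, plus 1, which reaches every center below the analytic range. The 23 pairs
  suffice because the next pentagonal number is 24 * 71 / 2 = 852.\<close>

lemma check_quotients_true:
  "check_quotients (pentagonal_tree 23 num.One num.One 1)
     [(844, 844), (844, 5), (563, 0), (423, 0), (338, 0)] (1 # replicate 843 0)"
  by code_simp

lemma log_concave_small:
  shows "Suc (Suc n) < 844 \<Longrightarrow> n \<ge> 5 \<Longrightarrow>
           colored_partitions 2 n * colored_partitions 2 (Suc (Suc n)) \<le> (colored_partitions 2 (Suc n))\<^sup>2"
    and "Suc (Suc n) < 563 \<Longrightarrow>
           colored_partitions 3 n * colored_partitions 3 (Suc (Suc n)) \<le> (colored_partitions 3 (Suc n))\<^sup>2"
    and "Suc (Suc n) < 423 \<Longrightarrow>
           colored_partitions 4 n * colored_partitions 4 (Suc (Suc n)) \<le> (colored_partitions 4 (Suc n))\<^sup>2"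
    and "Suc (Suc n) < 338 \<Longrightarrow>
           colored_partitions 5 n * colored_partitions 5 (Suc (Suc n)) \<le> (colored_partitions 5 (Suc n))\<^sup>2"
proof -
  define u where "u = pentagonal_tree 23 num.One num.One 1"
  define d where "d = (\<lambda>n xs. divide_series u Leaf (take n xs))"
  define l0 where "l0 = 1 # replicate 843 (0 :: int)"
  define l1 where "l1 = d 844 l0"
  define l2 where "l2 = d 844 l1"
  define l3 where "l3 = d 563 l2"
  define l4 where "l4 = d 423 l3"
  define l5 where "l5 = d 338 l4"
  have lc: "log_concave_list (drop 5 l2)" "log_concave_list l3" "log_concave_list l4"
           "log_concave_list l5"
    using check_quotients_true
    by (simp_all add: u_def [symmetric] l0_def [symmetric] l1_def l2_def l3_def l4_def l5_def d_def
        prefix_of_eq_take suffix_of_eq_drop)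
  have d: "map of_int (d n xs) = map (colored_partitions k') [0..<n]"
    if "map of_int xs = map (colored_partitions k) [0..<N]" "n \<le> N" "n \<le> 844" "k' = Suc k"
    for xs k k' N n
    unfolding d_def u_def that(4) using that by (intro divide_series_colored_partitions) auto
  have cp0: "colored_partitions 0 n = (if n = 0 then 1 else 0)" for n
    using colored_partitions_eq_euler[of n "Suc n" 0] by simp
  have "map of_int (1 # replicate n (0 :: int)) = map (colored_partitions 0) [0..<Suc n]" for n
    by (rule nth_equalityI) (auto simp: cp0 nth_Cons simp del: upt_Suc split: nat.splits)
  from this[of 843] have l0: "map of_int l0 = map (colored_partitions 0) [0..<844]"
    unfolding l0_def by (simp only: Suc_numeral add_num_simps)
  have l1: "map of_int l1 = map (colored_partitions 1) [0..<844]"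
    unfolding l1_def by (rule d[OF l0]) simp_all
  have l2: "map of_int l2 = map (colored_partitions 2) [0..<844]"
    unfolding l2_def by (rule d[OF l1]) simp_all
  have l3: "map of_int l3 = map (colored_partitions 3) [0..<563]"
    unfolding l3_def by (rule d[OF l2]) simp_all
  have l4: "map of_int l4 = map (colored_partitions 4) [0..<423]"
    unfolding l4_def by (rule d[OF l3]) simp_all
  have l5: "map of_int l5 = map (colored_partitions 5) [0..<338]"
    unfolding l5_def by (rule d[OF l4]) simp_all
  have "map of_int (drop 5 l2) = map (colored_partitions 2) (drop 5 [0..<844])"
    unfolding drop_map [symmetric] l2 ..
  hence l2': "map of_int (drop 5 l2) = map (colored_partitions 2) [5..<844]"
    unfolding drop_upt by (simp only: add_0)
  have pos: "colored_partitions 2 n > 0" "colored_partitions 3 n > 0"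
    "colored_partitions 4 n > 0" "colored_partitions 5 n > 0" for n
    by (simp_all add: colored_partitions_pos)
  show "Suc (Suc n) < 844 \<Longrightarrow> n \<ge> 5 \<Longrightarrow>
           colored_partitions 2 n * colored_partitions 2 (Suc (Suc n)) \<le> (colored_partitions 2 (Suc n))\<^sup>2"
    by (rule log_concave_list_correct[OF lc(1) l2' _ _ pos(1)])
  show "Suc (Suc n) < 563 \<Longrightarrow>
           colored_partitions 3 n * colored_partitions 3 (Suc (Suc n)) \<le> (colored_partitions 3 (Suc n))\<^sup>2"
    by (rule log_concave_list_correct[OF lc(2) l3 le0 _ pos(2)])
  show "Suc (Suc n) < 423 \<Longrightarrow>
           colored_partitions 4 n * colored_partitions 4 (Suc (Suc n)) \<le> (colored_partitions 4 (Suc n))\<^sup>2"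
    by (rule log_concave_list_correct[OF lc(3) l4 le0 _ pos(3)])
  show "Suc (Suc n) < 338 \<Longrightarrow>
           colored_partitions 5 n * colored_partitions 5 (Suc (Suc n)) \<le> (colored_partitions 5 (Suc n))\<^sup>2"
    by (rule log_concave_list_correct[OF lc(4) l5 le0 _ pos(4)])
qed

section \<open>Convolutions of log-concave sequences\<close>

text \<open>The index \<open>n\<close> is the left neighbor of the center, so the property from
  \<open>m\<close> on concerns the centers from \<open>m + 1\<close> on.\<close>

definition log_concave_from :: "nat \<Rightarrow> (nat \<Rightarrow> real) \<Rightarrow> bool" where
  "log_concave_from m a \<longleftrightarrow> (\<forall>n\<ge>m. a n * a (Suc (Suc n)) \<le> (a (Suc n))\<^sup>2)"

text \<open>The ratios a(n+1)/a(n) do not increase; two of them are compared without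
  division.\<close>

lemma log_concave_from_cross:
  assumes "log_concave_from m a" "\<And>n. a n > 0" "m \<le> i" "i \<le> j"
  shows "a i * a (Suc j) \<le> a (Suc i) * a j"
  using \<open>i \<le> j\<close>
proof (induction j rule: dec_induct)
  case (step j)
  have "a j * a (Suc (Suc j)) \<le> (a (Suc j))\<^sup>2"
    using assms(1) step.hyps assms(3) by (auto simp: log_concave_from_def)
  have "a j * (a i * a (Suc (Suc j))) = a i * (a j * a (Suc (Suc j)))" by simp
  also have "\<dots> \<le> a i * (a (Suc j))\<^sup>2"
    using assms(2)[of i] \<open>a j * a (Suc (Suc j)) \<le> (a (Suc j))\<^sup>2\<close>
    by (intro mult_left_mono) auto
  also have "\<dots> = (a i * a (Suc j)) * a (Suc j)" by (simp add: power2_eq_square)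
  also have "\<dots> \<le> (a (Suc i) * a j) * a (Suc j)"
    using step.IH assms(2)[of "Suc j"] by (intro mult_right_mono) auto
  also have "\<dots> = a j * (a (Suc i) * a (Suc j))" by simp
  finally show ?case using assms(2)[of j] by simp
qed simp

text \<open>With \<open>a'\<close> the sequence \<open>a\<close> shifted by one place, the determinant
  \<open>c\<^sub>n\<^sup>2 - c\<^sub>n\<^sub>-\<^sub>1 c\<^sub>n\<^sub>+\<^sub>1\<close> of the convolution \<open>c\<close> is a sum of products of
  \<open>2 \<times> 2\<close> minors of \<open>(a, a')\<close> and of \<open>(b, b')\<close> by the Cauchy-Binet formula.\<close>

lemma log_concave_from_convolution:
  fixes a b :: "nat \<Rightarrow> real"
  assumes a: "log_concave_from 0 a" "\<And>n. a n > 0"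
    and b: "log_concave_from 0 b" "\<And>n. b n > 0"
  shows "log_concave_from 0 (\<lambda>n. \<Sum>i=0..n. a i * b (n - i))"
  unfolding log_concave_from_def
proof (intro allI impI)
  fix n :: nat
  define c where "c = (\<lambda>n. \<Sum>i=0..n. a i * b (n - i))"
  define I where "I = {0..Suc (Suc n)}"
  \<comment> \<open>The zero entries at the two ends let c(n), c(n+1) in two ways, and c(n+2) be
    written as scalar products over the common index set \<open>I\<close>, as the Cauchy-Binet
    formula requires.\<close>
  define a' where "a' = (\<lambda>i. if i = 0 then 0 else a (i - 1))"
  define b0 where "b0 = (\<lambda>i. if i = Suc (Suc n) then 0 else b (Suc n - i))"
  define b1 where "b1 = (\<lambda>i. b (Suc (Suc n) - i))"
  have shift: "(\<Sum>i\<in>I. a' i * f i) = (\<Sum>i=0..Suc n. a i * f (Suc i))" for f :: "nat \<Rightarrow> real"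
    unfolding I_def a'_def by (subst sum.atLeast0_atMost_Suc_shift) simp
  have c1: "c (Suc n) = (\<Sum>i\<in>I. a i * b0 i)"
    unfolding c_def I_def b0_def by simp
  have c2: "c (Suc (Suc n)) = (\<Sum>i\<in>I. a i * b1 i)"
    unfolding c_def I_def b1_def by simp
  have c0: "c n = (\<Sum>i\<in>I. a' i * b0 i)"
    unfolding shift by (simp add: c_def b0_def)
  have c1': "c (Suc n) = (\<Sum>i\<in>I. a' i * b1 i)"
    unfolding shift by (simp add: c_def b1_def)
  define D where "D = (\<lambda>i j. b0 i * b1 j - b1 i * b0 j)"
  define M where "M = (\<lambda>i j. a i * a' j - a j * a' i)"
  have M: "M i j \<ge> 0" if "i \<le> j" for i j
  proof (cases "i = 0")
    case True
    thus ?thesis using a(2)[of 0] a(2)[of "j - 1"] by (auto simp: M_def a'_def)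
  next
    case False
    thus ?thesis using log_concave_from_cross[OF a, of "i - 1" "j - 1"] that
      by (auto simp: M_def a'_def mult_ac)
  qed
  have D: "D i j \<ge> 0" if "i \<le> j" "i \<in> I" "j \<in> I" for i j
  proof (cases "j = Suc (Suc n)")
    case True
    thus ?thesis using b(2)[of 0] b(2)[of "Suc n - i"] that
      by (auto simp: D_def b0_def b1_def)
  next
    case False
    hence "Suc (Suc n) - i = Suc (Suc n - i)" "Suc (Suc n) - j = Suc (Suc n - j)"
      using that by (auto simp: I_def)
    thus ?thesis using log_concave_from_cross[OF b, of "Suc n - j" "Suc n - i"] that False
      by (auto simp: D_def b0_def b1_def I_def mult_ac)
  qed
  have "M i j * D i j \<ge> 0" if "i \<in> I" "j \<in> I" for i j
  proof (cases "i \<le> j")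
    case True
    thus ?thesis using M D that by simp
  next
    case False
    hence "M j i * D j i \<ge> 0" using M D that by simp
    moreover have "M j i * D j i = M i j * D i j" by (simp add: M_def D_def algebra_simps)
    ultimately show ?thesis by simp
  qed
  \<comment> \<open>The sum over ordered pairs meets each product of minors twice, so it equals
    twice the determinant.\<close>
  hence "0 \<le> (\<Sum>i\<in>I. \<Sum>j\<in>I. M i j * D i j)" by (intro sum_nonneg) auto
  also have "\<dots> = (\<Sum>i\<in>I. \<Sum>j\<in>I. a i * a' j * D i j) - (\<Sum>i\<in>I. \<Sum>j\<in>I. a j * a' i * D i j)"
    unfolding M_def by (simp only: sum_subtractf left_diff_distrib)
  also have "(\<Sum>i\<in>I. \<Sum>j\<in>I. a j * a' i * D i j) = (\<Sum>j\<in>I. \<Sum>i\<in>I. a j * a' i * D i j)"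
    by (rule sum.swap)
  also have "\<dots> = - (\<Sum>i\<in>I. \<Sum>j\<in>I. a i * a' j * D i j)"
    unfolding sum_negf [symmetric] by (intro sum.cong) (auto simp: D_def algebra_simps)
  also have "(\<Sum>i\<in>I. \<Sum>j\<in>I. a i * a' j * D i j) =
             c (Suc n) * c (Suc n) - c (Suc (Suc n)) * c n"
  proof -
    have "c (Suc n) * c (Suc n) = (\<Sum>i\<in>I. \<Sum>j\<in>I. (a i * b0 i) * (a' j * b1 j))"
      by (subst c1, subst c1') (rule sum_product)
    moreover have "c (Suc (Suc n)) * c n = (\<Sum>i\<in>I. \<Sum>j\<in>I. (a i * b1 i) * (a' j * b0 j))"
      by (subst c2, subst c0) (rule sum_product)
    ultimately show ?thesis
      by (simp only: sum_subtractf [symmetric] D_def right_diff_distrib mult_ac)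
  qed
  finally show "c n * c (Suc (Suc n)) \<le> (c (Suc n))\<^sup>2"
    by (simp add: power2_eq_square algebra_simps)
qed

section \<open>Cauchy's formula on a circle\<close>

definition log_coeff :: "nat \<Rightarrow> real" where
  "log_coeff n = real (divisor_sum n) / real n"

lemma log_coeff_0 [simp]: "log_coeff 0 = 0"
  by (simp add: log_coeff_def)

lemma log_coeff_nonneg: "log_coeff n \<ge> 0"
  by (simp add: log_coeff_def)

lemma divisor_sum_le: "divisor_sum n \<le> n * n"
proof (cases "n = 0")
  case False
  have "divisor_sum n \<le> \<Sum>{1..n}"
    unfolding divisor_sum_def
    by (rule sum_mono2) (use False in \<open>auto dest: dvd_imp_le intro: Suc_leI dvd_pos_nat\<close>)
  also have "\<dots> \<le> (\<Sum>i\<in>{1..n}. n)" by (intro sum_mono) auto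
  finally show ?thesis by simp
qed simp

lemma log_coeff_le: "log_coeff n \<le> real n"
proof (cases "n = 0")
  case False
  have "real (divisor_sum n) \<le> real (n * n)" using divisor_sum_le of_nat_le_iff by blast
  thus ?thesis using False by (simp add: log_coeff_def field_simps)
qed simp

text \<open>With r = u^(a+1) the term factors as (n u^n)^a u^n, and n u^n is bounded.\<close>

lemma summable_power_mult:
  fixes r :: real
  assumes "0 \<le> r" "r < 1"
  shows "summable (\<lambda>n. real n ^ a * r ^ n)"
proof -
  define u where "u = root (Suc a) r"
  have u: "0 \<le> u" "u < 1" and r: "r = u ^ a * u"
    using assms real_root_pow_pos2[of "Suc a" r] by (simp_all add: u_def mult.commute)
  have "(\<lambda>n. real n * u ^ n) \<longlonglongrightarrow> 0" using u by (intro powser_times_n_limit_0) simp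
  hence "Bseq (\<lambda>n. real n * u ^ n)" by (meson convergentI convergent_imp_Bseq)
  then obtain C where C: "\<And>n. norm (real n * u ^ n) \<le> C" by (auto simp: Bseq_def)
  show ?thesis
  proof (rule summable_comparison_test')
    show "summable (\<lambda>n. C ^ a * u ^ n)" using u by (intro summable_mult summable_geometric) auto
    show "norm (real n ^ a * r ^ n) \<le> C ^ a * u ^ n" for n
    proof -
      have "norm (real n ^ a * r ^ n) = norm (real n * u ^ n) ^ a * u ^ n"
        using u by (simp add: r power_mult_distrib abs_mult mult.commute flip: power_mult)
      also have "\<dots> \<le> C ^ a * u ^ n" using C[of n] u by (intro mult_right_mono power_mono) auto
      finally show ?thesis .
    qed
  qed
qed

lemma summable_log_coeff:
  assumes "0 \<le> r" "r < 1"
  shows "summable (\<lambda>n. real n ^ a * log_coeff n * r ^ n)"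
proof (rule summable_comparison_test')
  show "summable (\<lambda>n. real n ^ Suc a * r ^ n)" by (rule summable_power_mult[OF assms])
  show "norm (real n ^ a * log_coeff n * r ^ n) \<le> real n ^ Suc a * r ^ n" for n
  proof -
    have "norm (real n ^ a * log_coeff n * r ^ n) = real n ^ a * r ^ n * log_coeff n"
      using assms log_coeff_nonneg[of n] by (simp add: abs_mult)
    also have "\<dots> \<le> real n ^ a * r ^ n * real n"
      using assms log_coeff_le[of n] by (intro mult_left_mono) auto
    finally show ?thesis by (simp add: mult_ac)
  qed
qed

definition log_fps :: "complex fps" where
  "log_fps = Abs_fps (\<lambda>n. of_real (log_coeff n))"

lemma fps_conv_radius_log_fps: "fps_conv_radius log_fps \<ge> 1"
  unfolding fps_conv_radius_def
proof (rule conv_radius_geI_ex')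
  fix r :: real assume r: "0 < r" "ereal r < 1"
  have "summable (\<lambda>n. log_coeff n * r ^ n)"
    using summable_log_coeff[of r 0] r by simp
  hence "summable (\<lambda>n. complex_of_real (log_coeff n * r ^ n))"
    by (rule summable_of_real)
  thus "summable (\<lambda>n. fps_nth log_fps n * complex_of_real r ^ n)"
    by (simp add: log_fps_def)
qed

text \<open>Defined as an exponential, so that holomorphy, modulus and phase come directly from the
  logarithmic series.\<close>

definition gen_fun :: "nat \<Rightarrow> complex \<Rightarrow> complex" where
  "gen_fun k z = exp (of_nat k * eval_fps log_fps z)"

lemma norm_less_conv_radius_log_fps:
  assumes "norm z < 1"
  shows "ereal (norm z) < fps_conv_radius log_fps"
proof -
  have "ereal (norm z) < 1" using assms by simp
  also have "1 \<le> fps_conv_radius log_fps" by (rule fps_conv_radius_log_fps)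
  finally show ?thesis .
qed

lemma holomorphic_gen_fun: "gen_fun k holomorphic_on ball 0 1"
  unfolding gen_fun_def
  by (intro holomorphic_intros) (auto intro!: norm_less_conv_radius_log_fps)

text \<open>Logarithmic differentiation makes the Taylor coefficients satisfy the divisor-sum
  recurrence with value 1 at index 0, which determines them.\<close>

lemma gen_fun_expansion:
  "fps_nth (fps_expansion (gen_fun k) 0) n = of_real (colored_partitions k n)"
proof -
  define g where "g = fps_expansion (gen_fun k) 0"
  have g: "gen_fun k has_fps_expansion g"
    unfolding g_def by (rule has_fps_expansion_fps_expansion[OF _ _ holomorphic_gen_fun]) auto
  have "deriv (gen_fun k) z = of_nat k * eval_fps (fps_deriv log_fps) z * gen_fun k z"
    if "z \<in> ball 0 1" for z
  proof -
    have "norm z < 1" using that by simp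
    note less = norm_less_conv_radius_log_fps[OF this]
    hence "(eval_fps log_fps has_field_derivative eval_fps (fps_deriv log_fps) z) (at z)"
      by (intro has_field_derivative_eval_fps) (simp add: eball_def)
    hence "(gen_fun k has_field_derivative
             of_nat k * eval_fps (fps_deriv log_fps) z * gen_fun k z) (at z)"
      unfolding gen_fun_def using less by (auto intro!: derivative_eq_intros)
    thus ?thesis by (rule DERIV_imp_deriv)
  qed
  hence "eventually (\<lambda>z. deriv (gen_fun k) z = of_nat k * eval_fps (fps_deriv log_fps) z * gen_fun k z)
           (nhds 0)"
    by (intro eventually_nhds_in_open[of "ball 0 1", THEN eventually_mono]) auto
  moreover have "(\<lambda>z. of_nat k * eval_fps (fps_deriv log_fps) z * gen_fun k z) has_fps_expansion
                   fps_const (of_nat k) * fps_deriv log_fps * g"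
  proof (intro fps_expansion_intros g)
    have "0 < fps_conv_radius log_fps"
      using fps_conv_radius_log_fps by (rule less_le_trans[rotated]) simp
    also have "\<dots> \<le> fps_conv_radius (fps_deriv log_fps)" by (rule fps_conv_radius_deriv)
    finally show "eval_fps (fps_deriv log_fps) has_fps_expansion fps_deriv log_fps"
      by (rule eval_fps_has_fps_expansion)
  qed
  ultimately have "deriv (gen_fun k) has_fps_expansion fps_const (of_nat k) * fps_deriv log_fps * g"
    by (subst has_fps_expansion_cong[OF _ refl]) auto
  moreover have "deriv (gen_fun k) has_fps_expansion fps_deriv g"
    by (rule has_fps_expansion_deriv[OF g])
  ultimately have "fps_deriv g = fps_const (of_nat k) * fps_deriv log_fps * g"
    using fps_expansion_unique_complex by blast
  hence Xg: "fps_X * fps_deriv g = fps_const (of_nat k) * ((fps_X * fps_deriv log_fps) * g)"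
    by (simp only: mult_ac)
  have XL: "fps_nth (fps_X * fps_deriv log_fps) i = of_real (real (divisor_sum i))" for i
    by (cases i) (auto simp: log_fps_def log_coeff_def simp del: of_nat_Suc)
  have rec: "of_nat n * fps_nth g n =
               of_nat k * (\<Sum>i=0..n. of_real (real (divisor_sum i)) * fps_nth g (n - i))" for n
  proof -
    have "of_nat n * fps_nth g n = fps_nth (fps_X * fps_deriv g) n" by (cases n) auto
    also have "\<dots> = of_nat k * (\<Sum>i=0..n. of_real (real (divisor_sum i)) * fps_nth g (n - i))"
      unfolding Xg fps_mult_left_const_nth fps_mult_nth[of "fps_X * fps_deriv log_fps"] XL ..
    finally show ?thesis .
  qed
  have "fps_nth g n = of_real (colored_partitions k n)"
  proof (induction n rule: less_induct)
    case (less n)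
    show ?case
    proof (cases "n = 0")
      case True
      have "fps_nth g 0 = gen_fun k 0" using has_fps_expansion_imp_0_eq_fps_nth_0[OF g] by simp
      also have "\<dots> = 1" by (simp add: gen_fun_def eval_fps_at_0 log_fps_def)
      finally show ?thesis using True by simp
    next
      case False
      have "of_nat n * fps_nth g n =
        of_nat k * (\<Sum>i=0..n. of_real (real (divisor_sum i) * colored_partitions k (n - i)))"
        unfolding rec
      proof (intro arg_cong2[where f = "(*)"] refl sum.cong)
        fix i assume "i \<in> {0..n}"
        thus "of_real (real (divisor_sum i)) * fps_nth g (n - i) =
          of_real (real (divisor_sum i) * colored_partitions k (n - i))"
          using less.IH[of "n - i"] by (cases "i = 0") auto
      qed
      also have "\<dots> = of_real (real k * (\<Sum>i=0..n. real (divisor_sum i) * colored_partitions k (n - i)))"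
        by simp
      also have "\<dots> = of_nat n * of_real (colored_partitions k n)"
        unfolding colored_partitions_rec [symmetric] by simp
      finally show ?thesis using False by simp
    qed
  qed
  thus ?thesis by (simp add: g_def)
qed

lemma has_integral_gen_fun:
  assumes "0 < r" "r < 1"
  shows "((\<lambda>\<theta>. gen_fun k (of_real r * cis \<theta>) * cis (- real n * \<theta>)) has_integral
           of_real (2 * pi * r ^ n * colored_partitions k n)) {0..2*pi}"
proof -
  have holo: "gen_fun k holomorphic_on ball 0 1" by (rule holomorphic_gen_fun)
  have sub: "cball 0 r \<subseteq> ball (0::complex) 1" using assms by auto
  have "((\<lambda>u. gen_fun k u / (u - 0) ^ Suc n) has_contour_integral
           (2 * pi * \<i>) / fact n * (deriv ^^ n) (gen_fun k) 0) (circlepath 0 r)"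
  proof (rule Cauchy_has_contour_integral_higher_derivative_circlepath)
    show "continuous_on (cball 0 r) (gen_fun k)"
      using holomorphic_on_imp_continuous_on[OF holo] sub continuous_on_subset by blast
    show "gen_fun k holomorphic_on ball 0 r"
      using holo by (rule holomorphic_on_subset) (use assms in auto)
  qed (use assms in auto)
  also have "(2 * pi * \<i>) / fact n * (deriv ^^ n) (gen_fun k) 0 =
               2 * pi * \<i> * of_real (colored_partitions k n)"
    using gen_fun_expansion[of k n] by (simp add: fps_expansion_def field_simps)
  finally have "((\<lambda>u. gen_fun k u / u ^ Suc n) has_contour_integral
      2 * pi * \<i> * of_real (colored_partitions k n)) (part_circlepath 0 r 0 (2*pi))"
    by (simp add: circlepath_def)
  hence "((\<lambda>\<theta>. gen_fun k (0 + r * cis \<theta>) / (0 + r * cis \<theta>) ^ Suc n * r * \<i> * cis \<theta>)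
          has_integral 2 * pi * \<i> * of_real (colored_partitions k n)) {0..2*pi}"
    by (subst (asm) has_contour_integral_part_circlepath_iff) auto
  \<comment> \<open>The factor \<open>- \<i> * r ^ n\<close> cancels the \<open>\<i>\<close> of the
    parametrized contour and the modulus of u^n.\<close>
  hence "((\<lambda>\<theta>. (- \<i> * r ^ n) * (gen_fun k (0 + r * cis \<theta>) / (0 + r * cis \<theta>) ^ Suc n * r * \<i> * cis \<theta>))
          has_integral (- \<i> * r ^ n) * (2 * pi * \<i> * of_real (colored_partitions k n))) {0..2*pi}"
    by (rule has_integral_mult_right)
  also have "(\<lambda>\<theta>. (- \<i> * r ^ n) * (gen_fun k (0 + r * cis \<theta>) / (0 + r * cis \<theta>) ^ Suc n * r * \<i> * cis \<theta>)) =
             (\<lambda>\<theta>. gen_fun k (of_real r * cis \<theta>) * cis (- real n * \<theta>))"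
  proof
    fix \<theta> :: real
    have "cis (- real n * \<theta>) = inverse (cis \<theta> ^ n)"
      by (simp add: Complex.DeMoivre)
    thus "(- \<i> * r ^ n) * (gen_fun k (0 + r * cis \<theta>) / (0 + r * cis \<theta>) ^ Suc n * r * \<i> * cis \<theta>) =
          gen_fun k (of_real r * cis \<theta>) * cis (- real n * \<theta>)"
      using assms by (simp add: field_simps power_mult_distrib)
  qed
  also have "(- \<i> * r ^ n) * (2 * pi * \<i> * of_real (colored_partitions k n)) =
             of_real (2 * pi * r ^ n * colored_partitions k n)"
    by (simp add: algebra_simps)
  finally show ?thesis .
qed

section \<open>Polar form of the generating function\<close>

definition log_modulus :: "nat \<Rightarrow> real \<Rightarrow> real \<Rightarrow> real" where
  "log_modulus k r \<theta> = real k * (\<Sum>n. log_coeff n * r ^ n * cos (real n * \<theta>))"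

definition log_phase :: "nat \<Rightarrow> real \<Rightarrow> real \<Rightarrow> real" where
  "log_phase k r \<theta> = real k * (\<Sum>n. log_coeff n * r ^ n * sin (real n * \<theta>))"

lemma summable_log_coeff_mult:
  assumes "0 \<le> r" "r < 1" "\<And>n. \<bar>f n\<bar> \<le> 1"
  shows "summable (\<lambda>n. log_coeff n * r ^ n * f n)"
proof (rule summable_comparison_test')
  show "summable (\<lambda>n. log_coeff n * r ^ n)"
    using summable_log_coeff[OF assms(1,2), of 0] by simp
  show "norm (log_coeff n * r ^ n * f n) \<le> log_coeff n * r ^ n" for n
    using assms(1) assms(3)[of n] log_coeff_nonneg[of n]
    by (simp add: abs_mult mult_left_le)
qed

lemma gen_fun_polar:
  assumes "0 \<le> r" "r < 1"
  shows "gen_fun k (of_real r * cis \<theta>) = of_real (exp (log_modulus k r \<theta>)) * cis (log_phase k r \<theta>)"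
proof -
  define w where "w = eval_fps log_fps (of_real r * cis \<theta>)"
  have "(\<lambda>n. fps_nth log_fps n * (of_real r * cis \<theta>) ^ n) sums w"
    unfolding w_def by (intro sums_eval_fps) 
      (use norm_less_conv_radius_log_fps[of "of_real r * cis \<theta>"] assms in \<open>auto simp: norm_mult\<close>)
  also have "(\<lambda>n. fps_nth log_fps n * (of_real r * cis \<theta>) ^ n) =
               (\<lambda>n. of_real (log_coeff n * r ^ n) * cis (real n * \<theta>))"
    by (simp add: log_fps_def power_mult_distrib Complex.DeMoivre mult.assoc)
  finally have *: "(\<lambda>n. of_real (log_coeff n * r ^ n) * cis (real n * \<theta>)) sums w" .
  have "Re w = (\<Sum>n. log_coeff n * r ^ n * cos (real n * \<theta>))"
    using sums_Re[OF *] by (simp add: sums_iff)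
  moreover have "Im w = (\<Sum>n. log_coeff n * r ^ n * sin (real n * \<theta>))"
    using sums_Im[OF *] by (simp add: sums_iff)
  ultimately have "of_nat k * w = Complex (log_modulus k r \<theta>) (log_phase k r \<theta>)"
    by (simp add: complex_eq_iff log_modulus_def log_phase_def)
  thus ?thesis unfolding gen_fun_def w_def [symmetric] by (simp add: exp_eq_polar)
qed

lemma has_integral_concavity:
  assumes "0 < r" "r < 1"
  shows "((\<lambda>\<theta>. exp (log_modulus k r \<theta>) * cos (log_phase k r \<theta> - real (Suc n) * \<theta>) * (1 - cos \<theta>))
           has_integral pi * (2 * r ^ Suc n * colored_partitions k (Suc n)
             - r ^ n * colored_partitions k n
             - r ^ Suc (Suc n) * colored_partitions k (Suc (Suc n)))) {0..2*pi}"
proof -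
  define c where "c = colored_partitions k"
  define G where "G = (\<lambda>\<theta>. gen_fun k (of_real r * cis \<theta>))"
  have I: "((\<lambda>\<theta>. G \<theta> * cis (- real n * \<theta>)) has_integral of_real (2 * pi * r ^ n * c n)) {0..2*pi}" for n
    unfolding G_def c_def by (rule has_integral_gen_fun[OF assms])
  have "((\<lambda>\<theta>. G \<theta> * cis (- real (Suc n) * \<theta>) -
          (1/2) * (G \<theta> * cis (- real n * \<theta>) + G \<theta> * cis (- real (Suc (Suc n)) * \<theta>)))
         has_integral of_real (2 * pi * r ^ Suc n * c (Suc n)) -
           (1/2) * (of_real (2 * pi * r ^ n * c n) + of_real (2 * pi * r ^ Suc (Suc n) * c (Suc (Suc n)))))
         {0..2*pi}"
    by (intro has_integral_diff has_integral_add has_integral_mult_right I)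
  also have "(\<lambda>\<theta>. G \<theta> * cis (- real (Suc n) * \<theta>) -
          (1/2) * (G \<theta> * cis (- real n * \<theta>) + G \<theta> * cis (- real (Suc (Suc n)) * \<theta>))) =
        (\<lambda>\<theta>. G \<theta> * cis (- real (Suc n) * \<theta>) * of_real (1 - cos \<theta>))"
  proof
    fix \<theta> :: real
    have "cis (- real n * \<theta>) = cis (- real (Suc n) * \<theta>) * cis \<theta>"
         "cis (- real (Suc (Suc n)) * \<theta>) = cis (- real (Suc n) * \<theta>) * cis (- \<theta>)"
      unfolding cis_mult by (rule arg_cong[where f = cis], simp add: algebra_simps)+
    moreover have "of_real (cos \<theta>) = (1/2) * (cis \<theta> + cis (-\<theta>))"
      by (simp add: complex_eq_iff)
    ultimately show "G \<theta> * cis (- real (Suc n) * \<theta>) -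
          (1/2) * (G \<theta> * cis (- real n * \<theta>) + G \<theta> * cis (- real (Suc (Suc n)) * \<theta>)) =
          G \<theta> * cis (- real (Suc n) * \<theta>) * of_real (1 - cos \<theta>)"
      by (simp only: of_real_diff of_real_1) (simp add: algebra_simps del: of_nat_Suc)
  qed
  finally have "((\<lambda>\<theta>. Re (G \<theta> * cis (- real (Suc n) * \<theta>) * of_real (1 - cos \<theta>))) has_integral
      Re (of_real (2 * pi * r ^ Suc n * c (Suc n)) -
           (1/2) * (of_real (2 * pi * r ^ n * c n) + of_real (2 * pi * r ^ Suc (Suc n) * c (Suc (Suc n))))))
      {0..2*pi}"
    by (rule has_integral_Re)
  also have "(\<lambda>\<theta>. Re (G \<theta> * cis (- real (Suc n) * \<theta>) * of_real (1 - cos \<theta>))) =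
     (\<lambda>\<theta>. exp (log_modulus k r \<theta>) * cos (log_phase k r \<theta> - real (Suc n) * \<theta>) * (1 - cos \<theta>))"
  proof
    fix \<theta>
    have "G \<theta> * cis (- real (Suc n) * \<theta>) =
            of_real (exp (log_modulus k r \<theta>)) * cis (log_phase k r \<theta> - real (Suc n) * \<theta>)"
      unfolding G_def using assms by (subst gen_fun_polar) (auto simp: mult.assoc cis_mult algebra_simps)
    thus "Re (G \<theta> * cis (- real (Suc n) * \<theta>) * of_real (1 - cos \<theta>)) =
      exp (log_modulus k r \<theta>) * cos (log_phase k r \<theta> - real (Suc n) * \<theta>) * (1 - cos \<theta>)"
      by simp
  qed
  finally show ?thesis by (simp add: c_def algebra_simps)
qed

section \<open>Upper bounds for the modulus and the phase\<close>

lemma cosh_lower_6: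
  fixes s :: real
  shows "s\<^sup>2 + s ^ 4 / 12 + s ^ 6 / 360 \<le> 2 * cosh s - 2"
proof -
  define f where "f = (\<lambda>n. if even n then s ^ n /\<^sub>R fact n else 0)"
  have f: "f sums cosh s" unfolding f_def by (rule cosh_converges)
  have "f n \<ge> 0" for n by (auto simp: f_def zero_le_even_power intro!: mult_nonneg_nonneg)
  hence "sum f {..<7} \<le> cosh s"
    using sum_le_suminf[of f "{..<7}"] f by (auto simp: sums_iff)
  moreover have "sum f {..<7} = f 0 + f 1 + f 2 + f 3 + f 4 + f 5 + f 6"
    by (simp add: eval_nat_numeral)
  moreover have "f 0 = 1" "f 1 = 0" "f 2 = s\<^sup>2 / 2" "f 3 = 0" "f 4 = s ^ 4 / 24" "f 5 = 0"
    "f 6 = s ^ 6 / 720"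
    by (simp_all add: f_def fact_numeral)
  ultimately show ?thesis by simp
qed

text \<open>The moments are simple in w = 2 cosh s - 2: the infinite sums of m x^m and m^3 x^m are
  1/w and (w + 6)/w^2, and the square of the sum of m^2 x^m is (w + 4)/w^3. Lower bounds for cosh
  thus become upper bounds for moments.\<close>

lemma cosh_exp_neg:
  fixes s :: real
  defines "x \<equiv> exp (- s)"
  shows "2 * cosh s - 2 = (1 - x)\<^sup>2 / x"
proof -
  have x: "x > 0" by (simp add: x_def)
  have "exp s = 1 / x" by (simp add: x_def exp_minus divide_inverse)
  hence "cosh s = (1 / x + x) / 2" by (simp add: cosh_def x_def)
  thus ?thesis using x by (simp add: field_simps power2_eq_square)
qed

text \<open>Closed forms with the tail kept on the left, where it is nonnegative for 0 < x < 1;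
  dropping it bounds every partial sum. Without division the identities follow by induction.\<close>

lemma sum_mult_power_identities:
  fixes x :: real
  shows "(1 - x) ^ 2 * (\<Sum>m<M. real m * x ^ m) + x ^ M * (real M * (1 - x) + x) = x" (is ?A)
    and "(1 - x) ^ 3 * (\<Sum>m<M. real m ^ 2 * x ^ m) +
           x ^ M * (real M ^ 2 * (1 - x)\<^sup>2 + 2 * real M * x * (1 - x) + x * (1 + x)) = x * (1 + x)" (is ?B)
    and "(1 - x) ^ 4 * (\<Sum>m<M. real m ^ 3 * x ^ m) +
           x ^ M * (real M ^ 3 * (1 - x) ^ 3 + 3 * real M ^ 2 * x * (1 - x)\<^sup>2 +
             3 * real M * x * (1 + x) * (1 - x) + x * (1 + 4 * x + x\<^sup>2)) = x * (1 + 4 * x + x\<^sup>2)" (is ?C)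
proof -
  show ?A by (induction M) (simp_all add: algebra_simps eval_nat_numeral)
  show ?B by (induction M) (simp_all add: algebra_simps eval_nat_numeral)
  show ?C by (induction M) (simp_all add: algebra_simps eval_nat_numeral)
qed

text \<open>As s tends to 0 the full sums behave like 1/s^2, 2/s^3 and 6/s^4. The third exceeds its
  leading term, by about 1/120, so the constant 6 is relaxed to 63/10.\<close>

lemma sum_mult_exp_le:
  fixes s :: real
  assumes "s > 0"
  shows "(\<Sum>m<M. real m * exp (- s) ^ m) \<le> 1 / s\<^sup>2"
    and "(\<Sum>m<M. real m ^ 2 * exp (- s) ^ m) \<le> 2 / s ^ 3"
    and "(\<Sum>m<M. real m ^ 3 * exp (- s) ^ m) \<le> 63 / 10 / s ^ 4"
proof -
  define x where "x = exp (- s)"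
  define w where "w = 2 * cosh s - 2"
  have x: "0 < x" "x < 1" using assms by (auto simp: x_def)
  have w: "w = (1 - x)\<^sup>2 / x" unfolding w_def x_def by (rule cosh_exp_neg)
  have w_ge: "s\<^sup>2 + s ^ 4 / 12 + s ^ 6 / 360 \<le> w" unfolding w_def by (rule cosh_lower_6)
  have s_pos: "s ^ n > 0" for n using assms by simp
  have w_ge1: "s\<^sup>2 + s ^ 4 / 12 \<le> w" using w_ge s_pos[of 6] by linarith
  have w_ge0: "s\<^sup>2 \<le> w" using w_ge1 s_pos[of 4] by linarith
  have w_pos: "w > 0" using w_ge0 s_pos[of 2] by linarith
  have sx: "1 - x > 0" using x by simp

  have "(1 - x) ^ 2 * (\<Sum>m<M. real m * x ^ m) \<le> x"
    using sum_mult_power_identities(1)[of x M] x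
    by (smt (verit, best) mult_nonneg_nonneg of_nat_0_le_iff zero_le_power)
  hence "(\<Sum>m<M. real m * x ^ m) \<le> x / (1 - x)\<^sup>2"
    using sx by (simp add: pos_le_divide_eq mult.commute)
  also have "\<dots> = 1 / w" using x by (simp add: w)
  also have "\<dots> \<le> 1 / s\<^sup>2" using w_ge0 s_pos[of 2] w_pos by (intro divide_left_mono mult_pos_pos) auto
  finally show "(\<Sum>m<M. real m * exp (- s) ^ m) \<le> 1 / s\<^sup>2" by (simp add: x_def)

  have "0 \<le> x ^ M * (real M ^ 2 * (1 - x)\<^sup>2 + 2 * real M * x * (1 - x) + x * (1 + x))"
    using x by (intro mult_nonneg_nonneg add_nonneg_nonneg) auto
  hence "(1 - x) ^ 3 * (\<Sum>m<M. real m ^ 2 * x ^ m) \<le> x * (1 + x)"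
    using sum_mult_power_identities(2)[of x M] by linarith
  hence "(\<Sum>m<M. real m ^ 2 * x ^ m) \<le> x * (1 + x) / (1 - x) ^ 3"
    using sx by (simp add: pos_le_divide_eq mult.commute)
  also have "\<dots> \<le> 2 / s ^ 3"
  \<comment> \<open>Only the square is a rational function of \<open>w\<close>.\<close>
  proof (rule power2_le_imp_le)
    have quot: "(a\<^sup>2 / x) / (b\<^sup>2 / x) ^ 3 = (x * a / b ^ 3)\<^sup>2" if "b \<noteq> 0" for a b
      using x that by (simp add: field_simps eval_nat_numeral)
    have "(x * (1 + x) / (1 - x) ^ 3)\<^sup>2 = (w + 4) / w ^ 3"
    proof -
      have "(w + 4) / w ^ 3 = ((1 + x)\<^sup>2 / x) / ((1 - x)\<^sup>2 / x) ^ 3"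
      proof -
        have "w + 4 = (1 + x)\<^sup>2 / x" using x by (simp add: w field_simps power2_eq_square)
        thus ?thesis by (simp add: w)
      qed
      also have "\<dots> = (x * (1 + x) / (1 - x) ^ 3)\<^sup>2"
        using x sx quot[of "1 - x" "1 + x"] by simp
      finally show ?thesis by simp
    qed
    also have "\<dots> \<le> 4 / s ^ 6"
    proof -
      \<comment> \<open>In terms of \<open>W\<close>, the ratio of \<open>w\<close> to its leading
        term s^2, the claim becomes s^2 W + 4 \<le> 4 W^3.\<close>
      define W where "W = w / s\<^sup>2"
      have wW: "w = s\<^sup>2 * W" using assms by (simp add: W_def)
      have "s\<^sup>2 * (1 + s\<^sup>2 / 12) \<le> s\<^sup>2 * W"
        using w_ge1 unfolding wW by (simp add: algebra_simps eval_nat_numeral)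
      hence W: "1 + s\<^sup>2 / 12 \<le> W" using s_pos[of 2] by (simp only: mult_le_cancel_left_pos)
      hence W1: "W \<ge> 1" using s_pos[of 2] by linarith
      have "3 * W \<le> W\<^sup>2 + W + 1" using zero_le_power2[of "W - 1"] by (simp add: power2_eq_square algebra_simps)
      hence "(s\<^sup>2 / 12) * (3 * W) \<le> (W - 1) * (W\<^sup>2 + W + 1)"
        using W W1 s_pos[of 2] by (intro mult_mono; linarith)
      also have "\<dots> = W ^ 3 - 1" by (simp add: algebra_simps eval_nat_numeral)
      finally have "s\<^sup>2 * W + 4 \<le> 4 * W ^ 3" by (simp add: algebra_simps)
      hence "s ^ 6 * (s\<^sup>2 * W + 4) \<le> s ^ 6 * (4 * W ^ 3)" using s_pos[of 6] by (intro mult_left_mono) auto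
      hence "s ^ 6 * (w + 4) \<le> 4 * w ^ 3"
        unfolding wW by (simp add: power_mult_distrib mult_ac flip: power_mult)
      thus ?thesis using w_pos s_pos[of 6] by (simp add: field_simps)
    qed
    also have "\<dots> = (2 / s ^ 3)\<^sup>2" by (simp add: power_divide flip: power_mult)
    finally show "(x * (1 + x) / (1 - x) ^ 3)\<^sup>2 \<le> (2 / s ^ 3)\<^sup>2" .
  qed (use assms in auto)
  finally show "(\<Sum>m<M. real m ^ 2 * exp (- s) ^ m) \<le> 2 / s ^ 3" by (simp add: x_def)

  have "0 \<le> x ^ M * (real M ^ 3 * (1 - x) ^ 3 + 3 * real M ^ 2 * x * (1 - x)\<^sup>2 +
             3 * real M * x * (1 + x) * (1 - x) + x * (1 + 4 * x + x\<^sup>2))"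
    using x by (intro mult_nonneg_nonneg add_nonneg_nonneg) auto
  hence "(1 - x) ^ 4 * (\<Sum>m<M. real m ^ 3 * x ^ m) \<le> x * (1 + 4 * x + x\<^sup>2)"
    using sum_mult_power_identities(3)[of x M] by linarith
  hence "(\<Sum>m<M. real m ^ 3 * x ^ m) \<le> x * (1 + 4 * x + x\<^sup>2) / (1 - x) ^ 4"
    using sx by (simp add: pos_le_divide_eq mult.commute)
  also have "\<dots> = (w + 6) / w\<^sup>2"
  proof -
    have "w + 6 = (1 + 4 * x + x\<^sup>2) / x" using x by (simp add: w field_simps power2_eq_square)
    hence "(w + 6) / w\<^sup>2 = ((1 + 4 * x + x\<^sup>2) / x) / ((1 - x)\<^sup>2 / x)\<^sup>2" by (simp add: w)
    also have "\<dots> = x * (1 + 4 * x + x\<^sup>2) / (1 - x) ^ 4"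
    proof -
      have "(a / x) / (b\<^sup>2 / x)\<^sup>2 = x * a / b ^ 4" if "b \<noteq> 0" for a b
        using x that by (simp add: field_simps eval_nat_numeral)
      thus ?thesis using sx by simp
    qed
    finally show ?thesis by simp
  qed
  also have "\<dots> \<le> 63 / 10 / s ^ 4"
  proof -
    define z where "z = s\<^sup>2"
    define W where "W = w / z"
    define V where "V = 1 + z / 12 + z\<^sup>2 / 360"
    have z: "z > 0" using assms by (simp add: z_def)
    have wW: "w = z * W" using z by (simp add: W_def)
    have s46: "s ^ 4 = z\<^sup>2" "s ^ 6 = z ^ 3" by (simp_all add: z_def flip: power_mult)
    have "z * V \<le> z * W"
      using w_ge unfolding wW s46 z_def[symmetric] by (simp add: V_def algebra_simps eval_nat_numeral)
    hence W: "V \<le> W" using z by (simp only: mult_le_cancel_left_pos)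
    have V: "V \<ge> 1 + z / 12" by (simp add: V_def)
    have "63 / 10 * V\<^sup>2 - z * V - 6 \<ge> 0"
    proof -
      \<comment> \<open>The square is completed; since 5/63 < 1/12, the linear term of
        \<open>V\<close> can absorb the shift. The remaining quadratic in u is positive by the
        tangent bound of u^2 at 50.\<close>
      define u where "u = z\<^sup>2"
      have u: "u \<ge> 0" by (simp add: u_def)
      have "63 / 10 * V\<^sup>2 - z * V - 6 = 63 / 10 * (V - 5 / 63 * z)\<^sup>2 - 5 / 126 * u - 6"
        by (simp add: u_def power2_eq_square field_simps)
      moreover have "1 + u / 360 \<le> V - 5 / 63 * z" using z by (simp add: V_def u_def)
      hence "(1 + u / 360)\<^sup>2 \<le> (V - 5 / 63 * z)\<^sup>2" using u by (intro power_mono) auto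
      moreover have "(1 + u / 360)\<^sup>2 = 1 + u / 180 + u\<^sup>2 / 129600"
        by (simp add: power2_eq_square field_simps)
      moreover have "u\<^sup>2 - 100 * u + 2500 \<ge> 0"
        using zero_le_power2[of "u - 50"] by (simp add: power2_eq_square algebra_simps)
      ultimately show ?thesis using u by linarith
    qed
    moreover have "0 \<le> (W - V) * (63 / 10 * (W + V) - z)"
      using W V z by (intro mult_nonneg_nonneg) auto
    moreover have "(W - V) * (63 / 10 * (W + V) - z) = 63 / 10 * W\<^sup>2 - z * W - (63 / 10 * V\<^sup>2 - z * V)"
      by (simp add: field_simps power2_eq_square)
    ultimately have "z * W + 6 \<le> 63 / 10 * W\<^sup>2" by linarith
    hence "z\<^sup>2 * (z * W + 6) \<le> z\<^sup>2 * (63 / 10 * W\<^sup>2)" by (intro mult_left_mono) auto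
    hence "z\<^sup>2 * (w + 6) \<le> 63 / 10 * w\<^sup>2"
      unfolding wW by (simp add: power_mult_distrib mult_ac)
    thus ?thesis using w_pos z unfolding s46 by (simp add: field_simps)
  qed
  finally show "(\<Sum>m<M. real m ^ 3 * exp (- s) ^ m) \<le> 63 / 10 / s ^ 4" by (simp add: x_def)
qed

text \<open>Write n = m j for each divisor m of n, then enlarge the range m j < M to a rectangle.
  The inner sums become moments with parameter j t.\<close>

lemma sum_divisor_sum_le:
  fixes f :: "nat \<Rightarrow> real"
  assumes "\<And>n. f n \<ge> 0"
  shows "(\<Sum>n<M. real (divisor_sum n) * f n) \<le> (\<Sum>j\<in>{1..M}. \<Sum>m<M. real m * f (m * j))"
proof -
  have "(\<Sum>n<M. real (divisor_sum n) * f n) = (\<Sum>n\<in>{1..<M}. real (divisor_sum n) * f n)"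
    by (rule sum.mono_neutral_right) (auto simp: not_le)
  also have "\<dots> = (\<Sum>n\<in>{1..<M}. \<Sum>d\<in>{d. d dvd n}. real d * f n)"
    by (simp add: divisor_sum_def sum_distrib_right)
  also have "\<dots> = (\<Sum>(n, d)\<in>(SIGMA n:{1..<M}. {d. d dvd n}). real d * f n)"
    by (rule sum.Sigma) auto
  also have "\<dots> = (\<Sum>(j, m)\<in>{(j, m). 1 \<le> j \<and> 1 \<le> m \<and> m * j < M}. real m * f (m * j))"
  proof (rule sum.reindex_bij_witness[of _ "\<lambda>(j, m). (m * j, m)" "\<lambda>(n, d). (n div d, d)"])
    fix p assume "p \<in> (SIGMA n:{1..<M}. {d. d dvd n})"
    then obtain n d where p: "p = (n, d)" "1 \<le> n" "n < M" "d dvd n" by auto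
    then obtain c where c: "n = d * c" by (elim dvdE)
    with p have "d > 0" "c > 0" by (auto intro: Nat.gr0I)
    thus "(case case p of (n, d) \<Rightarrow> (n div d, d) of (j, m) \<Rightarrow> (m * j, m)) = p"
      and "(case p of (n, d) \<Rightarrow> (n div d, d)) \<in> {(j, m). 1 \<le> j \<and> 1 \<le> m \<and> m * j < M}"
      and "(case case p of (n, d) \<Rightarrow> (n div d, d) of (j, m) \<Rightarrow> real m * f (m * j)) =
           (case p of (n, d) \<Rightarrow> real d * f n)"
      using p c by simp_all
  next
    fix p assume "p \<in> {(j, m). 1 \<le> j \<and> 1 \<le> m \<and> m * j < M}"
    then obtain j m where p: "p = (j, m)" "j > 0" "m > 0" "m * j < M" by auto
    thus "(case case p of (j, m) \<Rightarrow> (m * j, m) of (n, d) \<Rightarrow> (n div d, d)) = p"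
      and "(case p of (j, m) \<Rightarrow> (m * j, m)) \<in> (SIGMA n:{1..<M}. {d. d dvd n})"
      by (simp_all add: Suc_le_eq)
  qed
  also have "\<dots> \<le> (\<Sum>(j, m)\<in>{1..M} \<times> {..<M}. real m * f (m * j))"
  proof (rule sum_mono2)
    show "{(j, m). 1 \<le> j \<and> 1 \<le> m \<and> m * j < M} \<subseteq> {1..M} \<times> {..<M}"
    proof
      fix p assume "p \<in> {(j, m). 1 \<le> j \<and> 1 \<le> m \<and> m * j < M}"
      then obtain j m where p: "p = (j, m)" "1 \<le> j" "1 \<le> m" "m * j < M" by auto
      moreover have "j \<le> m * j" "m \<le> m * j" using p by simp_all
      ultimately have "j \<le> M" "m < M" by linarith+
      thus "p \<in> {1..M} \<times> {..<M}" using p by simp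
    qed
  qed (auto intro!: mult_nonneg_nonneg assms)
  also have "\<dots> = (\<Sum>j\<in>{1..M}. \<Sum>m<M. real m * f (m * j))"
    by (rule sum.cartesian_product [symmetric])
  finally show ?thesis .
qed

lemma sum_inverse_squares_le: "(\<Sum>j\<in>{1..M}. 1 / real j ^ 2) \<le> pi\<^sup>2 / 6"
proof -
  have "(\<Sum>j\<in>{1..M}. 1 / real j ^ 2) = (\<Sum>n<M. 1 / real (n + 1) ^ 2)"
    by (rule sum.reindex_bij_witness[of _ Suc "\<lambda>n. n - 1"]) auto
  also have "\<dots> \<le> (\<Sum>n. 1 / real (n + 1) ^ 2)"
    using inverse_squares_sums by (intro sum_le_suminf) (auto simp: sums_iff)
  also have "\<dots> = pi\<^sup>2 / 6" using inverse_squares_sums by (simp add: sums_iff)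
  finally show ?thesis .
qed

text \<open>The moment bound at s = j t is C/(j t)^(a+2); together with the factor j^a it leaves
  1/j^2, whence \<pi>^2/6.\<close>

lemma suminf_log_coeff_le_aux:
  fixes C t :: real
  assumes "t > 0"
    and "\<And>s M. s > 0 \<Longrightarrow> (\<Sum>m<M. real m ^ Suc a * exp (- s) ^ m) \<le> C / s ^ (a + 2)"
  shows "(\<Sum>n. real n ^ Suc a * log_coeff n * exp (- t) ^ n) \<le> C * (pi\<^sup>2 / 6) / t ^ (a + 2)"
proof (rule suminf_le_const)
  show "summable (\<lambda>n. real n ^ Suc a * log_coeff n * exp (- t) ^ n)"
    using assms(1) by (intro summable_log_coeff) auto
  fix M
  have C: "C \<ge> 0" using assms(2)[of 1 0] by simp
  have "(\<Sum>n<M. real n ^ Suc a * log_coeff n * exp (- t) ^ n) =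
        (\<Sum>n<M. real (divisor_sum n) * (real n ^ a * exp (- t) ^ n))"
    by (intro sum.cong) (auto simp: log_coeff_def)
  also have "\<dots> \<le> (\<Sum>j\<in>{1..M}. \<Sum>m<M. real m * (real (m * j) ^ a * exp (- t) ^ (m * j)))"
    by (rule sum_divisor_sum_le) auto
  also have "\<dots> = (\<Sum>j\<in>{1..M}. real j ^ a * (\<Sum>m<M. real m ^ Suc a * exp (- (real j * t)) ^ m))"
  proof (intro sum.cong refl)
    fix j
    have "exp (- t) ^ (m * j) = exp (- (real j * t)) ^ m" for m
      by (simp add: mult_ac flip: exp_of_nat_mult)
    thus "(\<Sum>m<M. real m * (real (m * j) ^ a * exp (- t) ^ (m * j))) =
          real j ^ a * (\<Sum>m<M. real m ^ Suc a * exp (- (real j * t)) ^ m)"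
      by (simp add: sum_distrib_left power_mult_distrib mult_ac)
  qed
  also have "\<dots> \<le> (\<Sum>j\<in>{1..M}. real j ^ a * (C / (real j * t) ^ (a + 2)))"
    using assms by (intro sum_mono mult_left_mono) auto
  also have "\<dots> = C / t ^ (a + 2) * (\<Sum>j\<in>{1..M}. 1 / real j ^ 2)"
    unfolding sum_distrib_left
    by (intro sum.cong) (auto simp: power_mult_distrib power_add field_simps power2_eq_square)
  also have "\<dots> \<le> C / t ^ (a + 2) * (pi\<^sup>2 / 6)"
    using assms(1) C by (intro mult_left_mono sum_inverse_squares_le) auto
  finally show "(\<Sum>n<M. real n ^ Suc a * log_coeff n * exp (- t) ^ n) \<le> C * (pi\<^sup>2 / 6) / t ^ (a + 2)"
    by simp
qed

lemma suminf_log_coeff_le: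
  assumes "t > 0"
  shows "(\<Sum>n. real n * log_coeff n * exp (- t) ^ n) \<le> (pi\<^sup>2 / 6) / t\<^sup>2"
    and "(\<Sum>n. real n ^ 2 * log_coeff n * exp (- t) ^ n) \<le> 2 * (pi\<^sup>2 / 6) / t ^ 3"
    and "(\<Sum>n. real n ^ 3 * log_coeff n * exp (- t) ^ n) \<le> 63 / 10 * (pi\<^sup>2 / 6) / t ^ 4"
  using suminf_log_coeff_le_aux[OF assms, of 0 1] suminf_log_coeff_le_aux[OF assms, of 1 2]
    suminf_log_coeff_le_aux[OF assms, of 2 "63 / 10"] sum_mult_exp_le
  by (simp_all add: eval_nat_numeral)

section \<open>Comparison of modulus and phase with their Taylor polynomials\<close>

lemma log_modulus_diff_sums:
  assumes "t > 0"
  shows "(\<lambda>n. log_coeff n * exp (- t) ^ n * (1 - cos (real n * \<theta>))) sums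
           ((\<Sum>n. log_coeff n * exp (- t) ^ n * cos (real n * 0)) -
            (\<Sum>n. log_coeff n * exp (- t) ^ n * cos (real n * \<theta>)))"
proof -
  have "summable (\<lambda>n. log_coeff n * exp (- t) ^ n * cos (real n * \<phi>))" for \<phi>
    using assms by (intro summable_log_coeff_mult) auto
  from sums_diff[OF summable_sums[OF this[of 0]] summable_sums[OF this[of \<theta>]]]
  show ?thesis by (simp add: algebra_simps)
qed

lemma log_modulus_diff:
  assumes "t > 0"
  shows "log_modulus k (exp (- t)) 0 - log_modulus k (exp (- t)) \<theta> =
           real k * (\<Sum>n. log_coeff n * exp (- t) ^ n * (1 - cos (real n * \<theta>)))"
  using sums_unique[OF log_modulus_diff_sums[OF assms, of \<theta>]]
  by (simp only: log_modulus_def right_diff_distrib [symmetric])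

lemma one_minus_cos_le: "1 - cos x \<le> x\<^sup>2 / 2" for x :: real
proof -
  have "1 - cos x = 2 * (sin (x / 2))\<^sup>2" using cos_double_sin[of "x / 2"] by simp
  also have "(sin (x / 2))\<^sup>2 \<le> (x / 2)\<^sup>2"
    by (rule abs_le_square_iff[THEN iffD1, OF abs_sin_x_le_abs_x])
  finally show ?thesis by (simp add: power_divide)
qed

lemma abs_sin_minus_self_le: "\<bar>sin x - x\<bar> \<le> \<bar>x\<bar> ^ 3 / 6" for x :: real
proof -
  have *: "x - x ^ 3 / 6 \<le> sin x \<and> sin x \<le> x" if "x \<ge> 0" for x :: real
  proof
    show "sin x \<le> x" using that by (rule sin_x_le_x)
    have "(\<lambda>x. sin x - x + x ^ 3 / 6) 0 \<le> (\<lambda>x. sin x - x + x ^ 3 / 6) x"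
    proof (rule DERIV_nonneg_imp_nondecreasing[OF that])
      fix y :: real
      have "((\<lambda>x. sin x - x + x ^ 3 / 6) has_real_derivative (cos y - 1 + y\<^sup>2 / 2)) (at y)"
        by (auto intro!: derivative_eq_intros simp: field_simps)
      thus "\<exists>D. ((\<lambda>x. sin x - x + x ^ 3 / 6) has_real_derivative D) (at y) \<and> 0 \<le> D"
        using one_minus_cos_le[of y] by (intro exI conjI) auto
    qed
    thus "x - x ^ 3 / 6 \<le> sin x" by simp
  qed
  have "\<bar>sin \<bar>x\<bar> - \<bar>x\<bar>\<bar> \<le> \<bar>x\<bar> ^ 3 / 6"
    using *[of "\<bar>x\<bar>"] by linarith
  moreover have "\<bar>sin \<bar>x\<bar> - \<bar>x\<bar>\<bar> = \<bar>sin x - x\<bar>" by (cases "x \<ge> 0") auto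
  ultimately show ?thesis by simp
qed

lemma log_modulus_diff_le:
  assumes "t > 0"
  shows "log_modulus k (exp (- t)) 0 - log_modulus k (exp (- t)) \<theta> \<le>
           real k * (pi\<^sup>2 / 6) / t ^ 3 * \<theta>\<^sup>2"
proof -
  have "(\<Sum>n. log_coeff n * exp (- t) ^ n * (1 - cos (real n * \<theta>))) \<le>
        (\<Sum>n. (real n ^ 2 * log_coeff n * exp (- t) ^ n) * (\<theta>\<^sup>2 / 2))"
  proof (rule suminf_le)
    fix n
    have "log_coeff n * exp (- t) ^ n * (1 - cos (real n * \<theta>)) \<le>
          log_coeff n * exp (- t) ^ n * ((real n * \<theta>)\<^sup>2 / 2)"
      using log_coeff_nonneg[of n] by (intro mult_left_mono one_minus_cos_le) auto
    thus "log_coeff n * exp (- t) ^ n * (1 - cos (real n * \<theta>)) \<le>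
          (real n ^ 2 * log_coeff n * exp (- t) ^ n) * (\<theta>\<^sup>2 / 2)"
      by (simp add: power_mult_distrib mult_ac)
  next
    show "summable (\<lambda>n. log_coeff n * exp (- t) ^ n * (1 - cos (real n * \<theta>)))"
      using log_modulus_diff_sums[OF assms] by (rule sums_summable)
    show "summable (\<lambda>n. (real n ^ 2 * log_coeff n * exp (- t) ^ n) * (\<theta>\<^sup>2 / 2))"
      using assms by (intro summable_mult2 summable_log_coeff) auto
  qed
  also have "\<dots> = (\<Sum>n. real n ^ 2 * log_coeff n * exp (- t) ^ n) * (\<theta>\<^sup>2 / 2)"
    using assms by (intro suminf_mult2 [symmetric] summable_log_coeff) auto
  also have "\<dots> \<le> 2 * (pi\<^sup>2 / 6) / t ^ 3 * (\<theta>\<^sup>2 / 2)"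
    by (intro mult_right_mono suminf_log_coeff_le assms) auto
  finally have "real k * (\<Sum>n. log_coeff n * exp (- t) ^ n * (1 - cos (real n * \<theta>))) \<le>
                  real k * (2 * (pi\<^sup>2 / 6) / t ^ 3 * (\<theta>\<^sup>2 / 2))"
    by (intro mult_left_mono) auto
  thus ?thesis unfolding log_modulus_diff[OF assms] by (simp add: field_simps)
qed

text \<open>The third-moment bound applied to the cubic estimate of sin x - x; the factor 21/20 is
  63/10 divided by 6.\<close>

lemma log_phase_diff_le:
  assumes "t > 0"
  shows "\<bar>log_phase k (exp (- t)) \<theta> - real k * (\<Sum>n. real n * log_coeff n * exp (- t) ^ n) * \<theta>\<bar> \<le>
           21 / 20 * real k * (pi\<^sup>2 / 6) / t ^ 4 * \<bar>\<theta>\<bar> ^ 3"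
proof -
  define r where "r = exp (- t)"
  have r: "0 \<le> r" "r < 1" using assms by (auto simp: r_def)
  define f where "f = (\<lambda>n. log_coeff n * r ^ n * (sin (real n * \<theta>) - real n * \<theta>))"
  have "(\<lambda>n. log_coeff n * r ^ n * sin (real n * \<theta>) - (real n ^ 1 * log_coeff n * r ^ n) * \<theta>) sums
           ((\<Sum>n. log_coeff n * r ^ n * sin (real n * \<theta>)) - (\<Sum>n. real n ^ 1 * log_coeff n * r ^ n) * \<theta>)"
    by (intro sums_diff sums_mult2 summable_sums summable_log_coeff_mult summable_log_coeff r) auto
  hence f: "f sums ((\<Sum>n. log_coeff n * r ^ n * sin (real n * \<theta>)) - (\<Sum>n. real n * log_coeff n * r ^ n) * \<theta>)"
    by (simp add: f_def algebra_simps)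
  have bound: "norm (f n) \<le> (real n ^ 3 * log_coeff n * r ^ n) * (\<bar>\<theta>\<bar> ^ 3 / 6)" for n
  proof -
    have "norm (f n) = log_coeff n * r ^ n * \<bar>sin (real n * \<theta>) - real n * \<theta>\<bar>"
      using log_coeff_nonneg[of n] r by (simp add: f_def abs_mult)
    also have "\<dots> \<le> log_coeff n * r ^ n * (\<bar>real n * \<theta>\<bar> ^ 3 / 6)"
      using log_coeff_nonneg[of n] r by (intro mult_left_mono abs_sin_minus_self_le) auto
    finally show ?thesis by (simp add: abs_mult power_mult_distrib mult_ac)
  qed
  have summ: "summable (\<lambda>n. (real n ^ 3 * log_coeff n * r ^ n) * (\<bar>\<theta>\<bar> ^ 3 / 6))"
    by (intro summable_mult2 summable_log_coeff r)
  have "norm (suminf f) \<le> (\<Sum>n. (real n ^ 3 * log_coeff n * r ^ n) * (\<bar>\<theta>\<bar> ^ 3 / 6))"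
    by (rule norm_suminf_le[OF bound summ])
  also have "\<dots> = (\<Sum>n. real n ^ 3 * log_coeff n * r ^ n) * (\<bar>\<theta>\<bar> ^ 3 / 6)"
    by (intro suminf_mult2 [symmetric] summable_log_coeff r)
  also have "\<dots> \<le> 63 / 10 * (pi\<^sup>2 / 6) / t ^ 4 * (\<bar>\<theta>\<bar> ^ 3 / 6)"
    unfolding r_def by (intro mult_right_mono suminf_log_coeff_le assms) auto
  finally have "real k * \<bar>suminf f\<bar> \<le> real k * (63 / 10 * (pi\<^sup>2 / 6) / t ^ 4 * (\<bar>\<theta>\<bar> ^ 3 / 6))"
    by (intro mult_left_mono) auto
  moreover have "log_phase k r \<theta> - real k * (\<Sum>n. real n * log_coeff n * r ^ n) * \<theta> = real k * suminf f"
    unfolding sums_unique[OF f, symmetric] log_phase_def by (simp only: right_diff_distrib mult.assoc)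
  ultimately show ?thesis unfolding r_def by (simp add: abs_mult field_simps)
qed

text \<open>This choice of \<open>t\<close> centres the tilted distribution at \<open>N\<close>, which removes the linear
  term of the phase.\<close>

lemma exists_tilt:
  assumes "k > 0" "T > 0" "real k * (pi\<^sup>2 / 6) / T\<^sup>2 \<le> real N"
  obtains t where "0 < t" "t \<le> T" "real k * (\<Sum>n. real n * log_coeff n * exp (- t) ^ n) = real N"
proof -
  define m where "m = (\<lambda>t. real k * (\<Sum>n. real n * log_coeff n * exp (- t) ^ n))"
  have summ: "summable (\<lambda>n. real n * log_coeff n * r ^ n)" if "0 \<le> r" "r < 1" for r
    using summable_log_coeff[OF that, of 1] by simp
  \<comment> \<open>At \<open>e\<close> the value of \<open>m\<close> is at least \<open>N\<close>:
    for n \<le> N + 1 one has n e \<le> 1/(N+1), so each of these N + 1 terms is at least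
    exp(-1/(N+1)) \<ge> 1 - 1/(N+1).\<close>
  define e where "e = min T (1 / real (Suc N) ^ 2)"
  have e: "0 < e" "e \<le> T" "e \<le> 1 / real (Suc N) ^ 2" using assms by (auto simp: e_def)
  have "\<exists>t\<ge>e. t \<le> T \<and> m t = real N"
  proof (rule IVT2)
    have "m T \<le> real k * ((pi\<^sup>2 / 6) / T\<^sup>2)"
      unfolding m_def by (intro mult_left_mono suminf_log_coeff_le assms) auto
    thus "m T \<le> real N" using assms(3) by simp
  next
    have divisor: "real n * log_coeff n = real (divisor_sum n)" for n
      by (cases "n = 0") (auto simp: log_coeff_def)
    have "real N = real (Suc N) * (1 - 1 / real (Suc N))" by (simp add: field_simps)
    also have "\<dots> \<le> real (Suc N) * exp (- (1 / real (Suc N)))"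
      using exp_ge_add_one_self[of "- (1 / real (Suc N))"] by (intro mult_left_mono) auto
    also have "\<dots> = (\<Sum>n\<in>{1..Suc N}. exp (- (1 / real (Suc N))))" by simp
    also have "\<dots> \<le> (\<Sum>n\<in>{1..Suc N}. real n * log_coeff n * exp (- e) ^ n)"
    proof (rule sum_mono)
      fix n assume n: "n \<in> {1..Suc N}"
      have "real n * e \<le> real (Suc N) * (1 / real (Suc N) ^ 2)"
        using n e by (intro mult_mono) auto
      also have "\<dots> = 1 / real (Suc N)" by (simp add: power2_eq_square)
      finally have "exp (- (1 / real (Suc N))) \<le> exp (- e) ^ n"
        by (simp flip: exp_of_nat_mult)
      also have "1 \<le> real (divisor_sum n)" using divisor_sum_pos[of n] n by simp
      hence "1 * exp (- e) ^ n \<le> real (divisor_sum n) * exp (- e) ^ n" by (intro mult_right_mono) auto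
      hence "exp (- e) ^ n \<le> real n * log_coeff n * exp (- e) ^ n" by (simp add: divisor)
      finally show "exp (- (1 / real (Suc N))) \<le> real n * log_coeff n * exp (- e) ^ n" .
    qed
    also have "\<dots> \<le> (\<Sum>n. real n * log_coeff n * exp (- e) ^ n)"
      using e log_coeff_nonneg by (intro sum_le_suminf summ) auto
    also have "\<dots> \<le> m e"
    proof -
      have "0 \<le> (\<Sum>n. real n * log_coeff n * exp (- e) ^ n)"
        using e log_coeff_nonneg by (intro suminf_nonneg summ) auto
      moreover have "1 \<le> real k" using assms(1) by simp
      ultimately have "1 * (\<Sum>n. real n * log_coeff n * exp (- e) ^ n) \<le>
               real k * (\<Sum>n. real n * log_coeff n * exp (- e) ^ n)"
        by (intro mult_right_mono)
      thus ?thesis unfolding m_def mult_1_left .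
    qed
    finally show "real N \<le> m e" .
  next
    show "\<forall>t. e \<le> t \<and> t \<le> T \<longrightarrow> isCont m t"
    proof safe
      fix t assume t: "e \<le> t"
      define K where "K = exp (- e / 2)"
      have "isCont (\<lambda>x. \<Sum>n. real n * log_coeff n * x ^ n) (exp (- t))"
      proof (rule isCont_powser)
        show "summable (\<lambda>n. real n * log_coeff n * K ^ n)" using e by (intro summ) (auto simp: K_def)
        show "norm (exp (- t)) < norm K" using t e by (simp add: K_def)
      qed
      moreover have "isCont (\<lambda>t. exp (- t)) t" by (intro continuous_intros)
      ultimately have "isCont (\<lambda>t. \<Sum>n. real n * log_coeff n * exp (- t) ^ n) t"
        by (rule isCont_o2[rotated])
      thus "isCont m t" unfolding m_def by (intro isCont_mult continuous_const)
    qed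
  qed (use e in auto)
  then obtain t where t: "e \<le> t" "t \<le> T" "m t = real N" by blast
  show ?thesis by (rule that[of t]) (use t e in \<open>simp_all add: m_def\<close>)
qed

text \<open>Real part of the geometric series in z = exp(-s + i y), subtracted from the series in
  exp(-s); \<open>D\<close> is the squared modulus of 1 - z.\<close>

lemma geometric_cos_sums:
  fixes s y :: real
  assumes "s > 0"
  shows "(\<lambda>n. exp (- s) ^ n * (1 - cos (real n * y))) sums
           (sinh s * (1 - cos y) / (2 * (cosh s - 1) * (cosh s - cos y)))"
proof -
  define x where "x = exp (- s)"
  have x: "0 < x" "x < 1" using assms by (auto simp: x_def)
  define z where "z = of_real x * cis y"
  have "norm z < 1" using x by (simp add: z_def norm_mult)
  hence "(\<lambda>n. z ^ n) sums (1 / (1 - z))" by (rule geometric_sums)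
  hence "(\<lambda>n. Re (z ^ n)) sums Re (1 / (1 - z))" by (rule sums_Re)
  moreover have "Re (z ^ n) = x ^ n * cos (real n * y)" for n
    by (simp add: z_def power_mult_distrib Complex.DeMoivre flip: of_real_power)
  moreover define D where "D = 1 - 2 * x * cos y + x\<^sup>2"
  have "Re (1 / (1 - z)) = (1 - x * cos y) / D"
  proof -
    have "(1 - x * cos y)\<^sup>2 + (x * sin y)\<^sup>2 = D"
    proof -
      have "(1 - x * c)\<^sup>2 + (x * s)\<^sup>2 = 1 - 2 * x * c + x\<^sup>2 * (s\<^sup>2 + c\<^sup>2)" for c s
        by (simp add: power2_eq_square algebra_simps)
      thus ?thesis by (simp add: D_def)
    qed
    thus ?thesis by (simp add: Re_divide z_def)
  qed
  ultimately have *: "(\<lambda>n. x ^ n * cos (real n * y)) sums ((1 - x * cos y) / D)" by simp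
  have "(\<lambda>n. x ^ n) sums (1 / (1 - x))" using x by (intro geometric_sums) simp
  from sums_diff[OF this *]
  have "(\<lambda>n. x ^ n * (1 - cos (real n * y))) sums (1 / (1 - x) - (1 - x * cos y) / D)"
    by (simp add: algebra_simps)
  also have "1 / (1 - x) - (1 - x * cos y) / D =
               sinh s * (1 - cos y) / (2 * (cosh s - 1) * (cosh s - cos y))"
  proof -
    have ex: "exp s = 1 / x" by (simp add: x_def exp_minus divide_inverse)
    have "cosh s = (1 / x + x) / 2" using ex by (simp add: cosh_def x_def)
    hence cosh: "cosh s - 1 = (1 - x)\<^sup>2 / (2 * x)" "cosh s - cos y = D / (2 * x)"
      using x by (simp_all add: D_def field_simps power2_eq_square)
    have "sinh s = (1 / x - x) / 2" using ex by (simp add: sinh_def x_def)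
    hence sinh: "sinh s = (1 - x\<^sup>2) / (2 * x)"
      using x by (simp add: field_simps power2_eq_square)
    have "(1 - x)\<^sup>2 > 0" using x by simp
    moreover have "D = (1 - x)\<^sup>2 + 2 * x * (1 - cos y)" by (simp add: D_def power2_eq_square algebra_simps)
    moreover have "0 \<le> 2 * x * (1 - cos y)" using x by simp
    ultimately have D: "D > 0" by linarith
    have "1 / (1 - x) - (1 - x * cos y) / D = (D - (1 - x * cos y) * (1 - x)) / ((1 - x) * D)"
      using x D by (simp add: divide_simps)
    also have "D - (1 - x * cos y) * (1 - x) = x * (1 + x) * (1 - cos y)"
      by (simp add: D_def power2_eq_square algebra_simps)
    also have "x * (1 + x) * (1 - cos y) / ((1 - x) * D) =
      (1 - x\<^sup>2) / (2 * x) * (1 - cos y) / (2 * ((1 - x)\<^sup>2 / (2 * x)) * (D / (2 * x)))"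
    proof -
      have "1 - x\<^sup>2 = (1 - x) * (1 + x)" by (simp add: power2_eq_square algebra_simps)
      thus ?thesis using x D by (simp add: divide_simps power2_eq_square)
    qed
    finally show ?thesis unfolding sinh cosh .
  qed
  finally show ?thesis by (simp add: x_def)
qed

section \<open>Lower bounds for the decay of the modulus\<close>

lemma nonneg_if_deriv_nonneg:
  fixes f f' :: "real \<Rightarrow> real"
  assumes "x \<ge> 0" "f 0 = 0" "\<And>y. 0 \<le> y \<Longrightarrow> y \<le> x \<Longrightarrow> (f has_real_derivative f' y) (at y)"
    and "\<And>y. 0 \<le> y \<Longrightarrow> y \<le> x \<Longrightarrow> f' y \<ge> 0"
  shows "f x \<ge> 0"
proof -
  have "f 0 \<le> f x"
    by (rule DERIV_nonneg_imp_nondecreasing[OF assms(1)]) (use assms(3,4) in blast)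
  thus ?thesis using assms(2) by simp
qed

lemma one_minus_cos_ge:
  fixes x :: real
  assumes "x \<ge> 0"
  shows "x\<^sup>2 / 2 - x ^ 4 / 24 \<le> 1 - cos x"
proof -
  have "0 \<le> 1 - cos x - (x\<^sup>2 / 2 - x ^ 4 / 24)"
  proof (rule nonneg_if_deriv_nonneg[where f = "\<lambda>x. 1 - cos x - (x\<^sup>2 / 2 - x ^ 4 / 24)"
        and f' = "\<lambda>y. sin y - (y - y ^ 3 / 6)", OF assms])
    fix y :: real assume "0 \<le> y"
    thus "0 \<le> sin y - (y - y ^ 3 / 6)" using abs_sin_minus_self_le[of y] by linarith
  qed (use assms in \<open>auto intro!: derivative_eq_intros simp: field_simps eval_nat_numeral\<close>)
  thus ?thesis by simp
qed

text \<open>For s > 0 equivalent to tanh(s/2) \<le> s/2. It bounds the factor sinh s/(2 (cosh s -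
  1)) of the geometric cosine sum below by 1/s.\<close>

lemma sinh_ge_cosh_minus_one:
  fixes s :: real
  assumes "s \<ge> 0"
  shows "2 * (cosh s - 1) \<le> s * sinh s"
proof -
  have sinh: "sinh y \<le> y * cosh y" if "y \<ge> 0" for y :: real
  proof -
    have "0 \<le> y * cosh y - sinh y"
      by (rule nonneg_if_deriv_nonneg[where f' = "\<lambda>y. y * sinh y", OF that])
         (auto intro!: derivative_eq_intros mult_nonneg_nonneg)
    thus ?thesis by simp
  qed
  have "0 \<le> s * sinh s - 2 * (cosh s - 1)"
    by (rule nonneg_if_deriv_nonneg[where f' = "\<lambda>s. s * cosh s - sinh s", OF assms])
       (use sinh in \<open>auto intro!: derivative_eq_intros\<close>)
  thus ?thesis by simp
qed

text \<open>The other factor of the geometric cosine sum. For small arguments it is close to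
  y^2/(s^2 + y^2), which is homogeneous, so the pairs (j t, j \<theta>) give nearly the same value
  for all small j.\<close>

definition cos_cosh_ratio :: "real \<Rightarrow> real \<Rightarrow> real" where
  "cos_cosh_ratio s y = (1 - cos y) / (cosh s - cos y)"

lemma cosh_gt_1: "s \<noteq> 0 \<Longrightarrow> cosh s > 1" for s :: real
  using cosh_real_ge_1[of s] cosh_real_one_iff[of s] by linarith

lemma cos_cosh_ratio_nonneg: "s > 0 \<Longrightarrow> cos_cosh_ratio s y \<ge> 0"
  unfolding cos_cosh_ratio_def using cosh_gt_1[of s] cos_le_one[of y]
  by (intro divide_nonneg_nonneg) linarith+

lemma cos_cosh_ratio_ge:
  assumes "s > 0" "0 \<le> v" "v \<le> 1 - cos y" "cosh s - 1 \<le> a"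
  shows "v / (a + v) \<le> cos_cosh_ratio s y"
proof -
  have "cosh s > 1" using assms(1) cosh_gt_1[of s] by simp
  have "v * (cosh s - 1) \<le> (1 - cos y) * a"
    using assms \<open>cosh s > 1\<close> by (intro mult_mono) auto
  hence "v * (cosh s - cos y) \<le> (1 - cos y) * (a + v)" by (simp add: algebra_simps)
  moreover have "0 < a + v" "0 < cosh s - cos y" using assms \<open>cosh s > 1\<close> cos_le_one[of y] by linarith+
  ultimately show ?thesis by (simp add: cos_cosh_ratio_def divide_simps mult.commute)
qed

lemma cos_cosh_ratio_mono:
  assumes "s > 0" "0 \<le> x" "x \<le> y" "y \<le> pi"
  shows "cos_cosh_ratio s x \<le> cos_cosh_ratio s y"
proof -
  have "(1 - cos x) / ((cosh s - 1) + (1 - cos x)) \<le> cos_cosh_ratio s y"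
    using assms cos_monotone_0_pi_le[of x y] by (intro cos_cosh_ratio_ge) auto
  thus ?thesis by (simp add: cos_cosh_ratio_def)
qed

lemma sum_inverse_divisors_le_log_coeff:
  assumes "n > 0"
  shows "(\<Sum>j\<in>{1..J}. if j dvd n then 1 / real j else 0) \<le> log_coeff n"
proof -
  have "(\<Sum>j\<in>{1..J}. if j dvd n then 1 / real j else 0) = (\<Sum>j\<in>{j\<in>{1..J}. j dvd n}. 1 / real j)"
    by (rule sum.inter_filter [symmetric]) simp
  also have "\<dots> \<le> (\<Sum>j\<in>{j. j dvd n}. 1 / real j)"
    using assms by (intro sum_mono2) auto
  also have "\<dots> = (\<Sum>d\<in>{d. d dvd n}. real d / real n)"
  proof (rule sum.reindex_bij_witness[of _ "\<lambda>d. n div d" "\<lambda>d. n div d"])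
    have *: "n div (n div d) = d \<and> n div d dvd n \<and> real (n div d) / real n = 1 / real d"
      if "d dvd n" for d
    proof -
      from that obtain c where c: "n = d * c" by (elim dvdE)
      with assms have "d > 0" "c > 0" by auto
      thus ?thesis using c by simp
    qed
    fix d assume "d \<in> {d. d dvd n}"
    with *[of d] show "n div (n div d) = d" "n div d \<in> {d. d dvd n}"
      "n div (n div d) = d" "n div d \<in> {d. d dvd n}" "real (n div d) / real n = 1 / real d"
      by auto
  qed
  also have "\<dots> = log_coeff n"
    by (simp add: log_coeff_def divisor_sum_def sum_divide_distrib)
  finally show ?thesis .
qed

text \<open>Since \<sigma>(n)/n is the sum of 1/j over the divisors j of n, and all terms are
  nonnegative, keeping only j \<le> J gives a lower bound; the multiples of j form a geometric
  cosine sum with parameters j t and j \<theta>.\<close>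

lemma log_modulus_diff_ge:
  assumes "t > 0"
  shows "real k / t * (\<Sum>j\<in>{1..J}. cos_cosh_ratio (real j * t) (real j * \<theta>) / real j ^ 2) \<le>
           log_modulus k (exp (- t)) 0 - log_modulus k (exp (- t)) \<theta>"
proof -
  define e where "e = (\<lambda>n. exp (- t) ^ n * (1 - cos (real n * \<theta>)))"
  have e_nonneg: "e n \<ge> 0" for n by (simp add: e_def)
  define g where "g = (\<lambda>s y. sinh s * (1 - cos y) / (2 * (cosh s - 1) * (cosh s - cos y)) :: real)"
  have e_sums: "(\<lambda>n. if j dvd n then e n else 0) sums g (real j * t) (real j * \<theta>)" if "j > 0" for j
  proof -
    have "(\<lambda>n. exp (- (real j * t)) ^ n * (1 - cos (real n * (real j * \<theta>)))) sums
            g (real j * t) (real j * \<theta>)"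
      unfolding g_def using that assms by (intro geometric_cos_sums) auto
    also have "(\<lambda>n. exp (- (real j * t)) ^ n * (1 - cos (real n * (real j * \<theta>)))) = (\<lambda>n. e (j * n))"
    proof
      fix n
      have "exp (- t) ^ (j * n) = (exp (- t) ^ j) ^ n" by (rule power_mult)
      also have "exp (- t) ^ j = exp (- (real j * t))" by (simp flip: exp_of_nat_mult)
      finally show "exp (- (real j * t)) ^ n * (1 - cos (real n * (real j * \<theta>))) = e (j * n)"
        by (simp add: e_def mult_ac)
    qed
    finally have e: "(\<lambda>n. if j dvd j * n then e (j * n) else 0) sums g (real j * t) (real j * \<theta>)" by simp
    show ?thesis
    proof (rule sums_mono_reindex[where g = "(*) j" and f = "\<lambda>n. if j dvd n then e n else 0",
          THEN iffD1, OF _ _ e])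
      show "strict_mono ((*) j)" using that by (simp add: strict_mono_def)
      show "(if j dvd n then e n else 0) = 0" if "n \<notin> range ((*) j)" for n
        using that by (auto simp: dvd_def)
    qed
  qed
  have lower: "(\<lambda>n. \<Sum>j\<in>{1..J}. 1 / real j * (if j dvd n then e n else 0)) sums
          (\<Sum>j\<in>{1..J}. 1 / real j * g (real j * t) (real j * \<theta>))"
    by (intro sums_sum sums_mult e_sums) auto
  have le: "(\<Sum>j\<in>{1..J}. 1 / real j * (if j dvd n then e n else 0)) \<le>
                   log_coeff n * exp (- t) ^ n * (1 - cos (real n * \<theta>))" for n
  proof (cases "n = 0")
    case False
    have "(\<Sum>j\<in>{1..J}. 1 / real j * (if j dvd n then e n else 0)) =
          (\<Sum>j\<in>{1..J}. if j dvd n then 1 / real j else 0) * e n"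
      unfolding sum_distrib_right by (intro sum.cong) auto
    also have "\<dots> \<le> log_coeff n * e n"
      using False by (intro mult_right_mono sum_inverse_divisors_le_log_coeff e_nonneg) auto
    finally show ?thesis by (simp add: e_def mult.assoc)
  qed (simp add: e_def)
  have upper: "(\<lambda>n. log_coeff n * exp (- t) ^ n * (1 - cos (real n * \<theta>))) sums
                   (\<Sum>n. log_coeff n * exp (- t) ^ n * (1 - cos (real n * \<theta>)))"
    by (intro summable_sums sums_summable[OF log_modulus_diff_sums] assms)
  have "(\<Sum>j\<in>{1..J}. 1 / real j * g (real j * t) (real j * \<theta>)) \<le>
      (\<Sum>n. log_coeff n * exp (- t) ^ n * (1 - cos (real n * \<theta>)))"
    by (rule sums_le[OF le lower upper])
  moreover have "1 / t * (\<Sum>j\<in>{1..J}. cos_cosh_ratio (real j * t) (real j * \<theta>) / real j ^ 2) \<le>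
                   (\<Sum>j\<in>{1..J}. 1 / real j * g (real j * t) (real j * \<theta>))"
    unfolding sum_distrib_left
  proof (rule sum_mono)
    fix j assume j: "j \<in> {1..J}"
    define s where "s = real j * t"
    have s: "s > 0" using j assms by (simp add: s_def)
    have cosh: "cosh s > 1" using s cosh_gt_1[of s] by simp
    have "1 / s \<le> sinh s / (2 * (cosh s - 1))"
      using sinh_ge_cosh_minus_one[of s] s cosh by (simp add: divide_simps mult.commute)
    hence "1 / s * cos_cosh_ratio s (real j * \<theta>) \<le> sinh s / (2 * (cosh s - 1)) * cos_cosh_ratio s (real j * \<theta>)"
      using s by (intro mult_right_mono cos_cosh_ratio_nonneg)
    also have "\<dots> = g s (real j * \<theta>)" by (simp add: g_def cos_cosh_ratio_def)
    finally have "1 / real j * (1 / s * cos_cosh_ratio s (real j * \<theta>)) \<le> 1 / real j * g s (real j * \<theta>)"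
      by (intro mult_left_mono) auto
    thus "1 / t * (cos_cosh_ratio (real j * t) (real j * \<theta>) / real j ^ 2) \<le>
            1 / real j * g (real j * t) (real j * \<theta>)"
      by (simp add: s_def power2_eq_square mult_ac)
  qed
  ultimately have "1 / t * (\<Sum>j\<in>{1..J}. cos_cosh_ratio (real j * t) (real j * \<theta>) / real j ^ 2) \<le>
      (\<Sum>n. log_coeff n * exp (- t) ^ n * (1 - cos (real n * \<theta>)))" by linarith
  hence "real k * (1 / t * (\<Sum>j\<in>{1..J}. cos_cosh_ratio (real j * t) (real j * \<theta>) / real j ^ 2)) \<le>
      real k * (\<Sum>n. log_coeff n * exp (- t) ^ n * (1 - cos (real n * \<theta>)))"
    by (intro mult_left_mono) auto
  thus ?thesis unfolding log_modulus_diff[OF assms] by simp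
qed

text \<open>Taylor expansion of both exponentials with a remainder of fifth order; 5/8 = 4 * 5/32 is
  the largest j t that occurs, and exp(5/8) \<le> 2 controls the remainder.\<close>

lemma cosh_minus_one_le:
  fixes s :: real
  assumes "0 \<le> s" "s \<le> 5 / 8"
  shows "cosh s - 1 \<le> s\<^sup>2 / 2 + 5 / 96 * s ^ 4"
proof -
  obtain a where a: "\<bar>a\<bar> \<le> \<bar>s\<bar>" "exp s = (\<Sum>m<5. s ^ m / fact m) + exp a / fact 5 * s ^ 5"
    using Maclaurin_exp_le[of s 5] by blast
  obtain b where b: "exp (- s) = (\<Sum>m<5. (- s) ^ m / fact m) + exp b / fact 5 * (- s) ^ 5"
    using Maclaurin_exp_le[of "- s" 5] by blast
  have "exp (5 / 8 :: real) ^ 8 = exp 1 ^ 5" by (simp flip: exp_of_nat_mult)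
  also have "\<dots> \<le> (272 / 100) ^ 5" using e_less_272 by (intro power_mono) auto
  also have "\<dots> \<le> 2 ^ 8" by (simp add: power_divide)
  finally have "exp (5 / 8 :: real) \<le> 2" by (subst (asm) power_mono_iff) auto
  moreover have "exp a \<le> exp (5 / 8)" using a(1) assms by simp
  ultimately have "exp a \<le> 2" by linarith
  have "cosh s = (exp s + exp (- s)) / 2" by (simp add: cosh_def)
  also have "exp s = 1 + s + s\<^sup>2 / 2 + s ^ 3 / 6 + s ^ 4 / 24 + exp a / 120 * s ^ 5"
    unfolding a(2) by (simp add: eval_nat_numeral)
  also have "exp (- s) = 1 - s + s\<^sup>2 / 2 - s ^ 3 / 6 + s ^ 4 / 24 - exp b / 120 * s ^ 5"
    unfolding b by (simp add: eval_nat_numeral)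
  also have "(1 + s + s\<^sup>2 / 2 + s ^ 3 / 6 + s ^ 4 / 24 + exp a / 120 * s ^ 5 +
      (1 - s + s\<^sup>2 / 2 - s ^ 3 / 6 + s ^ 4 / 24 - exp b / 120 * s ^ 5)) / 2 \<le>
      1 + s\<^sup>2 / 2 + s ^ 4 / 24 + exp a / 240 * s ^ 5"
    using assms by (simp add: field_simps)
  also have "exp a / 240 * s ^ 5 \<le> 2 / 240 * (5 / 8 * s ^ 4)"
  proof (intro mult_mono)
    have "s * s ^ 4 \<le> 5 / 8 * s ^ 4" using assms by (intro mult_right_mono) auto
    thus "s ^ 5 \<le> 5 / 8 * s ^ 4" by (simp add: eval_nat_numeral)
  qed (use \<open>exp a \<le> 2\<close> assms in auto)
  finally show ?thesis using zero_le_power[OF assms(1), of 4] by linarith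
qed

text \<open>Each of the four ratios is at least 949/1000 of its limit value, because 247/500 and
  1301/2500, which replace 1/2 in the bounds of cos and cosh, have a quotient above 949/1000.
  Finally 949/1000 (1 + 1/4 + 1/9 + 1/16) > 27/20.\<close>

lemma sum_cos_cosh_ratio_ge_core:
  assumes t: "0 < t" "t \<le> 5 / 32" and \<theta>: "0 \<le> \<theta>" "\<theta> \<le> 3 / 5 * t"
  shows "27 / 20 * (\<theta>\<^sup>2 / (t\<^sup>2 + \<theta>\<^sup>2)) \<le>
           (\<Sum>j\<in>{1..4}. cos_cosh_ratio (real j * t) (real j * \<theta>) / real j ^ 2)"
proof -
  define q where "q = \<theta>\<^sup>2 / (t\<^sup>2 + \<theta>\<^sup>2)"
  have q: "q \<ge> 0" using t by (simp add: q_def)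
  have *: "949 / 1000 * q \<le> cos_cosh_ratio (real j * t) (real j * \<theta>)" if j: "j \<in> {1..4}" for j :: nat
  proof -
    define s where "s = real j * t"
    define y where "y = real j * \<theta>"
    have "real j * t \<le> 4 * (5 / 32)" using j t by (intro mult_mono) auto
    hence s: "0 < s" "s \<le> 5 / 8" using j t by (auto simp: s_def)
    have "real j * \<theta> \<le> real j * (3 / 5 * t)" using \<theta> by (intro mult_left_mono) auto
    hence y: "0 \<le> y" "y \<le> 3 / 5 * s" using \<theta> by (auto simp: y_def s_def)
    have "y\<^sup>2 \<le> (3 / 8)\<^sup>2" using y s by (intro power_mono) auto
    hence "y\<^sup>2 * (y\<^sup>2 / 24) \<le> y\<^sup>2 * (3 / 500)" by (intro mult_left_mono) (auto simp: power2_eq_square)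
    moreover have "y ^ 4 = y\<^sup>2 * y\<^sup>2" by (simp flip: power_add)
    ultimately have v: "247 / 500 * y\<^sup>2 \<le> 1 - cos y" using one_minus_cos_ge[OF y(1)] by linarith
    have "s\<^sup>2 \<le> (5 / 8)\<^sup>2" using s by (intro power_mono) auto
    hence "s\<^sup>2 * (5 / 96 * s\<^sup>2) \<le> s\<^sup>2 * (51 / 2500)" by (intro mult_left_mono) (auto simp: power2_eq_square)
    moreover have "s ^ 4 = s\<^sup>2 * s\<^sup>2" by (simp flip: power_add)
    ultimately have a: "cosh s - 1 \<le> 1301 / 2500 * s\<^sup>2" using cosh_minus_one_le[of s] s by linarith
    have "247 / 500 * y\<^sup>2 / (1301 / 2500 * s\<^sup>2 + 247 / 500 * y\<^sup>2) \<le> cos_cosh_ratio s y"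
      by (rule cos_cosh_ratio_ge) (use s v a in auto)
    moreover have "949 / 1000 * q \<le> 247 / 500 * y\<^sup>2 / (1301 / 2500 * s\<^sup>2 + 247 / 500 * y\<^sup>2)"
    proof -
      have "q = y\<^sup>2 / (s\<^sup>2 + y\<^sup>2)"
        using j by (simp add: q_def y_def s_def power_mult_distrib flip: distrib_left)
      moreover have "0 < s\<^sup>2" "0 \<le> y\<^sup>2" using s by auto
      moreover from this have "949 / 1000 * y\<^sup>2 * (1301 / 2500 * s\<^sup>2 + 247 / 500 * y\<^sup>2) \<le>
          247 / 500 * y\<^sup>2 * (s\<^sup>2 + y\<^sup>2)"
      proof -
        have "949 / 1000 * (1301 / 2500 * u + 247 / 500 * w) \<le> 247 / 500 * (u + w)"
          if "0 \<le> u" "0 \<le> w" for u w :: real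
          using that by (simp add: field_simps)
        hence "949 / 1000 * (1301 / 2500 * s\<^sup>2 + 247 / 500 * y\<^sup>2) \<le> 247 / 500 * (s\<^sup>2 + y\<^sup>2)"
          by simp
        from mult_left_mono[OF this \<open>0 \<le> y\<^sup>2\<close>] show ?thesis by (simp add: mult_ac)
      qed
      ultimately show ?thesis by (simp add: divide_le_eq le_divide_eq add_pos_nonneg mult_ac)
    qed
    ultimately show ?thesis by (simp add: s_def y_def)
  qed
  have "27 / 20 * q \<le> (\<Sum>j\<in>{1..4::nat}. 949 / 1000 * q / real j ^ 2)"
    using q by (simp add: eval_nat_numeral)
  also have "\<dots> \<le> (\<Sum>j\<in>{1..4}. cos_cosh_ratio (real j * t) (real j * \<theta>) / real j ^ 2)"
    using * by (intro sum_mono divide_right_mono) auto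
  finally show ?thesis unfolding q_def .
qed

text \<open>Monotonicity in the angle reduces the claim to \<theta> = c t; it applies because j
  \<theta> \<le> 4 * 3/2 * 5/32 < \<pi>.\<close>

lemma sum_cos_cosh_ratio_ge_middle:
  assumes t: "0 < t" "t \<le> 5 / 32" and c: "0 \<le> c" "c \<le> 3 / 5"
    and \<theta>: "c * t \<le> \<theta>" "\<theta> \<le> 3 / 2 * t"
  shows "27 / 20 * (c\<^sup>2 / (1 + c\<^sup>2)) \<le>
           (\<Sum>j\<in>{1..4}. cos_cosh_ratio (real j * t) (real j * \<theta>) / real j ^ 2)"
proof -
  have "(c * t)\<^sup>2 / (t\<^sup>2 + (c * t)\<^sup>2) = c\<^sup>2 / (1 + c\<^sup>2)"
  proof -
    have "t\<^sup>2 + (c * t)\<^sup>2 = t\<^sup>2 * (1 + c\<^sup>2)" by (simp add: power_mult_distrib algebra_simps)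
    thus ?thesis using t by (simp add: power_mult_distrib)
  qed
  hence "27 / 20 * (c\<^sup>2 / (1 + c\<^sup>2)) \<le>
           (\<Sum>j\<in>{1..4}. cos_cosh_ratio (real j * t) (real j * (c * t)) / real j ^ 2)"
    using sum_cos_cosh_ratio_ge_core[OF t, of "c * t"] t c by simp
  also have "\<dots> \<le> (\<Sum>j\<in>{1..4}. cos_cosh_ratio (real j * t) (real j * \<theta>) / real j ^ 2)"
  proof (intro sum_mono divide_right_mono cos_cosh_ratio_mono)
    fix j :: nat assume j: "j \<in> {1..4}"
    have "0 \<le> c * t" using c t by simp
    hence "0 \<le> \<theta>" using \<theta> by linarith
    hence "real j * \<theta> \<le> 4 * (3 / 2 * (5 / 32))" using j t \<theta> by (intro mult_mono) auto
    thus "real j * \<theta> \<le> pi" using pi_gt3 by linarith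
    show "real j * (c * t) \<le> real j * \<theta>" using \<theta> by (intro mult_left_mono) auto
  qed (use t c in auto)
  finally show ?thesis .
qed

text \<open>Only j = 1 is used this far out: larger multiples of \<theta> may leave the range up to
  \<pi> where the ratio is monotone. At \<theta> = 3t/2 its limit value is 9/13, and 2/3 leaves room
  for the error terms.\<close>

lemma cos_cosh_ratio_ge_far:
  assumes t: "0 < t" "t \<le> 5 / 32" and \<theta>: "3 / 2 * t \<le> \<theta>" "\<theta> \<le> pi"
  shows "2 / 3 \<le> cos_cosh_ratio t \<theta>"
proof -
  define u where "u = t\<^sup>2"
  have "t\<^sup>2 \<le> (5 / 32)\<^sup>2" using t by (intro power_mono) auto
  hence u: "0 \<le> u" "u \<le> 25 / 1024" by (simp_all add: u_def power_divide)
  hence uu: "u * u \<le> u * (25 / 1024)" by (intro mult_left_mono) auto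
  have t4: "t ^ 4 = u * u" by (simp add: u_def flip: power_add)
  have "(3 / 2 * t)\<^sup>2 = 9 / 4 * u" "(3 / 2 * t) ^ 4 = 81 / 16 * (u * u)"
    by (simp_all add: power_mult_distrib power_divide u_def flip: power_add)
  hence "51 / 50 * u \<le> 1 - cos (3 / 2 * t)"
    using one_minus_cos_ge[of "3 / 2 * t"] t uu u by linarith
  hence v: "51 / 50 * t\<^sup>2 \<le> 1 - cos (3 / 2 * t)" unfolding u_def .
  have "cosh t - 1 \<le> 51 / 100 * u"
    using cosh_minus_one_le[of t] t uu u unfolding t4 u_def [symmetric] by linarith
  hence a: "cosh t - 1 \<le> 51 / 100 * t\<^sup>2" unfolding u_def .
  have "51 / 50 * t\<^sup>2 / (51 / 100 * t\<^sup>2 + 51 / 50 * t\<^sup>2) \<le> cos_cosh_ratio t (3 / 2 * t)"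
    by (rule cos_cosh_ratio_ge) (use t v a in auto)
  moreover have "51 / 50 * t\<^sup>2 / (51 / 100 * t\<^sup>2 + 51 / 50 * t\<^sup>2) = 2 / 3"
    using t by (simp add: divide_simps)
  ultimately have "2 / 3 \<le> cos_cosh_ratio t (3 / 2 * t)" by linarith
  also have "\<dots> \<le> cos_cosh_ratio t \<theta>" using t \<theta> by (intro cos_cosh_ratio_mono) auto
  finally show ?thesis .
qed

section \<open>Truncated Gaussian moments\<close>

lemma integral_power_gaussian_step:
  fixes B T :: real
  assumes "B > 0" "T \<ge> 0"
  shows "integral {0..T} (\<lambda>x. x ^ (m + 2) * exp (- (B * x\<^sup>2))) \<le>
           real (m + 1) / (2 * B) * integral {0..T} (\<lambda>x. x ^ m * exp (- (B * x\<^sup>2)))"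
proof -
  \<comment> \<open>Integration by parts with an explicit antiderivative; the boundary term
    \<open>F T\<close> is nonpositive, so truncation at \<open>T\<close> only helps.\<close>
  define F where "F = (\<lambda>x. - (x ^ (m + 1) * exp (- (B * x\<^sup>2)) / (2 * B)))"
  define f where "f = (\<lambda>m x. x ^ m * exp (- (B * x\<^sup>2)))"
  have int: "f m integrable_on {0..T}" for m
    unfolding f_def by (intro integrable_continuous_real continuous_intros)
  have "((\<lambda>x. f (m + 2) x - real (m + 1) / (2 * B) * f m x) has_integral F T - F 0) {0..T}"
  proof (rule fundamental_theorem_of_calculus[OF assms(2)])
    fix x assume "x \<in> {0..T}"
    have "((\<lambda>x. x ^ (m + 1)) has_real_derivative real (m + 1) * x ^ m) (at x within {0..T})"
      using DERIV_pow[of "m + 1" x "{0..T}"] by simp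
    moreover have "((\<lambda>x. exp (- (B * x\<^sup>2))) has_real_derivative exp (- (B * x\<^sup>2)) * (- (2 * B * x)))
                     (at x within {0..T})"
      by (auto intro!: derivative_eq_intros)
    ultimately have "(F has_real_derivative
        - ((real (m + 1) * x ^ m * exp (- (B * x\<^sup>2)) +
            exp (- (B * x\<^sup>2)) * (- (2 * B * x)) * x ^ (m + 1)) / (2 * B))) (at x within {0..T})"
      unfolding F_def by (intro DERIV_minus DERIV_cdivide DERIV_mult)
    also have "- ((real (m + 1) * x ^ m * exp (- (B * x\<^sup>2)) +
            exp (- (B * x\<^sup>2)) * (- (2 * B * x)) * x ^ (m + 1)) / (2 * B)) =
        f (m + 2) x - real (m + 1) / (2 * B) * f m x"
      using assms by (simp add: f_def field_simps)
    finally have "(F has_real_derivative f (m + 2) x - real (m + 1) / (2 * B) * f m x) (at x within {0..T})" .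
    thus "(F has_vector_derivative f (m + 2) x - real (m + 1) / (2 * B) * f m x) (at x within {0..T})"
      by (simp add: has_real_derivative_iff_has_vector_derivative)
  qed
  hence "integral {0..T} (\<lambda>x. f (m + 2) x - real (m + 1) / (2 * B) * f m x) = F T - F 0"
    by (rule integral_unique)
  moreover have "integral {0..T} (\<lambda>x. f (m + 2) x - real (m + 1) / (2 * B) * f m x) =
      integral {0..T} (f (m + 2)) - real (m + 1) / (2 * B) * integral {0..T} (f m)"
  proof -
    have "(\<lambda>x. real (m + 1) / (2 * B) * f m x) integrable_on {0..T}"
      using integrable_cmul[OF int[of m], of "real (m + 1) / (2 * B)"] by simp
    thus ?thesis using int[of "m + 2"] by (subst integral_diff) auto
  qed
  moreover have "F T - F 0 \<le> 0" using assms by (simp add: F_def)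
  ultimately show ?thesis unfolding f_def by linarith
qed

lemma integral_power_8_gaussian_le:
  fixes B T :: real
  assumes "B > 0" "T \<ge> 0"
  shows "integral {0..T} (\<lambda>x. x ^ 8 * exp (- (B * x\<^sup>2))) \<le>
           105 / 8 / B ^ 3 * integral {0..T} (\<lambda>x. x\<^sup>2 * exp (- (B * x\<^sup>2)))"
proof -
  define I where "I = (\<lambda>m :: nat. integral {0..T} (\<lambda>x. x ^ m * exp (- (B * x\<^sup>2))))"
  have *: "I (m + 2) \<le> real (m + 1) / (2 * B) * I m" for m
    unfolding I_def by (rule integral_power_gaussian_step[OF assms])
  have "I 8 \<le> 7 / (2 * B) * I 6" using *[of 6] by simp
  also have "\<dots> \<le> 7 / (2 * B) * (5 / (2 * B) * I 4)"
    using *[of 4] assms by (intro mult_left_mono) simp_all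
  also have "\<dots> \<le> 7 / (2 * B) * (5 / (2 * B) * (3 / (2 * B) * I 2))"
    using *[of 2] assms by (intro mult_left_mono) simp_all
  also have "\<dots> = 105 / 8 / B ^ 3 * I 2" by (simp add: field_simps eval_nat_numeral)
  finally show ?thesis by (simp add: I_def)
qed

text \<open>The substitution x = c y turns one Gaussian into the other and shrinks the interval to
  \<open>{0..T / c}\<close>, which lies inside the given one.\<close>

lemma integral_square_gaussian_scale:
  fixes A c T :: real
  assumes "c \<ge> 1" "T \<ge> 0"
  shows "integral {0..T} (\<lambda>x. x\<^sup>2 * exp (- (A / c\<^sup>2 * x\<^sup>2))) \<le>
           c ^ 3 * integral {0..T} (\<lambda>x. x\<^sup>2 * exp (- (A * x\<^sup>2)))"
proof -
  define f where "f = (\<lambda>x. x\<^sup>2 * exp (- (A * x\<^sup>2)))"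
  have c: "c > 0" using assms by simp
  have int: "f integrable_on {a..b}" for a b
    unfolding f_def by (intro integrable_continuous_real continuous_intros)
  have nonneg: "f x \<ge> 0" for x by (simp add: f_def)
  have "(f has_integral integral {0..T / c} f) {0..T / c}" using int by (rule integrable_integral)
  from has_integral_stretch_real[OF this, of "1 / c"]
  have "((\<lambda>x. f (x / c)) has_integral c * integral {0..T / c} f) {0..T}"
    using c image_mult_atLeastAtMost[of c 0 "T / c"] by (simp add: mult.commute[of _ c])
  hence "((\<lambda>x. c\<^sup>2 * f (x / c)) has_integral c\<^sup>2 * (c * integral {0..T / c} f)) {0..T}"
    by (rule has_integral_mult_right)
  also have "(\<lambda>x. c\<^sup>2 * f (x / c)) = (\<lambda>x. x\<^sup>2 * exp (- (A / c\<^sup>2 * x\<^sup>2)))"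
    using c by (auto simp: f_def power_divide)
  finally have "integral {0..T} (\<lambda>x. x\<^sup>2 * exp (- (A / c\<^sup>2 * x\<^sup>2))) = c\<^sup>2 * (c * integral {0..T / c} f)"
    by (rule integral_unique)
  also have "\<dots> = c ^ 3 * integral {0..T / c} f" by (simp add: eval_nat_numeral)
  also have "\<dots> \<le> c ^ 3 * integral {0..T} f"
  proof (intro mult_left_mono integral_subset_le)
    have "1 * T \<le> c * T" using assms by (intro mult_right_mono)
    hence "T / c \<le> T" using c by (simp add: divide_le_eq mult.commute)
    thus "{0..T / c} \<subseteq> {0..T}" by auto
  qed (use c in \<open>auto simp: int nonneg\<close>)
  finally show ?thesis by (simp add: f_def)
qed

text \<open>The sixth power of 1 - v \<le> exp(-v) with v = (x/q)^2 gives a polynomial minorant on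
  \<open>{0..q}\<close>, whose integral is about 0.02273 q^3.\<close>

lemma integral_square_gaussian_ge:
  fixes A q T :: real
  assumes "A > 0" "q > 0" "A * q\<^sup>2 = 6" "q \<le> T"
  shows "227 / 10000 * q ^ 3 \<le> integral {0..T} (\<lambda>x. x\<^sup>2 * exp (- (A * x\<^sup>2)))"
proof -
  define f where "f = (\<lambda>x. x\<^sup>2 * exp (- (A * x\<^sup>2)))"
  define g where "g = (\<lambda>x. x\<^sup>2 * (1 - (x / q)\<^sup>2) ^ 6)"
  define P where "P = (\<lambda>u :: real. u ^ 3 / 3 - 6 * u ^ 5 / 5 + 15 * u ^ 7 / 7 - 20 * u ^ 9 / 9 +
                        15 * u ^ 11 / 11 - 6 * u ^ 13 / 13 + u ^ 15 / 15)"
  have int: "f integrable_on {a..b}" for a b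
    unfolding f_def by (intro integrable_continuous_real continuous_intros)
  have nonneg: "f x \<ge> 0" for x by (simp add: f_def)
  have "(g has_integral q ^ 3 * P (q / q) - q ^ 3 * P (0 / q)) {0..q}"
  proof (rule fundamental_theorem_of_calculus)
    fix x assume "x \<in> {0..q}"
    define u where "u = x / q"
    have "(P has_real_derivative
            (u ^ 2 - 6 * u ^ 4 + 15 * u ^ 6 - 20 * u ^ 8 + 15 * u ^ 10 - 6 * u ^ 12 + u ^ 14)) (at (x / q))"
      unfolding P_def u_def by (auto intro!: derivative_eq_intros)
    moreover have "((\<lambda>x. x / q) has_real_derivative 1 / q) (at x within {0..q})"
      using assms by (auto intro!: derivative_eq_intros)
    ultimately have "((\<lambda>x. q ^ 3 * P (x / q)) has_real_derivative
            q ^ 3 * ((u ^ 2 - 6 * u ^ 4 + 15 * u ^ 6 - 20 * u ^ 8 + 15 * u ^ 10 - 6 * u ^ 12 + u ^ 14) * (1 / q)))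
            (at x within {0..q})"
      by (intro DERIV_cmult DERIV_chain2)
    also have "u ^ 2 - 6 * u ^ 4 + 15 * u ^ 6 - 20 * u ^ 8 + 15 * u ^ 10 - 6 * u ^ 12 + u ^ 14 =
                 u\<^sup>2 * (1 - u\<^sup>2) ^ 6"
      by (simp add: algebra_simps eval_nat_numeral)
    also have "q ^ 3 * (u\<^sup>2 * (1 - u\<^sup>2) ^ 6 * (1 / q)) = g x"
      using assms by (simp add: g_def u_def eval_nat_numeral)
    finally show "((\<lambda>x. q ^ 3 * P (x / q)) has_vector_derivative g x) (at x within {0..q})"
      by (simp add: has_real_derivative_iff_has_vector_derivative)
  qed (use assms in auto)
  hence g: "(g has_integral q ^ 3 * P 1) {0..q}" using assms by (simp add: P_def)
  have "227 / 10000 * q ^ 3 \<le> q ^ 3 * P 1" using assms by (simp add: P_def)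
  also have "\<dots> = integral {0..q} g" using g by (simp add: integral_unique)
  also have "\<dots> \<le> integral {0..q} f"
  proof (rule integral_le)
    fix x assume x: "x \<in> {0..q}"
    have "(x / q)\<^sup>2 \<le> 1" using x assms by (simp add: power_le_one_iff abs_square_le_1)
    moreover have "1 - (x / q)\<^sup>2 \<le> exp (- ((x / q)\<^sup>2))"
      using exp_ge_add_one_self[of "- ((x / q)\<^sup>2)"] by simp
    ultimately have "(1 - (x / q)\<^sup>2) ^ 6 \<le> exp (- ((x / q)\<^sup>2)) ^ 6" by (intro power_mono) auto
    also have "exp (- ((x / q)\<^sup>2)) ^ 6 = exp (- (6 * (x / q)\<^sup>2))" by (simp flip: exp_of_nat_mult)
    also have "6 * (x / q)\<^sup>2 = A * q\<^sup>2 * (x / q)\<^sup>2" by (simp only: assms(3))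
    also have "\<dots> = A * x\<^sup>2" using assms(2) by (simp add: power_divide)
    finally show "g x \<le> f x" unfolding f_def g_def by (intro mult_left_mono) auto
  qed (use g int in \<open>auto intro: has_integral_integrable\<close>)
  also have "\<dots> \<le> integral {0..T} f"
    by (rule integral_subset_le) (use assms in \<open>auto simp: int nonneg\<close>)
  finally show ?thesis by (simp add: f_def)
qed

text \<open>The left side decreases in \<open>l\<close> beyond m/y. This is how \<lambda> \<ge> 32
  reduces to \<lambda> = 32.\<close>

lemma power_mult_exp_neg_le:
  fixes l a y :: real
  assumes "0 < a" "a \<le> l" "real m \<le> a * y"
  shows "l ^ m * exp (- (y * l)) \<le> a ^ m * exp (- (y * a))"
proof -
  have "(l / a) ^ m \<le> exp (l / a - 1) ^ m"
    using exp_ge_add_one_self[of "l / a - 1"] assms by (intro power_mono) auto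
  also have "\<dots> = exp (real m * (l / a - 1))" by (simp flip: exp_of_nat_mult)
  also have "\<dots> \<le> exp (a * y * (l / a - 1))"
    using assms by (simp add: mult_right_mono)
  also have "a * y * (l / a - 1) = y * l - y * a" using assms by (simp add: field_simps)
  finally have "(l / a) ^ m * (a ^ m * exp (- (y * l))) \<le> exp (y * l - y * a) * (a ^ m * exp (- (y * l)))"
    using assms by (intro mult_right_mono) auto
  moreover have "(l / a) ^ m * (a ^ m * exp (- (y * l))) = l ^ m * exp (- (y * l))"
    using assms by (simp add: power_divide)
  moreover have "exp (y * l - y * a) * exp (- (y * l)) = exp (- (y * a))"
    by (simp flip: exp_add)
  hence "exp (y * l - y * a) * (a ^ m * exp (- (y * l))) = a ^ m * exp (- (y * a))"
    by (simp only: mult.left_commute)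
  ultimately show ?thesis by simp
qed

text \<open>Replaces an exponential by a rational power, so that the numerical comparisons become
  pure arithmetic.\<close>

lemma exp_neg_le_power:
  fixes y :: real
  assumes "0 \<le> y"
  shows "exp (- (real n * y)) \<le> 1 / (1 + y + y\<^sup>2 / 2) ^ n"
proof -
  have "(1 + y + y\<^sup>2 / 2) ^ n \<le> exp y ^ n"
    using exp_lower_Taylor_quadratic[OF assms] assms by (intro power_mono) auto
  also have "\<dots> = exp (real n * y)" by (simp flip: exp_of_nat_mult)
  finally show ?thesis using assms by (simp add: exp_minus divide_simps add_pos_nonneg mult.commute)
qed

section \<open>Positivity of the integral\<close>

lemma pi_squared_bounds: "16449 / 10000 \<le> pi\<^sup>2 / 6" "pi\<^sup>2 / 6 \<le> 1645 / 1000"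
proof -
  have "(3.14159 :: real)\<^sup>2 \<le> pi\<^sup>2" using pi_approx(1) by (intro power_mono) auto
  thus "16449 / 10000 \<le> pi\<^sup>2 / 6" by (simp add: power2_eq_square)
  have "pi\<^sup>2 \<le> (3.1416 :: real)\<^sup>2" using pi_approx(2) by (intro power_mono) auto
  thus "pi\<^sup>2 / 6 \<le> 1645 / 1000" by (simp add: power2_eq_square)
qed

lemma has_integral_reflect_2pi:
  assumes "(f has_integral I) {pi..2*pi}" "\<And>x. f (2 * pi - x) = f x"
  shows "(f has_integral I) {0..pi}"
proof -
  have "((f \<circ> ((+) (2*pi))) has_integral I) {-pi..0}"
    using assms(1) has_integral_shift_Icc_real[of f "2*pi" I "-pi" 0] by simp
  hence "((\<lambda>x. (f \<circ> ((+) (2*pi))) (- x)) has_integral I) {-0..-(-pi)}"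
    by (subst has_integral_reflect_real) simp
  thus ?thesis using assms(2) by (simp add: o_def)
qed

text \<open>The weight \<open>1 - cos \<theta>\<close> turns the value of the integral into a multiple of
  \<open>2r\<^sup>n p(n) - r\<^sup>n\<^sup>-\<^sup>1 p(n-1) - r\<^sup>n\<^sup>+\<^sup>1 p(n+1)\<close>.\<close>

lemma log_concave_if_integral_nonneg:
  assumes r: "0 < r" "r < 1"
    and nonneg: "0 \<le> integral {0..pi}
      (\<lambda>\<theta>. exp (log_modulus k r \<theta>) * cos (log_phase k r \<theta> - real (Suc n) * \<theta>) * (1 - cos \<theta>))"
    and k: "k > 0"
  shows "colored_partitions k n * colored_partitions k (Suc (Suc n)) \<le> (colored_partitions k (Suc n))\<^sup>2"
proof -
  define f where "f = (\<lambda>\<theta>. exp (log_modulus k r \<theta>) * cos (log_phase k r \<theta> - real (Suc n) * \<theta>) * (1 - cos \<theta>))"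
  define c where "c = colored_partitions k"
  have pos_factor: "0 \<le> b" if "0 \<le> a * b" "0 < a" for a b :: real
    using that by (metis linorder_not_le mult_pos_neg)
  have int: "(f has_integral pi * (2 * r ^ Suc n * c (Suc n) - r ^ n * c n -
               r ^ Suc (Suc n) * c (Suc (Suc n)))) {0..2*pi}"
    unfolding f_def c_def by (rule has_integral_concavity[OF r])
  \<comment> \<open>The modulus is even and the phase odd, so the integrand is symmetric about \<pi>
    and half a period decides the sign.\<close>
  have sym: "f (2 * pi - x) = f x" for x
  proof -
    have cos: "cos (real m * (2 * pi - x)) = cos (real m * x)"
      and sin: "sin (real m * (2 * pi - x)) = - sin (real m * x)" for m
    proof -
      have "real m * (2 * pi - x) = - (real m * x) + 2 * pi * real m" by (simp add: algebra_simps)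
      moreover have "cos (2 * pi * real m) = 1" "sin (2 * pi * real m) = 0"
        using cos_2npi[of m] sin_2npi[of m] by (simp_all add: mult_ac)
      ultimately show "cos (real m * (2 * pi - x)) = cos (real m * x)"
        and "sin (real m * (2 * pi - x)) = - sin (real m * x)"
        by (simp_all only: cos_add sin_add) simp_all
    qed
    have "log_modulus k r (2 * pi - x) = log_modulus k r x" unfolding log_modulus_def cos ..
    moreover have "log_phase k r (2 * pi - x) = - log_phase k r x"
      using suminf_minus[OF summable_log_coeff_mult[of r "\<lambda>n. sin (real n * x)"]] r
      unfolding log_phase_def sin by simp
    moreover have "cos (- log_phase k r x - real (Suc n) * (2 * pi - x)) =
                   cos (log_phase k r x - real (Suc n) * x)"
    proof -
      have "cos (- log_phase k r x - real (Suc n) * (2 * pi - x)) =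
            cos (log_phase k r x + real (Suc n) * (2 * pi - x))"
        using cos_minus[of "log_phase k r x + real (Suc n) * (2 * pi - x)"] by (simp add: algebra_simps)
      also have "\<dots> = cos (log_phase k r x - real (Suc n) * x)"
        unfolding cos_add cos_diff cos sin by simp
      finally show ?thesis .
    qed
    moreover have "cos (2 * pi - x) = cos x" using cos[of 1] by simp
    ultimately show ?thesis by (simp only: f_def)
  qed
  have int': "f integrable_on {0..2*pi}" using int by blast
  have "(f has_integral integral {pi..2*pi} f) {pi..2*pi}"
    by (intro integrable_integral integrable_subinterval_real[OF int']) auto
  hence "integral {0..pi} f = integral {pi..2*pi} f"
    using has_integral_reflect_2pi[of f] sym by (intro integral_unique) auto
  moreover have "integral {0..pi} f + integral {pi..2*pi} f = integral {0..2*pi} f"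
    by (intro Henstock_Kurzweil_Integration.integral_combine int') auto
  moreover have "0 \<le> integral {0..pi} f" using nonneg by (simp add: f_def)
  ultimately have "0 \<le> integral {0..2*pi} f" by linarith
  hence "0 \<le> pi * (2 * r ^ Suc n * c (Suc n) - r ^ n * c n - r ^ Suc (Suc n) * c (Suc (Suc n)))"
    using int by (simp add: integral_unique)
  hence "0 \<le> 2 * r ^ Suc n * c (Suc n) - r ^ n * c n - r ^ Suc (Suc n) * c (Suc (Suc n))"
    by (rule pos_factor) simp
  also have "\<dots> = r ^ n * (2 * (r * c (Suc n)) - c n - r\<^sup>2 * c (Suc (Suc n)))"
    by (simp add: algebra_simps power2_eq_square)
  finally have "0 \<le> 2 * (r * c (Suc n)) - c n - r\<^sup>2 * c (Suc (Suc n))"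
    by (rule pos_factor) (use r in simp)
  hence le: "c n + r\<^sup>2 * c (Suc (Suc n)) \<le> 2 * (r * c (Suc n))" by simp
  have pos: "c m > 0" for m unfolding c_def using k by (rule colored_partitions_pos)
  have "4 * (c n * (r\<^sup>2 * c (Suc (Suc n)))) \<le> (c n + r\<^sup>2 * c (Suc (Suc n)))\<^sup>2"
    using zero_le_power2[of "c n - r\<^sup>2 * c (Suc (Suc n))"] by (simp add: power2_eq_square algebra_simps)
  also have "\<dots> \<le> (2 * (r * c (Suc n)))\<^sup>2"
    using le r pos[of n] pos[of "Suc (Suc n)"] by (intro power_mono) auto
  finally have "r\<^sup>2 * (c n * c (Suc (Suc n))) \<le> r\<^sup>2 * (c (Suc n))\<^sup>2"
    by (simp add: power_mult_distrib mult_ac)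
  thus ?thesis using r by (simp add: c_def)
qed

text \<open>The target is C/l^2 because the main term will be bounded below by a multiple of
  t^3/l^2. The rational \<open>b\<close> rounds down the quadratic Taylor polynomial of exp
  y.\<close>

lemma middle_bound:
  fixes l w y b C :: real
  assumes "32 \<le> l" "2 \<le> 32 * y" "0 \<le> w" "0 < b" "b \<le> 1 + y + y\<^sup>2 / 2" "w * (1024 / b ^ 32) \<le> C"
  shows "w * exp (- (y * l)) \<le> C / l\<^sup>2"
proof -
  have y: "y \<ge> 0" using assms by linarith
  have "l\<^sup>2 * exp (- (y * l)) \<le> 32\<^sup>2 * exp (- (y * 32))"
    by (rule power_mult_exp_neg_le) (use assms in auto)
  also have "exp (- (y * 32)) \<le> 1 / (1 + y + y\<^sup>2 / 2) ^ 32"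
    using exp_neg_le_power[OF y, of 32] by (simp add: mult.commute)
  also have "\<dots> \<le> 1 / b ^ 32"
    using assms by (intro divide_left_mono power_mono mult_pos_pos zero_less_power) auto
  finally have "l\<^sup>2 * exp (- (y * l)) \<le> 1024 / b ^ 32" by simp
  hence "w * (l\<^sup>2 * exp (- (y * l))) \<le> w * (1024 / b ^ 32)" using assms(3) by (rule mult_left_mono)
  also have "\<dots> \<le> C" by fact
  finally show ?thesis using assms(1) by (simp add: field_simps)
qed

text \<open>The interval up to \<pi> does not scale with t, so the factor t^3 has to be recovered: l
  t \<ge> 2 gives t^3 \<ge> 8/l^3, at the price of three more powers of l against the
  exponential.\<close>

lemma far_bound:
  fixes l t :: real
  assumes "32 \<le> l" "0 < t" "2 \<le> l * t"
  shows "2 * pi * exp (- (2 / 3 * l)) \<le> 21 / 1000 * t ^ 3 / l\<^sup>2"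
proof -
  define Q :: real where "Q = 32 ^ 5 / (347 / 250) ^ 64"
  have Q: "Q \<ge> 0" by (simp add: Q_def)
  have "l ^ 5 * exp (- (2 / 3 * l)) \<le> 32 ^ 5 * exp (- (2 / 3 * 32))"
    by (rule power_mult_exp_neg_le) (use assms in auto)
  also have "exp (- (2 / 3 * 32)) = exp (- (real 64 * (1 / 3)))" by simp
  also have "\<dots> \<le> 1 / (1 + 1 / 3 + (1 / 3)\<^sup>2 / 2) ^ 64" by (rule exp_neg_le_power) simp
  also have "\<dots> \<le> 1 / (347 / 250) ^ 64"
    by (intro divide_left_mono power_mono mult_pos_pos zero_less_power) (auto simp: power2_eq_square)
  finally have *: "l ^ 5 * exp (- (2 / 3 * l)) \<le> Q" by (simp add: Q_def)
  have "2 ^ 3 \<le> (l * t) ^ 3" using assms by (intro power_mono) auto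
  hence lt: "8 \<le> l ^ 3 * t ^ 3" by (simp add: power_mult_distrib)
  have "8 * (l\<^sup>2 * exp (- (2 / 3 * l))) \<le> (l ^ 3 * t ^ 3) * (l\<^sup>2 * exp (- (2 / 3 * l)))"
    using lt by (intro mult_right_mono) auto
  also have "\<dots> = t ^ 3 * (l ^ 5 * exp (- (2 / 3 * l)))" by (simp add: eval_nat_numeral mult_ac)
  also have "\<dots> \<le> t ^ 3 * Q" using assms by (intro mult_left_mono *) auto
  finally have "l\<^sup>2 * exp (- (2 / 3 * l)) \<le> t ^ 3 * (Q / 8)" by simp
  hence "(2 * pi) * (l\<^sup>2 * exp (- (2 / 3 * l))) \<le> (2 * pi) * (t ^ 3 * (Q / 8))"
    by (intro mult_left_mono) auto
  also have "\<dots> \<le> (2 * (3.1416)) * (t ^ 3 * (Q / 8))"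
    using pi_approx(2) assms Q by (intro mult_right_mono mult_left_mono mult_nonneg_nonneg) auto
  also have "\<dots> = (2 * (3.1416) * (Q / 8)) * t ^ 3" by (simp only: mult_ac)
  also have "\<dots> \<le> 21 / 1000 * t ^ 3"
  proof (rule mult_right_mono)
    show "2 * (3.1416) * (Q / 8) \<le> 21 / 1000" by (simp add: Q_def power_divide)
  qed (use assms in simp)
  finally show ?thesis using assms(1) by (simp add: field_simps)
qed

text \<open>The interval is cut at 7/20, 9/20, 3/5 and 3/2 times t. The first piece supplies the
  positive contribution. On the others the cosine of the phase is only bounded by -1, and the
  repeated cuts let the decay exponent grow with the angle.\<close>

lemma integral_concavity_nonneg:
  fixes k N :: nat and t :: real
  assumes k: "k \<ge> 2" and t: "0 < t" "t \<le> 5 / 32" "32 * t \<le> real k"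
    and tilt: "real k * (\<Sum>n. real n * log_coeff n * exp (- t) ^ n) = real N"
    and integrable: "(\<lambda>\<theta>. exp (log_modulus k (exp (- t)) \<theta>) *
           cos (log_phase k (exp (- t)) \<theta> - real N * \<theta>) * (1 - cos \<theta>)) integrable_on {0..pi}"
  shows "0 \<le> integral {0..pi} (\<lambda>\<theta>. exp (log_modulus k (exp (- t)) \<theta>) *
           cos (log_phase k (exp (- t)) \<theta> - real N * \<theta>) * (1 - cos \<theta>))"
proof -
  define z where "z = pi\<^sup>2 / 6"
  define l where "l = real k / t"
  define h where "h = (\<lambda>\<theta>. log_modulus k (exp (- t)) 0 - log_modulus k (exp (- t)) \<theta>)"
  define p where "p = (\<lambda>\<theta>. log_phase k (exp (- t)) \<theta> - real N * \<theta>)"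
  define E where "E = (\<lambda>\<theta>. exp (- h \<theta>) * cos (p \<theta>) * (1 - cos \<theta>))"
  \<comment> \<open>\<open>A\<close> is the Gaussian exponent of the upper bound for the decay
    \<open>h\<close>, \<open>B\<close> that of the lower bound on \<open>{0..T}\<close>. The ratio
    (6/5)^2 is admissible since 25/36 * 1.645 < 27/20 * 400/449; its root 6/5 is the scale that
    relates the two Gaussians.\<close>
  define A where "A = l * z / t\<^sup>2"
  define B where "B = A / (6 / 5)\<^sup>2"
  define K where "K = 21 / 20 * l * z / t ^ 3"
  define T where "T = 7 / 20 * t"
  have z: "16449 / 10000 \<le> z" "z \<le> 1645 / 1000" unfolding z_def by (rule pi_squared_bounds)+
  have l: "32 \<le> l" using t by (simp add: l_def pos_le_divide_eq)
  have lt: "l * t = real k" using t by (simp add: l_def)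
  have A: "A > 0" using l z t by (simp add: A_def)
  have B: "B > 0" using A by (simp add: B_def)
  have T: "0 < T" using t by (simp add: T_def)

  have h_le: "h \<theta> \<le> A * \<theta>\<^sup>2" for \<theta>
    using log_modulus_diff_le[OF t(1), of k \<theta>] t
    by (simp add: h_def A_def l_def z_def eval_nat_numeral field_simps)
  have h_ge: "l * (\<Sum>j\<in>{1..J}. cos_cosh_ratio (real j * t) (real j * \<theta>) / real j ^ 2) \<le> h \<theta>" for J \<theta>
    using log_modulus_diff_ge[OF t(1), where k = k and J = J and \<theta> = \<theta>] by (simp add: h_def l_def)
  have p_le: "\<bar>p \<theta>\<bar> \<le> K * \<theta> ^ 3" if "\<theta> \<ge> 0" for \<theta>
    using log_phase_diff_le[OF t(1), of k \<theta>] that t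
    unfolding tilt p_def K_def l_def z_def by (simp add: eval_nat_numeral field_simps)

  \<comment> \<open>By cos p \<ge> 1 - p^2/2 the integrand splits in two: the upper bound for
    \<open>h\<close> serves the first part, the lower bound the second. In the latter
    \<open>1 - cos \<theta>\<close> and p^2 together produce the eighth power of \<theta>.\<close>
  have core: "999 / 2000 * (\<theta>\<^sup>2 * exp (- (A * \<theta>\<^sup>2))) - K\<^sup>2 / 4 * (\<theta> ^ 8 * exp (- (B * \<theta>\<^sup>2))) \<le> E \<theta>"
    if \<theta>: "\<theta> \<in> {0..T}" for \<theta>
  proof -
    have th: "0 \<le> \<theta>" "\<theta> \<le> 7 / 20 * t" using \<theta> by (auto simp: T_def)
    have "B * \<theta>\<^sup>2 \<le> l * (27 / 20 * (\<theta>\<^sup>2 / (t\<^sup>2 + \<theta>\<^sup>2)))"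
    proof -
      have "\<theta>\<^sup>2 \<le> (7 / 20 * t)\<^sup>2" using th by (intro power_mono) auto
      hence "t\<^sup>2 + \<theta>\<^sup>2 \<le> 449 / 400 * t\<^sup>2" by (simp add: power_mult_distrib power_divide)
      hence "\<theta>\<^sup>2 / (449 / 400 * t\<^sup>2) \<le> \<theta>\<^sup>2 / (t\<^sup>2 + \<theta>\<^sup>2)"
        using t by (intro divide_left_mono mult_pos_pos add_pos_nonneg) auto
      hence "l * (27 / 20 * (\<theta>\<^sup>2 / (449 / 400 * t\<^sup>2))) \<le> l * (27 / 20 * (\<theta>\<^sup>2 / (t\<^sup>2 + \<theta>\<^sup>2)))"
        using l by (intro mult_left_mono) auto
      note le = this
      have "B * \<theta>\<^sup>2 = 25 / 36 * z * (l * (\<theta>\<^sup>2 / t\<^sup>2))"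
        by (simp add: B_def A_def power_divide mult_ac)
      also have "\<dots> \<le> 540 / 449 * (l * (\<theta>\<^sup>2 / t\<^sup>2))"
        using z l by (intro mult_right_mono) auto
      also have "\<dots> = l * (27 / 20 * (\<theta>\<^sup>2 / (449 / 400 * t\<^sup>2)))" by simp
      also note le
      finally show ?thesis .
    qed
    also have "\<dots> \<le> l * (\<Sum>j\<in>{1..4}. cos_cosh_ratio (real j * t) (real j * \<theta>) / real j ^ 2)"
      using l t th by (intro mult_left_mono sum_cos_cosh_ratio_ge_core) auto
    also have "\<dots> \<le> h \<theta>" by (rule h_ge)
    finally have B_le: "B * \<theta>\<^sup>2 \<le> h \<theta>" .
    have "\<bar>p \<theta>\<bar>\<^sup>2 \<le> (K * \<theta> ^ 3)\<^sup>2"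
      using p_le[OF th(1)] by (intro power_mono) auto
    hence p2: "(p \<theta>)\<^sup>2 / 2 \<le> K\<^sup>2 * \<theta> ^ 6 / 2" by (simp add: power_mult_distrib flip: power_mult)
    define v where "v = 1 - cos \<theta>"
    have v: "0 \<le> v" "v \<le> \<theta>\<^sup>2 / 2" unfolding v_def by (simp, rule one_minus_cos_le)
    have v_ge: "999 / 2000 * \<theta>\<^sup>2 \<le> v"
    proof -
      have "\<theta>\<^sup>2 \<le> (7 / 128)\<^sup>2" using th t by (intro power_mono) auto
      hence "\<theta>\<^sup>2 * (\<theta>\<^sup>2 / 24) \<le> \<theta>\<^sup>2 * (1 / 2000)" by (intro mult_left_mono) (auto simp: power2_eq_square)
      moreover have "\<theta> ^ 4 = \<theta>\<^sup>2 * \<theta>\<^sup>2" by (simp flip: power_add)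
      ultimately show ?thesis using one_minus_cos_ge[OF th(1)] unfolding v_def by linarith
    qed
    have "999 / 2000 * (\<theta>\<^sup>2 * exp (- (A * \<theta>\<^sup>2))) = exp (- (A * \<theta>\<^sup>2)) * (999 / 2000 * \<theta>\<^sup>2)" by simp
    also have "\<dots> \<le> exp (- h \<theta>) * v"
      using h_le[of \<theta>] v_ge v by (intro mult_mono) auto
    finally have 1: "999 / 2000 * (\<theta>\<^sup>2 * exp (- (A * \<theta>\<^sup>2))) \<le> exp (- h \<theta>) * v" .
    have "exp (- h \<theta>) * (v * ((p \<theta>)\<^sup>2 / 2)) \<le> exp (- (B * \<theta>\<^sup>2)) * (\<theta>\<^sup>2 / 2 * (K\<^sup>2 * \<theta> ^ 6 / 2))"
      using B_le v p2 by (intro mult_mono mult_nonneg_nonneg) auto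
    also have "\<dots> = K\<^sup>2 / 4 * (\<theta> ^ 8 * exp (- (B * \<theta>\<^sup>2)))"
      by (simp add: eval_nat_numeral)
    finally have "999 / 2000 * (\<theta>\<^sup>2 * exp (- (A * \<theta>\<^sup>2))) - K\<^sup>2 / 4 * (\<theta> ^ 8 * exp (- (B * \<theta>\<^sup>2))) \<le>
                    exp (- h \<theta>) * v - exp (- h \<theta>) * (v * ((p \<theta>)\<^sup>2 / 2))"
      by (rule diff_mono[OF 1])
    also have "\<dots> = exp (- h \<theta>) * v * (1 - (p \<theta>)\<^sup>2 / 2)" by (simp only: right_diff_distrib mult_1_right mult.assoc)
    also have "\<dots> \<le> exp (- h \<theta>) * v * cos (p \<theta>)"
      using one_minus_cos_le[of "p \<theta>"] v by (intro mult_left_mono) auto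
    also have "\<dots> = E \<theta>" by (simp add: E_def v_def mult_ac)
    finally show ?thesis .
  qed

  have E_ge: "- (exp (- h \<theta>) * (1 - cos \<theta>)) \<le> E \<theta>" for \<theta>
  proof -
    have "exp (- h \<theta>) * (1 - cos \<theta>) * (- 1) \<le> exp (- h \<theta>) * (1 - cos \<theta>) * cos (p \<theta>)"
      by (intro mult_left_mono) auto
    thus ?thesis by (simp add: E_def mult_ac)
  qed
  have E_integrable: "E integrable_on {0..pi}"
  proof -
    define M where "M = exp (log_modulus k (exp (- t)) 0)"
    have "(\<lambda>\<theta>. inverse M * (exp (log_modulus k (exp (- t)) \<theta>) *
           cos (log_phase k (exp (- t)) \<theta> - real N * \<theta>) * (1 - cos \<theta>))) integrable_on {0..pi}"
      using integrable_cmul[OF integrable, of "inverse M"] by simp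
    also have "(\<lambda>\<theta>. inverse M * (exp (log_modulus k (exp (- t)) \<theta>) *
           cos (log_phase k (exp (- t)) \<theta> - real N * \<theta>) * (1 - cos \<theta>))) = E"
      by (auto simp: E_def h_def p_def M_def exp_diff divide_inverse mult_ac)
    finally show ?thesis .
  qed
  have T_pi: "T \<le> pi" "9 / 20 * t \<le> pi" "3 / 5 * t \<le> pi" "3 / 2 * t \<le> pi"
    using t pi_gt3 by (simp_all add: T_def)
  have int: "E integrable_on {a..b}" if "0 \<le> a" "b \<le> pi" for a b
    using E_integrable that by (intro integrable_subinterval_real[OF E_integrable]) auto

  \<comment> \<open>On \<open>{c * t..d * t}\<close> the decay is bounded by its estimate at the
    left end; (d^3 - c^3)/6 comes from integrating x^2/2.\<close>
  have middle: "- (t ^ 3 * ((d ^ 3 - c ^ 3) / 6 * exp (- (y * l)))) \<le> integral {c * t..d * t} E"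
    if "0 \<le> c" "c \<le> 3 / 5" "c \<le> d" "d \<le> 3 / 2" "y \<le> 27 / 20 * (c\<^sup>2 / (1 + c\<^sup>2))" for c d y
  proof -
    have cd: "c * t \<le> d * t" using that t by (intro mult_right_mono) auto
    have dt': "d * t \<le> 3 / 2 * t" using that t by (intro mult_right_mono) auto
    hence dt: "d * t \<le> pi" using T_pi by linarith
    define w where "w = exp (- (y * l)) / 2"
    have "((\<lambda>x. - (w * x\<^sup>2)) has_integral (- (w * (d * t) ^ 3 / 3)) - (- (w * (c * t) ^ 3 / 3))) {c * t..d * t}"
      by (rule fundamental_theorem_of_calculus[OF cd])
         (auto intro!: derivative_eq_intros simp flip: has_real_derivative_iff_has_vector_derivative)
    moreover have "- (w * x\<^sup>2) \<le> E x" if x: "x \<in> {c * t..d * t}" for x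
    proof -
      have "x \<le> d * t" using x by simp
      also note dt'
      finally have "x \<le> 3 / 2 * t" .
      hence "l * (27 / 20 * (c\<^sup>2 / (1 + c\<^sup>2))) \<le>
               l * (\<Sum>j\<in>{1..4}. cos_cosh_ratio (real j * t) (real j * x) / real j ^ 2)"
        using x l t \<open>0 \<le> c\<close> \<open>c \<le> 3 / 5\<close>
        by (intro mult_left_mono sum_cos_cosh_ratio_ge_middle) auto
      moreover have "l * y \<le> l * (27 / 20 * (c\<^sup>2 / (1 + c\<^sup>2)))"
        using \<open>y \<le> 27 / 20 * (c\<^sup>2 / (1 + c\<^sup>2))\<close> l by (intro mult_left_mono) auto
      ultimately have "y * l \<le> h x" using h_ge[where J = 4 and \<theta> = x] by (simp add: mult.commute)
      hence "exp (- h x) * (1 - cos x) \<le> exp (- (y * l)) * (x\<^sup>2 / 2)"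
        using one_minus_cos_le[of x] by (intro mult_mono) auto
      thus ?thesis using E_ge[of x] by (simp add: w_def)
    qed
    ultimately have "(- (w * (d * t) ^ 3 / 3)) - (- (w * (c * t) ^ 3 / 3)) \<le> integral {c * t..d * t} E"
      using int[of "c * t" "d * t"] dt that t
      by (intro has_integral_le[OF _ integrable_integral]) auto
    moreover have "(- (w * (d * t) ^ 3 / 3)) - (- (w * (c * t) ^ 3 / 3)) =
                     - (t ^ 3 * ((d ^ 3 - c ^ 3) / 6 * exp (- (y * l))))"
      by (simp add: w_def power_mult_distrib field_simps)
    ultimately show ?thesis by simp
  qed

  have far: "- (2 * pi * exp (- (2 / 3 * l))) \<le> integral {3 / 2 * t..pi} E"
  proof -
    have "((\<lambda>x. - (2 * exp (- (2 / 3 * l)))) has_integral (pi - 3 / 2 * t) *\<^sub>R (- (2 * exp (- (2 / 3 * l)))))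
            {3 / 2 * t..pi}"
      using has_integral_const_real[of "- (2 * exp (- (2 / 3 * l)))" "3 / 2 * t" pi] T_pi by simp
    moreover have "- (2 * exp (- (2 / 3 * l))) \<le> E x" if x: "x \<in> {3 / 2 * t..pi}" for x
    proof -
      have "l * (2 / 3) \<le> l * cos_cosh_ratio t x"
        using l t x by (intro mult_left_mono cos_cosh_ratio_ge_far) auto
      also have "\<dots> \<le> h x" using h_ge[where J = 1 and \<theta> = x] by simp
      finally have "exp (- h x) * (1 - cos x) \<le> exp (- (2 / 3 * l)) * 2"
        using cos_ge_minus_one[of x] by (intro mult_mono) auto
      thus ?thesis using E_ge[of x] by linarith
    qed
    ultimately have "(pi - 3 / 2 * t) *\<^sub>R (- (2 * exp (- (2 / 3 * l)))) \<le> integral {3 / 2 * t..pi} E"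
      using int[of "3 / 2 * t" pi] t by (intro has_integral_le[OF _ integrable_integral]) auto
    moreover have "(pi - 3 / 2 * t) * (2 * exp (- (2 / 3 * l))) \<le> pi * (2 * exp (- (2 / 3 * l)))"
      using t by (intro mult_right_mono) auto
    hence "- (2 * pi * exp (- (2 / 3 * l))) \<le> (pi - 3 / 2 * t) *\<^sub>R (- (2 * exp (- (2 / 3 * l))))"
      by simp
    ultimately show ?thesis by (rule order_trans[rotated])
  qed

  define I where "I = integral {0..T} (\<lambda>x. x\<^sup>2 * exp (- (A * x\<^sup>2)))"
  have I_nonneg: "I \<ge> 0" unfolding I_def
    by (intro integral_nonneg integrable_continuous_real continuous_intros) auto
  have core_int: "36 / 250 * I \<le> integral {0..T} E"
  proof -
    define f8 where "f8 = (\<lambda>x. x ^ 8 * exp (- (B * x\<^sup>2)))"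
    define f2 where "f2 = (\<lambda>x. x\<^sup>2 * exp (- (A * x\<^sup>2)))"
    have ints: "f8 integrable_on {0..T}" "f2 integrable_on {0..T}"
      unfolding f8_def f2_def by (intro integrable_continuous_real continuous_intros)+
    have "((\<lambda>x. 999 / 2000 * f2 x - K\<^sup>2 / 4 * f8 x) has_integral
             999 / 2000 * integral {0..T} f2 - K\<^sup>2 / 4 * integral {0..T} f8) {0..T}"
      by (intro has_integral_diff has_integral_mult_right integrable_integral ints)
    hence "999 / 2000 * integral {0..T} f2 - K\<^sup>2 / 4 * integral {0..T} f8 \<le> integral {0..T} E"
      using core int[of 0 T] T_pi unfolding f2_def f8_def
      by (intro has_integral_le[OF _ integrable_integral]) auto
    \<comment> \<open>The eighth moment is a constant over \<open>l * z\<close> times the second. At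
      l = 32 the result is just below 355/1000, which leaves 36/250 out of 999/2000.\<close>
    moreover have "K\<^sup>2 / 4 * integral {0..T} f8 \<le> 355 / 1000 * I"
    proof -
      have "integral {0..T} f8 \<le> 105 / 8 / B ^ 3 * integral {0..T} (\<lambda>x. x\<^sup>2 * exp (- (B * x\<^sup>2)))"
        unfolding f8_def using B T by (intro integral_power_8_gaussian_le) auto
      also have "\<dots> \<le> 105 / 8 / B ^ 3 * ((6 / 5) ^ 3 * I)"
        unfolding I_def B_def using T A
        by (intro mult_left_mono integral_square_gaussian_scale) auto
      finally have "K\<^sup>2 / 4 * integral {0..T} f8 \<le> K\<^sup>2 / 4 * (105 / 8 / B ^ 3 * ((6 / 5) ^ 3 * I))"
        by (intro mult_left_mono) auto
      also have "\<dots> = (K\<^sup>2 / B ^ 3) * (567 / 100 * I)" by (simp add: power_divide)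
      also have "K\<^sup>2 / B ^ 3 = 441 / 400 * (36 / 25) ^ 3 / (l * z)"
      proof -
        have "K\<^sup>2 = 441 / 400 * (l * z)\<^sup>2 / t ^ 6"
          by (simp add: K_def power_mult_distrib power_divide flip: power_mult)
        moreover have "B ^ 3 = (l * z) ^ 3 * (25 / 36) ^ 3 / t ^ 6"
          by (simp add: B_def A_def power_mult_distrib power_divide flip: power_mult)
        ultimately show ?thesis using l z t by (simp add: eval_nat_numeral)
      qed
      also have "441 / 400 * (36 / 25) ^ 3 / (l * z) * (567 / 100 * I) \<le>
                   441 / 400 * (36 / 25) ^ 3 / (32 * (16449 / 10000)) * (567 / 100 * I)"
        using l z I_nonneg by (intro mult_right_mono divide_left_mono mult_mono mult_pos_pos) auto
      also have "\<dots> \<le> 355 / 1000 * I" using I_nonneg by (simp add: power_divide)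
      finally show ?thesis .
    qed
    ultimately show ?thesis using I_nonneg unfolding I_def f2_def by linarith
  qed

  have I_ge: "1 / 8 * (t ^ 3 / l\<^sup>2) \<le> 36 / 250 * I"
  proof -
    \<comment> \<open>Makes A q^2 = 6, as the polynomial minorant requires; q \<le> T amounts to
      6/(l z) \<le> (7/20)^2.\<close>
    define q where "q = sqrt (6 / A)"
    have q: "q > 0" "q\<^sup>2 = 6 / A" using A by (simp_all add: q_def)
    have q2: "q\<^sup>2 = 6 * t\<^sup>2 / (l * z)" using q t by (simp add: A_def)
    have lz: "32 * (16449 / 10000) \<le> l * z" using l z by (intro mult_mono) auto
    have "q \<le> T"
    proof (rule power2_le_imp_le)
      have "6 * t\<^sup>2 / (l * z) \<le> 6 * t\<^sup>2 / (32 * (16449 / 10000))"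
        using lz l z by (intro divide_left_mono mult_pos_pos) auto
      also have "\<dots> \<le> T\<^sup>2" by (simp add: T_def power_mult_distrib power_divide)
      finally show "q\<^sup>2 \<le> T\<^sup>2" unfolding q2 .
    qed (use T in simp)
    hence "227 / 10000 * q ^ 3 \<le> I"
      unfolding I_def using A q by (intro integral_square_gaussian_ge) auto
    moreover have "1 / 8 * (t ^ 3 / l\<^sup>2) \<le> 36 / 250 * (227 / 10000 * q ^ 3)"
    proof -
      \<comment> \<open>Trades l^(-3/2) for l^(-2): q l/t is the square root of 6 l/z, which is
        above 10.7 for l \<ge> 32.\<close>
      have "107 / 10 * t / l \<le> q"
      proof (rule power2_le_imp_le)
        have "(107 / 10 * t / l)\<^sup>2 = 11449 / 100 * t\<^sup>2 / (l * l)"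
          by (simp add: power_mult_distrib power_divide power2_eq_square)
        also have "\<dots> \<le> 6 * t\<^sup>2 / (l * z)"
        proof -
          have "11449 / 100 * z \<le> 11449 / 100 * (1645 / 1000)" using z by (intro mult_left_mono) auto
          hence "11449 / 100 * z \<le> 6 * l" using l by linarith
          hence "t\<^sup>2 * l * (11449 / 100 * z) \<le> t\<^sup>2 * l * (6 * l)"
            using l by (intro mult_left_mono) auto
          thus ?thesis using l z by (simp add: divide_simps mult_ac)
        qed
        finally show "(107 / 10 * t / l)\<^sup>2 \<le> q\<^sup>2" unfolding q2 .
      qed (use q in simp)
      hence q3: "107 / 10 * t / l * (6 * t\<^sup>2 / (l * z)) \<le> q * q\<^sup>2"
        unfolding q2 using l z by (intro mult_right_mono) auto
      define X where "X = t ^ 3 / l\<^sup>2"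
      have X: "X \<ge> 0" using t by (simp add: X_def)
      have "39 * X \<le> 321 / 5 / z * X"
        using z X by (intro mult_right_mono) (auto simp: pos_le_divide_eq)
      also have "\<dots> = 107 / 10 * t / l * (6 * t\<^sup>2 / (l * z))"
        by (simp add: X_def eval_nat_numeral)
      also note q3
      also have "q * q\<^sup>2 = q ^ 3" by (simp add: eval_nat_numeral)
      finally have "39 * X \<le> q ^ 3" .
      thus ?thesis using X unfolding X_def [symmetric] by linarith
    qed
    ultimately show ?thesis by linarith
  qed

  \<comment> \<open>The four tail constants, 79, 17, 8 and 21 thousandths, add up to exactly the 1/8
    secured by the main term.\<close>
  have tail: "t ^ 3 * (193 / 24000 * exp (- (147 / 1000 * l))) +
              t ^ 3 * (999 / 48000 * exp (- (227 / 1000 * l))) +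
              t ^ 3 * (1053 / 2000 * exp (- (357 / 1000 * l))) +
              2 * pi * exp (- (2 / 3 * l)) \<le> 1 / 8 * (t ^ 3 / l\<^sup>2)"
  proof -
    have "193 / 24000 * exp (- (147 / 1000 * l)) \<le> (79 / 1000) / l\<^sup>2"
      by (rule middle_bound[OF l, where b = "1157 / 1000"]) (simp_all add: power_divide power2_eq_square)
    hence 1: "t ^ 3 * (193 / 24000 * exp (- (147 / 1000 * l))) \<le> t ^ 3 * ((79 / 1000) / l\<^sup>2)"
      using t by (intro mult_left_mono) auto
    have "999 / 48000 * exp (- (227 / 1000 * l)) \<le> (17 / 1000) / l\<^sup>2"
      by (rule middle_bound[OF l, where b = "1252 / 1000"]) (simp_all add: power_divide power2_eq_square)
    hence 2: "t ^ 3 * (999 / 48000 * exp (- (227 / 1000 * l))) \<le> t ^ 3 * ((17 / 1000) / l\<^sup>2)"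
      using t by (intro mult_left_mono) auto
    have "1053 / 2000 * exp (- (357 / 1000 * l)) \<le> (8 / 1000) / l\<^sup>2"
      by (rule middle_bound[OF l, where b = "142 / 100"]) (simp_all add: power_divide power2_eq_square)
    hence 3: "t ^ 3 * (1053 / 2000 * exp (- (357 / 1000 * l))) \<le> t ^ 3 * ((8 / 1000) / l\<^sup>2)"
      using t by (intro mult_left_mono) auto
    have 4: "2 * pi * exp (- (2 / 3 * l)) \<le> 21 / 1000 * t ^ 3 / l\<^sup>2"
      using l t lt k by (intro far_bound) auto
    have "t ^ 3 * ((79 / 1000) / l\<^sup>2) + t ^ 3 * ((17 / 1000) / l\<^sup>2) + t ^ 3 * ((8 / 1000) / l\<^sup>2) +
            21 / 1000 * t ^ 3 / l\<^sup>2 = 1 / 8 * (t ^ 3 / l\<^sup>2)"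
      by (simp add: field_simps)
    thus ?thesis using 1 2 3 4 by linarith
  qed

  \<comment> \<open>147/1000, 227/1000 and 357/1000 round down 27/20 * c^2/(1 + c^2) at the left
    ends c = 7/20, 9/20 and 3/5.\<close>
  have m1: "- (t ^ 3 * (193 / 24000 * exp (- (147 / 1000 * l)))) \<le> integral {T..9 / 20 * t} E"
    using middle[of "7 / 20" "9 / 20" "147 / 1000"] by (simp add: T_def power_divide)
  have m2: "- (t ^ 3 * (999 / 48000 * exp (- (227 / 1000 * l)))) \<le> integral {9 / 20 * t..3 / 5 * t} E"
    using middle[of "9 / 20" "3 / 5" "227 / 1000"] by (simp add: power_divide)
  have m3: "- (t ^ 3 * (1053 / 2000 * exp (- (357 / 1000 * l)))) \<le> integral {3 / 5 * t..3 / 2 * t} E"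
    using middle[of "3 / 5" "3 / 2" "357 / 1000"] by (simp add: power_divide)
  have "integral {0..pi} E = integral {0..T} E + integral {T..pi} E"
    using T T_pi by (intro Henstock_Kurzweil_Integration.integral_combine [symmetric] E_integrable) auto
  also have "integral {T..pi} E = integral {T..9 / 20 * t} E + integral {9 / 20 * t..pi} E"
    using T T_pi t by (intro Henstock_Kurzweil_Integration.integral_combine [symmetric] int) (auto simp: T_def)
  also have "integral {9 / 20 * t..pi} E = integral {9 / 20 * t..3 / 5 * t} E + integral {3 / 5 * t..pi} E"
    using T_pi t by (intro Henstock_Kurzweil_Integration.integral_combine [symmetric] int) auto
  also have "integral {3 / 5 * t..pi} E = integral {3 / 5 * t..3 / 2 * t} E + integral {3 / 2 * t..pi} E"
    using T_pi t by (intro Henstock_Kurzweil_Integration.integral_combine [symmetric] int) auto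
  finally have "0 \<le> integral {0..pi} E"
    using core_int I_ge tail m1 m2 m3 far by linarith
  hence "0 \<le> exp (log_modulus k (exp (- t)) 0) * integral {0..pi} E" by simp
  also have "\<dots> = integral {0..pi} (\<lambda>\<theta>. exp (log_modulus k (exp (- t)) 0) * E \<theta>)"
    by (rule integral_mult_right [symmetric])
  also have "(\<lambda>\<theta>. exp (log_modulus k (exp (- t)) 0) * E \<theta>) =
      (\<lambda>\<theta>. exp (log_modulus k (exp (- t)) \<theta>) * cos (log_phase k (exp (- t)) \<theta> - real N * \<theta>) * (1 - cos \<theta>))"
    by (auto simp: E_def h_def p_def mult.assoc [symmetric] simp flip: exp_add)
  finally show ?thesis .
qed

lemma log_concave_large:
  assumes k: "2 \<le> k" "k \<le> 5" and n: "1685 \<le> k * Suc n"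
  shows "colored_partitions k n * colored_partitions k (Suc (Suc n)) \<le> (colored_partitions k (Suc n))\<^sup>2"
proof -
  \<comment> \<open>t \<le> k/32 gives \<lambda> \<ge> 32, and k \<le> 5 gives t \<le> 5/32. The
    bound 1685 is 1024 * 1.645 rounded up.\<close>
  define T where "T = real k / 32"
  have T: "T > 0" using k by (simp add: T_def)
  have tilt: "real k * (pi\<^sup>2 / 6) / T\<^sup>2 \<le> real (Suc n)"
  proof -
    have "real k * (pi\<^sup>2 / 6) / T\<^sup>2 = 1024 * (pi\<^sup>2 / 6) / real k"
      using k by (simp add: T_def power2_eq_square)
    also have "\<dots> \<le> real (Suc n)"
    proof -
      have "1024 * (pi\<^sup>2 / 6) \<le> 1685" using pi_squared_bounds(2) by linarith
      also have "1685 \<le> real (k * Suc n)" using n of_nat_le_iff[of 1685 "k * Suc n"] by simp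
      finally show ?thesis using k by (simp add: pos_divide_le_eq algebra_simps)
    qed
    finally show ?thesis .
  qed
  obtain t where t: "0 < t" "t \<le> T" "real k * (\<Sum>n. real n * log_coeff n * exp (- t) ^ n) = real (Suc n)"
    by (rule exists_tilt[OF _ T tilt]) (use k in auto)
  have r: "0 < exp (- t)" "exp (- t) < 1" using t by auto
  have "(\<lambda>\<theta>. exp (log_modulus k (exp (- t)) \<theta>) * cos (log_phase k (exp (- t)) \<theta> - real (Suc n) * \<theta>) *
          (1 - cos \<theta>)) integrable_on {0..pi}"
    by (rule integrable_subinterval_real[OF has_integral_integrable[OF has_integral_concavity[OF r]]]) auto
  hence "0 \<le> integral {0..pi} (\<lambda>\<theta>. exp (log_modulus k (exp (- t)) \<theta>) *
           cos (log_phase k (exp (- t)) \<theta> - real (Suc n) * \<theta>) * (1 - cos \<theta>))"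
    using k t by (intro integral_concavity_nonneg) (auto simp: T_def)
  thus ?thesis using k by (intro log_concave_if_integral_nonneg[OF r]) auto
qed

section \<open>Log-concavity\<close>

lemma log_concave_from_5_colored_partitions_2: "log_concave_from 5 (colored_partitions 2)"
  unfolding log_concave_from_def
proof (intro allI impI)
  fix n :: nat assume "5 \<le> n"
  thus "colored_partitions 2 n * colored_partitions 2 (Suc (Suc n)) \<le> (colored_partitions 2 (Suc n))\<^sup>2"
    using log_concave_small(1)[of n] log_concave_large[of 2 n] by (cases "n \<le> 841") auto
qed

lemma log_concave_from_0_colored_partitions:
  assumes "k \<ge> 3"
  shows "log_concave_from 0 (colored_partitions k)"
  using assms
proof (induction k rule: less_induct)
  case (less k)
  consider "k = 3" | "k = 4" | "k = 5" | "k \<ge> 6" using less.prems by linarith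
  thus ?case
  proof cases
    case 1
    have "colored_partitions 3 n * colored_partitions 3 (Suc (Suc n)) \<le> (colored_partitions 3 (Suc n))\<^sup>2" for n
      using log_concave_small(2)[of n] log_concave_large[of 3 n] by (cases "n \<le> 560") auto
    thus ?thesis using 1 by (simp add: log_concave_from_def)
  next
    case 2
    have "colored_partitions 4 n * colored_partitions 4 (Suc (Suc n)) \<le> (colored_partitions 4 (Suc n))\<^sup>2" for n
      using log_concave_small(3)[of n] log_concave_large[of 4 n] by (cases "n \<le> 420") auto
    thus ?thesis using 2 by (simp add: log_concave_from_def)
  next
    case 3
    have "colored_partitions 5 n * colored_partitions 5 (Suc (Suc n)) \<le> (colored_partitions 5 (Suc n))\<^sup>2" for n
      using log_concave_small(4)[of n] log_concave_large[of 5 n] by (cases "n \<le> 335") auto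
    thus ?thesis using 3 by (simp add: log_concave_from_def)
  next
    case 4
    have "log_concave_from 0 (\<lambda>n. \<Sum>i=0..n. colored_partitions 3 i * colored_partitions (k - 3) (n - i))"
      using 4 by (intro log_concave_from_convolution less.IH colored_partitions_pos) auto
    also have "(\<lambda>n. \<Sum>i=0..n. colored_partitions 3 i * colored_partitions (k - 3) (n - i)) =
                 colored_partitions k"
      using 4 by (simp add: fun_eq_iff flip: colored_partitions_add)
    finally show ?thesis .
  qed
qed

section \<open>Two colors: the first few terms\<close>

lemma divisor_sum_eq: "divisor_sum n = sum_list (filter (\<lambda>d. d dvd n) [1..<Suc n])"
proof (cases "n = 0")
  case False
  have "set (filter (\<lambda>d. d dvd n) [1..<Suc n]) = {d. d dvd n}"
    using False by (auto dest: dvd_imp_le intro: Suc_leI dvd_pos_nat)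
  moreover have "distinct (filter (\<lambda>d. d dvd n) [1..<Suc n])" by simp
  ultimately show ?thesis
    unfolding divisor_sum_def using sum_list_distinct_conv_sum_set[of _ "\<lambda>d. d"] by (metis map_ident)
qed simp

lemma colored_partitions_2_values:
  "colored_partitions 2 1 = 2" "colored_partitions 2 2 = 5" "colored_partitions 2 3 = 10"
  "colored_partitions 2 4 = 20" "colored_partitions 2 5 = 36" "colored_partitions 2 6 = 65"
  "colored_partitions 2 7 = 110"
proof -
  have s: "divisor_sum 1 = 1" "divisor_sum 2 = 3" "divisor_sum 3 = 4" "divisor_sum 4 = 7"
    "divisor_sum 5 = 6" "divisor_sum 6 = 12" "divisor_sum 7 = 8"
    unfolding divisor_sum_eq by code_simp+
  have rec: "real n * colored_partitions 2 n =
               2 * (\<Sum>i\<in>{0..n}. real (divisor_sum i) * colored_partitions 2 (n - i))" for n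
    using colored_partitions_rec[of n 2] by simp
  show 1: "colored_partitions 2 1 = 2" using rec[of 1] s by simp
  show 2: "colored_partitions 2 2 = 5"
    using rec[of 2] s 1 by (simp add: numeral_eq_Suc)
  show 3: "colored_partitions 2 3 = 10"
    using rec[of 3] s 1 2 by (simp add: numeral_eq_Suc)
  show 4: "colored_partitions 2 4 = 20"
    using rec[of 4] s 1 2 3 by (simp add: numeral_eq_Suc)
  show 5: "colored_partitions 2 5 = 36"
    using rec[of 5] s 1 2 3 4 by (simp add: numeral_eq_Suc)
  show 6: "colored_partitions 2 6 = 65"
    using rec[of 6] s 1 2 3 4 5 by (simp add: numeral_eq_Suc)
  show 7: "colored_partitions 2 7 = 110"
    using rec[of 7] s 1 2 3 4 5 6 by (simp add: numeral_eq_Suc)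
qed

text \<open>Log-concavity from center 6 on settles l \<ge> 5. For l \<le> 4 and n \<ge> 7 the ratio
  p(n)/p(n-1) is at most 110/65, while p(l+1)/p(l) is at least 36/20. The other pairs are compared
  directly; at (6, 4) one has 65 * 20 > 36^2.\<close>

lemma colored_partitions_2_cross:
  assumes "1 \<le> l" "l < n" "(n, l) \<noteq> (6, 4)"
  shows "colored_partitions 2 n * colored_partitions 2 l \<le> colored_partitions 2 (n - 1) * colored_partitions 2 (l + 1)"
proof (cases "l \<ge> 5")
  case True
  have "colored_partitions 2 l * colored_partitions 2 (Suc (n - 1)) \<le>
          colored_partitions 2 (Suc l) * colored_partitions 2 (n - 1)"
    using True assms
    by (intro log_concave_from_cross[OF log_concave_from_5_colored_partitions_2] colored_partitions_pos) auto
  thus ?thesis using assms by (simp add: mult.commute)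
next
  case False
  note vals = colored_partitions_2_values
  from False assms have l: "l = 1 \<or> l = 2 \<or> l = 3 \<or> l = 4" by linarith
  show ?thesis
  proof (cases "n \<ge> 7")
    case True
    \<comment> \<open>Index 6 and not 5: since 65/36 exceeds 36/20, the bound from index 5 would be
      too weak for l = 4.\<close>
    have "colored_partitions 2 6 * colored_partitions 2 (Suc (n - 1)) \<le>
          colored_partitions 2 (Suc 6) * colored_partitions 2 (n - 1)"
      using True
      by (intro log_concave_from_cross[OF log_concave_from_5_colored_partitions_2] colored_partitions_pos) auto
    hence "65 * colored_partitions 2 n \<le> 110 * colored_partitions 2 (n - 1)"
      using True vals by simp
    moreover have "colored_partitions 2 n > 0" "colored_partitions 2 (n - 1) > 0"
      by (simp_all add: colored_partitions_pos)
    ultimately show ?thesis using l vals by (auto simp: numeral_eq_Suc)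
  next
    case False
    hence "n = 2 \<or> n = 3 \<or> n = 4 \<or> n = 5 \<or> n = 6" using assms by linarith
    thus ?thesis using l assms vals by (auto simp: numeral_eq_Suc)
  qed
qed

theorem corollary1p4:
  shows "(\<forall>k n l :: nat. k \<ge> 2 \<and> n \<ge> 1 \<and> l \<ge> 1 \<and> n > l \<and> (k, n, l) \<noteq> (2, 6, 4) \<longrightarrow>
            colored_partitions k (n - 1) * colored_partitions k (l + 1)
              \<ge> colored_partitions k n * colored_partitions k l)
       \<and> (\<forall>n\<ge>6. (colored_partitions 2 n)\<^sup>2
              \<ge> colored_partitions 2 (n - 1) * colored_partitions 2 (n + 1))
       \<and> (\<forall>k\<ge>3. \<forall>n\<ge>1. (colored_partitions k n)\<^sup>2
              \<ge> colored_partitions k (n - 1) * colored_partitions k (n + 1))"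
proof (intro conjI allI impI)
  fix k n l :: nat
  assume *: "k \<ge> 2 \<and> n \<ge> 1 \<and> l \<ge> 1 \<and> n > l \<and> (k, n, l) \<noteq> (2, 6, 4)"
  show "colored_partitions k (n - 1) * colored_partitions k (l + 1)
          \<ge> colored_partitions k n * colored_partitions k l"
  proof (cases "k = 2")
    case True
    thus ?thesis using colored_partitions_2_cross[of l n] * by simp
  next
    case False
    have "colored_partitions k l * colored_partitions k (Suc (n - 1)) \<le>
            colored_partitions k (Suc l) * colored_partitions k (n - 1)"
      using False * by (intro log_concave_from_cross[of 0] log_concave_from_0_colored_partitions
          colored_partitions_pos) auto
    thus ?thesis using * by (simp add: mult.commute)
  qed
next
  fix n :: nat assume "n \<ge> 6"
  thus "(colored_partitions 2 n)\<^sup>2 \<ge> colored_partitions 2 (n - 1) * colored_partitions 2 (n + 1)"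
    using log_concave_from_5_colored_partitions_2[unfolded log_concave_from_def, rule_format, of "n - 1"]
    by simp
next
  fix k n :: nat assume "k \<ge> 3" "n \<ge> 1"
  thus "(colored_partitions k n)\<^sup>2 \<ge> colored_partitions k (n - 1) * colored_partitions k (n + 1)"
    using log_concave_from_0_colored_partitions[unfolded log_concave_from_def, rule_format, of k "n - 1"]
    by simp
qed

end
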